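(* Let $n\ge1$, $\hbar>0$ and $p\in\mathbb{C}^n$. For all $\alpha\in\mathbb{C}$ and $f,g\in\mathcal{A}_{p,\hbar}$ the Wick star product $$f\star^\alpha_{\mathrm{Wick}}g=\sum_{N=0}^\infty\frac{(2\alpha)^{|N|}}{N!}\frac{\partial^{|N|}f}{\partial z^N}\frac{\partial^{|N|}g}{\partial\overline{z}^N}$$ converges absolutely in the topology of $\mathcal{A}_{p,\hbar}$ and gives a continuous associative product on $\mathcal{A}_{p,\hbar}$. If $\alpha=\hbar>0$, then $\mathcal{A}_{p,\hbar}$ becomes a Fréchet $^*$-algebra with respect to $\star^\hbar_{\mathrm{Wick}}$ as the product and complex conjugation as the $^*$-involution.
   Context: Conventions: $\mathbb{N}=\{0,1,2,\dots\}$; $z=(z^1,\dots,z^n)$ are the standard holomorphic coordinates on $\mathbb{C}^n$; multiindex notation is the usual componentwise one; $\sum_{N=0}^\infty$ means summation over $N\in\mathbb{N}^n$ and $\sum_{I=0}^R$ summation over $I\in\mathbb{N}^n$ with $I\le R$. A Fréchet algebra is a Fréchet space with a jointly continuous bilinear product; a Fréchet $^*$-algebra has in addition a continuous antilinear involutive anti-automorphism. A series converges absolutely if it converges and, for every continuous seminorm, the series of seminorms of its terms converges. For $f\in C^\infty(\mathbb{C}^n)$, $m\in\mathbb{N}$, $\ell\in\{0,\dots,2^m-1\}$, $R,S\in\mathbb{N}^n$ define recursively, with values in $[0,+\infty]$, $$h^{p,\hbar}_{0,0,R,S}(f)=\sum_{N=0}^\infty\frac{(2\hbar)^{|R|+|S|+|N|}}{N!}\left|\frac{\partial^{|R|+|S|+|N|}f}{\partial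 z^R\partial\overline{z}^{N+S}}(p)\right|^2,$$ and for $m\ge1$ $$h^{p,\hbar}_{m,\ell,R,S}(f)=\sum_{N=0}^\infty\frac1{N!}\Big(\sum_{I=0}^R\sum_{J=0}^{N+S}\tbinom{R}{I}\tbinom{N+S}{J}h^{p,\hbar}_{m-1,\ell/2,I,J}(f)\Big)^2\quad(\ell\text{ even}),$$ $$h^{p,\hbar}_{m,\ell,R,S}(f)=\sum_{N=0}^\infty\frac1{N!}\Big(\sum_{I=0}^R\sum_{J=0}^{N+S}\tbinom{R}{I}\tbinom{N+S}{J}h^{p,\hbar}_{m-1,(\ell-1)/2,J,I}(f)\Big)^2\quad(\ell\text{ odd}).$$ Put $\|f\|^{p,\hbar}_{m,\ell,R,S}=\big(h^{p,\hbar}_{m,\ell,R,S}(f)\big)^{1/2^{m+1}}$ and $\widetilde{\mathcal{A}}_{p,\hbar}=\{f\in C^\infty(\mathbb{C}^n)\mid \|f\|^{p,\hbar}_{m,\ell,R,S}<\infty\text{ for all }m,\ell,R,S\}$, a vector space on which these are seminorms. Define $\mathcal{A}_{p,\hbar}=\widetilde{\mathcal{A}}_{p,\hbar}/\{f\in C^\infty(\mathbb{C}^n)\mid \mathsf{j}^\infty_pf=0\}$ (quotient by the functions with vanishing $\infty$-jet at $p$), with the topology induced by all the seminorms; it is a Fréchet space. Every class has a unique real-analytic representative, so $\mathcal{A}_{p,\hbar}$ is identified with a subspace of $C^\omega(\mathbb{C}^n)$. *)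

theory Defs
  imports "HOL-Analysis.Analysis" "HOL-Algebra.Module"
begin

section \<open>Smooth functions, Wirtinger derivatives and jets on \<open>\<complex>\<^sup>n\<close>\<close>

text \<open>The space \<open>\<complex>\<^sup>n\<close> is \<^typ>\<open>complex ^ 'n\<close>, and multiindices are elements of \<^typ>\<open>nat ^ 'n\<close>, with the
  componentwise sum and order. \<^const>\<open>frechet_derivative\<close> is the real-linear derivative, so
  \<open>dir_deriv v\<close> is the derivative in the real direction \<open>v\<close>.\<close>

definition dir_deriv ::
    "complex ^ 'n \<Rightarrow> (complex ^ 'n \<Rightarrow> complex) \<Rightarrow> complex ^ 'n \<Rightarrow> complex" where
  "dir_deriv v f = (\<lambda>x. frechet_derivative f (at x) v)"

text \<open>A function is smooth iff all its iterated directional derivatives are (totally, real)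
  differentiable everywhere; the empty list of directions covers the function itself.\<close>

definition smooth :: "(complex ^ 'n \<Rightarrow> complex) \<Rightarrow> bool" where
  "smooth f \<longleftrightarrow> (\<forall>vs x. fold dir_deriv vs f differentiable (at x))"

definition jet_null :: "complex ^ 'n \<Rightarrow> (complex ^ 'n \<Rightarrow> complex) set" where
  "jet_null p = {f. smooth f \<and> (\<forall>vs. fold dir_deriv vs f p = 0)}"

definition dz :: "'n \<Rightarrow> (complex ^ 'n \<Rightarrow> complex) \<Rightarrow> complex ^ 'n \<Rightarrow> complex" where
  "dz i f = (\<lambda>x. (dir_deriv (axis i 1) f x - \<i> * dir_deriv (axis i \<i>) f x) / 2)"

definition dzbar :: "'n \<Rightarrow> (complex ^ 'n \<Rightarrow> complex) \<Rightarrow> complex ^ 'n \<Rightarrow> complex" where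
  "dzbar i f = (\<lambda>x. (dir_deriv (axis i 1) f x + \<i> * dir_deriv (axis i \<i>) f x) / 2)"

text \<open>The index type carries no order, so some enumeration of it is fixed. On smooth functions partial
  derivatives commute and the choice is irrelevant.\<close>

definition index_list :: "'n::finite list" where
  "index_list = (SOME xs. distinct xs \<and> set xs = UNIV)"

definition multi_deriv :: "('n::finite \<Rightarrow> 'f \<Rightarrow> 'f) \<Rightarrow> nat ^ 'n \<Rightarrow> 'f \<Rightarrow> 'f" where
  "multi_deriv d R f = fold (\<lambda>i. d i ^^ (R $ i)) index_list f"

text \<open>\<open>wirtinger R S f\<close> differentiates \<open>R\<close> times in \<open>z\<close> and \<open>S\<close> times in \<open>z\<close>-bar.\<close>

definition wirtinger ::
    "nat ^ 'n \<Rightarrow> nat ^ 'n \<Rightarrow> (complex ^ 'n \<Rightarrow> complex) \<Rightarrow> complex ^ 'n \<Rightarrow> complex" where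
  "wirtinger R S f = multi_deriv dz R (multi_deriv dzbar S f)"

definition mi_abs :: "nat ^ 'n \<Rightarrow> nat" where
  "mi_abs R = (\<Sum>i\<in>UNIV. R $ i)"

definition mi_fact :: "nat ^ 'n \<Rightarrow> real" where
  "mi_fact R = (\<Prod>i\<in>UNIV. fact (R $ i))"

definition mi_binom :: "nat ^ 'n \<Rightarrow> nat ^ 'n \<Rightarrow> nat" where
  "mi_binom R I = (\<Prod>i\<in>UNIV. (R $ i) choose (I $ i))"


section \<open>The space \<open>\<A>\<close> of jets\<close>

text \<open>Sums over \<open>\<nat>\<^sup>n\<close> of terms in \<open>[0, \<infinity>]\<close> are infinite sums in \<^typ>\<open>ennreal\<close>, which always exist.\<close>

primrec h :: "real \<Rightarrow> complex ^ 'n \<Rightarrow> nat \<Rightarrow> nat \<Rightarrow> nat ^ 'n \<Rightarrow> nat ^ 'n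
    \<Rightarrow> (complex ^ 'n \<Rightarrow> complex) \<Rightarrow> ennreal" where
  "h hb p 0 l R S f =
    (\<Sum>\<^sub>\<infinity>N. ennreal ((2 * hb) ^ (mi_abs R + mi_abs S + mi_abs N) / mi_fact N
                  * (cmod (wirtinger R (N + S) f p))\<^sup>2))"
| "h hb p (Suc m) l R S f =
    (if even l then
      (\<Sum>\<^sub>\<infinity>N. ennreal (1 / mi_fact N) *
        (\<Sum>I\<le>R. \<Sum>J\<le>N + S. of_nat (mi_binom R I * mi_binom (N + S) J)
             * h hb p m (l div 2) I J f)\<^sup>2)
     else
      (\<Sum>\<^sub>\<infinity>N. ennreal (1 / mi_fact N) *
        (\<Sum>I\<le>R. \<Sum>J\<le>N + S. of_nat (mi_binom R I * mi_binom (N + S) J)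
             * h hb p m ((l - 1) div 2) J I f)\<^sup>2))"

text \<open>Only meaningful where \<^const>\<open>h\<close> is finite, since \<^const>\<open>enn2real\<close> sends \<open>\<infinity>\<close> to \<open>0\<close>.\<close>

definition A_norm :: "real \<Rightarrow> complex ^ 'n \<Rightarrow> nat \<Rightarrow> nat \<Rightarrow> nat ^ 'n \<Rightarrow> nat ^ 'n
    \<Rightarrow> (complex ^ 'n \<Rightarrow> complex) \<Rightarrow> real" where
  "A_norm hb p m l R S f = root (2 ^ (m + 1)) (enn2real (h hb p m l R S f))"

definition A_tilde :: "real \<Rightarrow> complex ^ 'n \<Rightarrow> (complex ^ 'n \<Rightarrow> complex) set" where
  "A_tilde hb p = {f. smooth f \<and> (\<forall>m l R S. l < 2 ^ m \<longrightarrow> h hb p m l R S f < \<infinity>)}"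

definition jet_rel ::
    "real \<Rightarrow> complex ^ 'n \<Rightarrow> ((complex ^ 'n \<Rightarrow> complex) \<times> (complex ^ 'n \<Rightarrow> complex)) set" where
  "jet_rel hb p =
    {(f, g). f \<in> A_tilde hb p \<and> g \<in> A_tilde hb p \<and> (\<lambda>x. f x - g x) \<in> jet_null p}"

text \<open>Functions \<open>u\<close> on representatives that respect \<^const>\<open>jet_rel\<close> descend to the quotient as
  \<open>F \<mapsto> \<Union>f\<in>F. jet_rel hb p `` {u f}\<close>, as in \<^theory>\<open>HOL.Equiv_Relations\<close>. The
  multiplication and unit given here are the pointwise ones, that is, those of \<open>\<alpha> = 0\<close>;
  \<open>wick_algebra\<close> below replaces the multiplication.\<close>

definition A_space ::
    "real \<Rightarrow> complex ^ 'n \<Rightarrow> (complex, (complex ^ 'n \<Rightarrow> complex) set) module" where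
  "A_space hb p =
    \<lparr>carrier = A_tilde hb p // jet_rel hb p,
     monoid.mult = (\<lambda>F G. \<Union>f\<in>F. \<Union>g\<in>G. jet_rel hb p `` {\<lambda>x. f x * g x}),
     one = jet_rel hb p `` {\<lambda>x. 1},
     zero = jet_rel hb p `` {\<lambda>x. 0},
     add = (\<lambda>F G. \<Union>f\<in>F. \<Union>g\<in>G. jet_rel hb p `` {\<lambda>x. f x + g x}),
     smult = (\<lambda>c F. \<Union>f\<in>F. jet_rel hb p `` {\<lambda>x. c * f x})\<rparr>"

definition A_conj :: "real \<Rightarrow> complex ^ 'n \<Rightarrow> (complex ^ 'n \<Rightarrow> complex) set
    \<Rightarrow> (complex ^ 'n \<Rightarrow> complex) set" where
  "A_conj hb p F = (\<Union>f\<in>F. jet_rel hb p `` {\<lambda>x. cnj (f x)})"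

text \<open>The seminorms depend only on the jet at \<open>p\<close>, so each is constant on every class.\<close>

definition A_seminorms :: "real \<Rightarrow> complex ^ 'n \<Rightarrow> ((complex ^ 'n \<Rightarrow> complex) set \<Rightarrow> real) set" where
  "A_seminorms hb p =
    {(\<lambda>F. the_elem (A_norm hb p m l R S ` F)) | m l R S. l < 2 ^ m}"


section \<open>Frechet algebras\<close>

definition complex_ring :: "complex ring" where
  "complex_ring = \<lparr>carrier = UNIV, monoid.mult = (*), one = 1, zero = 0, add = (+)\<rparr>"

definition seminorm_on :: "(complex, 'a, 'm) module_scheme \<Rightarrow> ('a \<Rightarrow> real) \<Rightarrow> bool" where
  "seminorm_on M q \<longleftrightarrow>
    (\<forall>x\<in>carrier M. 0 \<le> q x) \<and>
    (\<forall>c. \<forall>x\<in>carrier M. q (c \<odot>\<^bsub>M\<^esub> x) = cmod c * q x) \<and>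
    (\<forall>x\<in>carrier M. \<forall>y\<in>carrier M. q (x \<oplus>\<^bsub>M\<^esub> y) \<le> q x + q y)"

definition seminorm_topology ::
    "(complex, 'a, 'm) module_scheme \<Rightarrow> ('a \<Rightarrow> real) set \<Rightarrow> 'a topology" where
  "seminorm_topology M Q = topology_generated_by
    {{y \<in> carrier M. q (y \<ominus>\<^bsub>M\<^esub> x) < \<epsilon>} | q x \<epsilon>. q \<in> Q \<and> x \<in> carrier M \<and> 0 < \<epsilon>}"

locale frechet_space = module complex_ring M
  for M :: "(complex, 'a, 'm) module_scheme" (structure) and T :: "'a topology" +
  assumes hausdorff: "Hausdorff_space T"
    and complete_seminorms:
      "\<exists>q :: nat \<Rightarrow> 'a \<Rightarrow> real.
        (\<forall>k. seminorm_on M (q k)) \<and> T = seminorm_topology M (range q) \<and>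
        (\<forall>s :: nat \<Rightarrow> 'a.
          (\<forall>i. s i \<in> carrier M) \<and>
          (\<forall>k. \<forall>\<epsilon>>0. \<exists>n. \<forall>i\<ge>n. \<forall>j\<ge>n. q k (s i \<ominus> s j) < \<epsilon>)
          \<longrightarrow> (\<exists>x\<in>carrier M. limitin T s x sequentially))"

text \<open>The product of the algebra is the multiplication of \<open>M\<close>; neither associativity nor a unit is
  part of this notion.\<close>

locale frechet_algebra = frechet_space +
  assumes mult_closed:
      "x \<in> carrier M \<Longrightarrow> y \<in> carrier M \<Longrightarrow> x \<otimes> y \<in> carrier M"
    and mult_add_left:
      "x \<in> carrier M \<Longrightarrow> y \<in> carrier M \<Longrightarrow> z \<in> carrier M
        \<Longrightarrow> (x \<oplus> y) \<otimes> z = x \<otimes> z \<oplus> y \<otimes> z"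
    and mult_add_right:
      "x \<in> carrier M \<Longrightarrow> y \<in> carrier M \<Longrightarrow> z \<in> carrier M
        \<Longrightarrow> x \<otimes> (y \<oplus> z) = x \<otimes> y \<oplus> x \<otimes> z"
    and mult_smult_left:
      "x \<in> carrier M \<Longrightarrow> y \<in> carrier M \<Longrightarrow> (c \<odot>\<^bsub>M\<^esub> x) \<otimes> y = c \<odot>\<^bsub>M\<^esub> (x \<otimes> y)"
    and mult_smult_right:
      "x \<in> carrier M \<Longrightarrow> y \<in> carrier M \<Longrightarrow> x \<otimes> (c \<odot>\<^bsub>M\<^esub> y) = c \<odot>\<^bsub>M\<^esub> (x \<otimes> y)"
    and mult_continuous:
      "continuous_map (prod_topology T T) T (\<lambda>(x, y). x \<otimes> y)"

locale frechet_star_algebra = frechet_algebra +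
  fixes inv_star :: "'a \<Rightarrow> 'a"
  assumes star_closed: "x \<in> carrier M \<Longrightarrow> inv_star x \<in> carrier M"
    and star_add:
      "x \<in> carrier M \<Longrightarrow> y \<in> carrier M \<Longrightarrow> inv_star (x \<oplus> y) = inv_star x \<oplus> inv_star y"
    and star_smult: "x \<in> carrier M \<Longrightarrow> inv_star (c \<odot>\<^bsub>M\<^esub> x) = cnj c \<odot>\<^bsub>M\<^esub> inv_star x"
    and star_star: "x \<in> carrier M \<Longrightarrow> inv_star (inv_star x) = x"
    and star_mult:
      "x \<in> carrier M \<Longrightarrow> y \<in> carrier M \<Longrightarrow> inv_star (x \<otimes> y) = inv_star y \<otimes> inv_star x"
    and star_continuous: "continuous_map T T inv_star"

definition series_limit ::
    "(complex, 'a, 'm) module_scheme \<Rightarrow> 'a topology \<Rightarrow> ('i \<Rightarrow> 'a) \<Rightarrow> 'a \<Rightarrow> bool" where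
  "series_limit M T t x \<longleftrightarrow>
    limitin T (\<lambda>K. finsum M t K) x (finite_subsets_at_top UNIV)"

definition abs_convergent_to ::
    "(complex, 'a, 'm) module_scheme \<Rightarrow> 'a topology \<Rightarrow> ('i \<Rightarrow> 'a) \<Rightarrow> 'a \<Rightarrow> bool" where
  "abs_convergent_to M T t x \<longleftrightarrow>
    (\<forall>i. t i \<in> carrier M) \<and> series_limit M T t x \<and>
    (\<forall>q. seminorm_on M q \<and> continuous_map T euclideanreal q \<longrightarrow> (\<lambda>i. q (t i)) summable_on UNIV)"


section \<open>The Wick star product on \<open>\<A>\<close>\<close>

definition A_topology :: "real \<Rightarrow> complex ^ 'n \<Rightarrow> (complex ^ 'n \<Rightarrow> complex) set topology" where
  "A_topology hb p = seminorm_topology (A_space hb p) (A_seminorms hb p)"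

text \<open>The class of a term depends only on the jets of the factors at \<open>p\<close>, so taking all
  representatives agrees with taking the unique real-analytic one.\<close>

definition wick_term :: "real \<Rightarrow> complex ^ 'n \<Rightarrow> complex \<Rightarrow> (complex ^ 'n \<Rightarrow> complex) set
    \<Rightarrow> (complex ^ 'n \<Rightarrow> complex) set \<Rightarrow> nat ^ 'n \<Rightarrow> (complex ^ 'n \<Rightarrow> complex) set" where
  "wick_term hb p \<alpha> F G N =
    (\<Union>f\<in>F. \<Union>g\<in>G. jet_rel hb p ``
      {\<lambda>x. (2 * \<alpha>) ^ mi_abs N / of_real (mi_fact N) * wirtinger N 0 f x * wirtinger 0 N g x})"

definition wick :: "real \<Rightarrow> complex ^ 'n \<Rightarrow> complex \<Rightarrow> (complex ^ 'n \<Rightarrow> complex) set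
    \<Rightarrow> (complex ^ 'n \<Rightarrow> complex) set \<Rightarrow> (complex ^ 'n \<Rightarrow> complex) set" where
  "wick hb p \<alpha> F G =
    (THE L. series_limit (A_space hb p) (A_topology hb p) (wick_term hb p \<alpha> F G) L)"

definition wick_algebra ::
    "real \<Rightarrow> complex ^ 'n \<Rightarrow> complex \<Rightarrow> (complex, (complex ^ 'n \<Rightarrow> complex) set) module" where
  "wick_algebra hb p \<alpha> = (A_space hb p)\<lparr>monoid.mult := wick hb p \<alpha>\<rparr>"

end

theory Submission
  imports Defs
begin

text \<open>Write \<open>a\<^sub>K\<close> for the derivatives of \<open>f\<close> at \<open>p\<close>, where \<open>K\<close> ranges over the multiindices in the
  \<open>2 n\<close> directions \<open>z\<close>, \<open>z\<close>-bar. The seminorms of \<open>\<A>\<close> define the same topology as the norms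
  \<open>sup |a\<^sub>K| / K! powr \<epsilon>\<close>, one for each \<open>\<epsilon> > 0\<close>: nesting \<open>m\<close> squares turns a factor \<open>N!\<close>
  into \<open>N! powr (1 / 2 ^ m)\<close>, and conversely every sum in the definition of \<open>h\<close> is absorbed by
  \<open>1 / N!\<close>. So \<open>\<A>\<close> is the space of arrays growing more slowly than every power of the factorial, all of
  which are jets of entire functions of \<open>z\<close>, \<open>z\<close>-bar, and it depends on neither \<open>p\<close> nor \<open>\<hbar>\<close>. On such
  arrays the Wick product converges absolutely, because its factor \<open>1 / N!\<close> beats \<open>(N!)\<^sup>2\<close> to the
  power \<open>\<epsilon>\<close>. Derivatives act as derivations of the product, so associativity needs to be checked only
  at the index \<open>0\<close>, where both sides are the same triple series.\<close>

section \<open>Multiindices\<close>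

text \<open>The values of \<open>h\<close> are out of reach, so they are only bounded. From above,
  each level of the recursion costs an arbitrarily small power of the factorial; the estimates
  therefore trade an exponent for a smaller one. From below, a single term of every sum is kept.
  Here the digits of the second index matter: the summation index \<open>N\<close> enters only
  through the second slot, so from \<open>R = S = 0\<close> even digits alone reach nothing but
  z-bar derivatives. One odd digit swaps the slots and makes room for the z derivatives.

  The roots of \<open>h\<close> are not visibly subadditive. Since \<open>h\<close> is built from
  sums with nonnegative coefficients and from squares, it is convex and homogeneous, and this
  suffices.

  All estimates take place on arrays. Smooth functions enter in two places: derivatives at
  \<open>p\<close> obey the array calculus, which rests on the symmetry of second derivatives, and
  every admissible array is realised by a power series. Hence a class of functions is the same as
  its array, and independence of representatives becomes automatic.\<close>

lemma multiindex_induct [case_names zero step]: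
  fixes K :: "nat ^ 'k"
  assumes "P 0" and "\<And>K i. P K \<Longrightarrow> P (K + axis i 1)"
  shows "P K"
proof (induction "mi_abs K" arbitrary: K)
  case 0
  then have "K = 0" by (simp add: mi_abs_def vec_eq_iff)
  with assms(1) show ?case by simp
next
  case (Suc d)
  then obtain i where i: "K $ i \<noteq> 0"
    by (metis mi_abs_def nat.distinct(1) sum.neutral)
  define L where "L = K - axis i 1"
  have K: "K = L + axis i 1"
    using i by (auto simp: L_def vec_eq_iff axis_def)
  have "mi_abs K = mi_abs L + 1"
    by (simp add: K mi_abs_def sum.distrib axis_def)
  with Suc K show ?case using assms(2) by auto
qed

lemma mi_abs_add: "mi_abs (K + L) = mi_abs K + mi_abs L"
  by (simp add: mi_abs_def sum.distrib)

lemma mi_abs_0 [simp]: "mi_abs 0 = 0"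
  by (simp add: mi_abs_def)

lemma mi_fact_0 [simp]: "mi_fact 0 = 1"
  by (simp add: mi_fact_def)

lemma mi_fact_ge1: "1 \<le> mi_fact K"
  unfolding mi_fact_def by (rule prod_ge_1) simp

lemma mi_fact_pos: "0 < mi_fact K"
  using mi_fact_ge1[of K] by linarith

lemma power_mi_abs: "x ^ mi_abs K = (\<Prod>i\<in>UNIV. x ^ (K $ i))"
  by (simp add: mi_abs_def power_sum)

lemma fact_add_le: "fact (a + b) \<le> (2 ^ a * 2 ^ b * (fact a * fact b) :: real)"
proof -
  have "fact (a + b) = real ((a + b) choose a) * (fact a * fact b)"
    using binomial_fact[of a "a + b", where 'a = real] by (simp add: field_simps)
  also have "real ((a + b) choose a) \<le> 2 ^ (a + b)"
    by (metis binomial_le_pow2 numeral_power_eq_of_nat_cancel_iff of_nat_le_iff)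
  finally show ?thesis by (simp add: power_add mult_right_mono)
qed

lemma mi_fact_add_le:
  "mi_fact (K + L) \<le> 2 ^ mi_abs K * 2 ^ mi_abs L * (mi_fact K * mi_fact L)"
proof -
  have "mi_fact (K + L) \<le> (\<Prod>i\<in>UNIV. 2 ^ (K $ i) * 2 ^ (L $ i) * (fact (K $ i) * fact (L $ i)))"
    unfolding mi_fact_def by (rule prod_mono) (simp add: fact_add_le)
  also have "\<dots> = 2 ^ mi_abs K * 2 ^ mi_abs L * (mi_fact K * mi_fact L)"
    by (simp add: mi_fact_def prod.distrib power_mi_abs)
  finally show ?thesis .
qed

lemma mi_binom_fact: "I \<le> K \<Longrightarrow> real (mi_binom K I) * (mi_fact I * mi_fact (K - I)) = mi_fact K"
  unfolding mi_binom_def mi_fact_def of_nat_prod prod.distrib[symmetric]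
  by (rule prod.cong) (auto simp: less_eq_vec_def binomial_fact)

lemma mi_binom_pos: "I \<le> K \<Longrightarrow> 1 \<le> mi_binom K I"
  unfolding mi_binom_def
  by (rule prod_ge_1) (auto simp: less_eq_vec_def Suc_le_eq)

lemma mi_fact_mult_le:
  assumes "I \<le> K" shows "mi_fact I * mi_fact (K - I) \<le> mi_fact K"
proof -
  have "1 * (mi_fact I * mi_fact (K - I)) \<le> real (mi_binom K I) * (mi_fact I * mi_fact (K - I))"
    using mi_binom_pos[OF assms] mi_fact_pos[of I] mi_fact_pos[of "K - I"]
    by (intro mult_right_mono) auto
  then show ?thesis using mi_binom_fact[OF assms] by simp
qed

text \<open>A box is the image of a product of intervals, so it is finite and
  \<open>prod_sum_PiE\<close> turns sums of products over it into products of sums.\<close>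

lemma mi_box: "{..K} = vec_lambda ` (\<Pi>\<^sub>E i\<in>UNIV. {..K $ i})"
proof
  show "{..K} \<subseteq> vec_lambda ` (\<Pi>\<^sub>E i\<in>UNIV. {..K $ i})"
  proof
    fix I assume "I \<in> {..K}"
    then show "I \<in> vec_lambda ` (\<Pi>\<^sub>E i\<in>UNIV. {..K $ i})"
      by (intro image_eqI[of _ _ "($) I"]) (auto simp: less_eq_vec_def)
  qed
qed (auto simp: less_eq_vec_def PiE_iff)

lemma finite_mi_le [simp, intro]: "finite {..(K :: nat ^ 'k)}"
  unfolding mi_box by (intro finite_imageI finite_PiE) auto

lemma sum_mi_box:
  fixes g :: "'k::finite \<Rightarrow> nat \<Rightarrow> 'a::comm_semiring_1"
  shows "(\<Sum>I\<le>K. \<Prod>i\<in>UNIV. g i (I $ i)) = (\<Prod>i\<in>UNIV. \<Sum>k\<le>K $ i. g i k)"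
proof -
  have "inj_on vec_lambda (\<Pi>\<^sub>E i\<in>UNIV. {..K $ i})"
    by (metis (no_types, lifting) UNIV_I inj_onI vec_lambda_inject)
  then have "(\<Sum>I\<le>K. \<Prod>i\<in>UNIV. g i (I $ i)) = (\<Sum>I\<in>(\<Pi>\<^sub>E i\<in>UNIV. {..K $ i}). \<Prod>i\<in>UNIV. g i (I i))"
    by (simp add: mi_box sum.reindex)
  also have "\<dots> = (\<Prod>i\<in>UNIV. \<Sum>k\<le>K $ i. g i k)"
    by (rule prod_sum_PiE[symmetric]) auto
  finally show ?thesis .
qed

lemma sum_mi_binom: "(\<Sum>I\<le>K. mi_binom K I) = 2 ^ mi_abs K"
proof -
  have "(\<Sum>I\<le>K. mi_binom K I) = (\<Prod>i\<in>UNIV. \<Sum>k\<le>K $ i. (K $ i) choose k)"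
    unfolding mi_binom_def by (rule sum_mi_box)
  also have "\<dots> = 2 ^ mi_abs K"
    by (simp add: choose_row_sum power_mi_abs)
  finally show ?thesis .
qed

text \<open>Geometric growth is absorbed by any positive power of the factorial, because
  \<open>(x powr (1 / \<epsilon>)) ^ k / k! \<le> exp (x powr (1 / \<epsilon>))\<close>.\<close>

lemma power_le_fact_powr:
  assumes "1 \<le> x" "0 < \<epsilon>"
  obtains C where "1 \<le> C" "\<And>K :: nat ^ 'k. x ^ mi_abs K \<le> C * mi_fact K powr \<epsilon>"
proof
  define y where "y = x powr (1 / \<epsilon>)"
  define C where "C = exp y powr \<epsilon>"
  have y: "1 \<le> y" using assms by (simp add: y_def ge_one_powr_ge_zero)
  have C1: "1 \<le> C" using y assms by (simp add: C_def ge_one_powr_ge_zero)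
  then show "1 \<le> C ^ CARD('k)" by (rule one_le_power)
  have *: "x ^ k \<le> C * fact k powr \<epsilon>" for k :: nat
  proof -
    have "(\<Sum>j\<in>{k}. inverse (fact j) *\<^sub>R y ^ j) \<le> (\<Sum>j. inverse (fact j) *\<^sub>R y ^ j)"
      by (rule sum_le_suminf) (use y summable_exp_generic[of y] in auto)
    then have "y ^ k \<le> exp y * fact k"
      by (simp add: exp_def divide_simps mult.commute)
    then have "(y ^ k) powr \<epsilon> \<le> (exp y * fact k) powr \<epsilon>"
      using assms y by (intro powr_mono2) auto
    moreover have "(y ^ k) powr \<epsilon> = x ^ k"
      using assms by (simp add: y_def powr_powr powr_power flip: powr_realpow)
    ultimately show ?thesis by (simp add: powr_mult C_def)
  qed
  fix K :: "nat ^ 'k"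
  have "x ^ mi_abs K \<le> (\<Prod>i\<in>UNIV. C * fact (K $ i) powr \<epsilon>)"
    unfolding power_mi_abs using assms * by (intro prod_mono) auto
  also have "\<dots> = C ^ CARD('k) * mi_fact K powr \<epsilon>"
    by (simp add: prod.distrib mi_fact_def prod_powr_distrib)
  finally show "x ^ mi_abs K \<le> C ^ CARD('k) * mi_fact K powr \<epsilon>" .
qed

section \<open>Convergence of series over multiindices\<close>

lemma ex_box:
  assumes "finite (F :: (nat ^ 'k) set)" obtains B where "F \<subseteq> {..B}"
proof
  define B :: "nat ^ 'k" where "B = (\<chi> i. \<Sum>K\<in>F. K $ i)"
  show "F \<subseteq> {..B}"
    using assms by (auto simp: B_def less_eq_vec_def intro!: member_le_sum)
qed

text \<open>Every finite set lies in a box, and over a box the sum factors into one geometric sum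
  per coordinate, each at most 2.\<close>

lemma summable_half_mi_abs: "(\<lambda>N :: nat ^ 'k. (1/2 :: real) ^ mi_abs N) summable_on UNIV"
proof (rule nonneg_bdd_above_summable_on)
  show "bdd_above (sum (\<lambda>N :: nat ^ 'k. (1/2 :: real) ^ mi_abs N) ` {F. F \<subseteq> UNIV \<and> finite F})"
  proof (rule bdd_aboveI2)
    fix F :: "(nat ^ 'k) set" assume "F \<in> {F. F \<subseteq> UNIV \<and> finite F}"
    then obtain B where B: "F \<subseteq> {..B}" using ex_box by auto
    then have "(\<Sum>N\<in>F. (1/2 :: real) ^ mi_abs N) \<le> (\<Sum>N\<le>B. (1/2) ^ mi_abs N)"
      by (intro sum_mono2) auto
    also have "\<dots> = (\<Prod>i\<in>UNIV. \<Sum>k\<le>B $ i. (1/2) ^ k)"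
      unfolding power_mi_abs by (rule sum_mi_box)
    also have "\<dots> \<le> (\<Prod>i\<in>(UNIV :: 'k set). 2)"
    proof (rule prod_mono, safe)
      fix i
      have "(\<Sum>k\<le>B $ i. (1/2 :: real) ^ k) \<le> (\<Sum>k. (1/2) ^ k)"
        by (rule sum_le_suminf) (auto simp: summable_geometric)
      then show "(\<Sum>k\<le>B $ i. (1/2 :: real) ^ k) \<le> 2"
        by (simp add: suminf_geometric)
    qed (auto intro: sum_nonneg)
    finally show "(\<Sum>N\<in>F. (1/2 :: real) ^ mi_abs N) \<le> 2 ^ CARD('k)" by simp
  qed
qed auto

lemma summable_power_fact:
  assumes "0 \<le> x" "0 < \<epsilon>"
  shows "(\<lambda>N :: nat ^ 'k. x ^ mi_abs N * mi_fact N powr - \<epsilon>) summable_on UNIV"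
proof -
  \<comment> \<open>The factor 2 leaves the summable weight \<open>(1/2) ^ mi_abs N\<close> after
    the absorption; adding 1 puts the base above 1 even for \<open>x = 0\<close>.\<close>
  obtain C where C: "1 \<le> C" "\<And>K :: nat ^ 'k. (2 * (x + 1)) ^ mi_abs K \<le> C * mi_fact K powr \<epsilon>"
    by (rule power_le_fact_powr[of "2 * (x + 1)" \<epsilon>]) (use assms in auto)
  show ?thesis
  proof (rule summable_on_comparison_test)
    show "(\<lambda>N :: nat ^ 'k. C * (1/2) ^ mi_abs N) summable_on UNIV"
      by (intro summable_on_cmult_right summable_half_mi_abs)
    fix N :: "nat ^ 'k"
    have "x ^ mi_abs N \<le> (1/2) ^ mi_abs N * (2 * (x + 1)) ^ mi_abs N"
      using assms by (simp flip: power_mult_distrib) (intro power_mono, auto)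
    also have "\<dots> \<le> (1/2) ^ mi_abs N * (C * mi_fact N powr \<epsilon>)"
      by (intro mult_left_mono C) auto
    finally show "x ^ mi_abs N * mi_fact N powr - \<epsilon> \<le> C * (1/2) ^ mi_abs N"
      using mi_fact_pos[of N] by (simp add: powr_minus field_simps)
  qed (use assms in auto)
qed

section \<open>Arrays of Taylor coefficients\<close>

definition shift :: "nat ^ 'k \<Rightarrow> (nat ^ 'k \<Rightarrow> complex) \<Rightarrow> nat ^ 'k \<Rightarrow> complex" where
  "shift L a = (\<lambda>K. a (K + L))"

text \<open>On jets, \<open>shift\<close> is differentiation and \<open>leibniz\<close> is pointwise
  multiplication; see \<open>jet_wirtinger\<close> and \<open>jet_mult\<close>.\<close>

definition leibniz :: "(nat ^ 'k \<Rightarrow> complex) \<Rightarrow> (nat ^ 'k \<Rightarrow> complex) \<Rightarrow> nat ^ 'k \<Rightarrow> complex" where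
  "leibniz a b = (\<lambda>K. \<Sum>I\<le>K. of_nat (mi_binom K I) * (a I * b (K - I)))"

text \<open>The bound is a parameter instead of a supremum: constants then compose without any proof
  that a supremum is finite, and the same predicate serves for single arrays and for tails of
  series.\<close>

definition fact_bounded :: "real \<Rightarrow> real \<Rightarrow> (nat ^ 'k \<Rightarrow> complex) \<Rightarrow> bool" where
  "fact_bounded \<epsilon> A a \<longleftrightarrow> (\<forall>K. cmod (a K) \<le> A * mi_fact K powr \<epsilon>)"

definition subfactorial :: "(nat ^ 'k \<Rightarrow> complex) set" where
  "subfactorial = {a. \<forall>\<epsilon>>0. \<exists>A. fact_bounded \<epsilon> A a}"

lemma mi_fact_nonneg [simp]: "0 \<le> mi_fact K"
  using mi_fact_pos[of K] by linarith

lemma shift_shift: "shift L (shift M a) = shift (L + M) a"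
  by (simp add: shift_def add_ac)

lemma mi_minus_add: "I \<le> K \<Longrightarrow> K - I + I = (K :: nat ^ 'k)"
  by (simp add: vec_eq_iff less_eq_vec_def)

lemma mi_diff_diff: "I \<le> K \<Longrightarrow> K - (K - I) = (I :: nat ^ 'k)"
  by (simp add: vec_eq_iff less_eq_vec_def)

lemma mi_diff_le: "K - I \<le> (K :: nat ^ 'k)"
  by (simp add: less_eq_vec_def)

lemma mi_binom_eq_0: "\<not> I \<le> K \<Longrightarrow> mi_binom K I = 0"
  unfolding mi_binom_def less_eq_vec_def
  by (auto simp: not_le binomial_eq_0 intro!: prod_zero)

lemma mi_binom_symmetric: "I \<le> K \<Longrightarrow> mi_binom K (K - I) = mi_binom K I"
  unfolding mi_binom_def less_eq_vec_def
  by (rule prod.cong) (auto simp: binomial_symmetric[symmetric])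

text \<open>Only the factor at \<open>j\<close> changes, by Pascal's rule. The case
  \<open>I $ j = 0\<close> is separate because subtraction truncates: there
  \<open>I - axis j 1\<close> is \<open>I\<close> again.\<close>

lemma mi_binom_pascal:
  "mi_binom (K + axis j 1) I =
    mi_binom K I + (if I $ j = 0 then 0 else mi_binom K (I - axis j 1))"
proof -
  define r where "r = (\<Prod>i\<in>UNIV - {j}. (K $ i) choose (I $ i))"
  have split: "mi_binom L M = ((L $ j) choose (M $ j)) * (\<Prod>i\<in>UNIV - {j}. (L $ i) choose (M $ i))" for L M
    unfolding mi_binom_def by (rule prod.remove) auto
  have r: "(\<Prod>i\<in>UNIV - {j}. ((K + axis j 1) $ i) choose (I $ i)) = r"
    "(\<Prod>i\<in>UNIV - {j}. (K $ i) choose ((I - axis j 1) $ i)) = r"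
    unfolding r_def by (rule prod.cong; auto simp: axis_def)+
  show ?thesis
    unfolding split[of "K + axis j 1" I] split[of K "I - axis j 1"] split[of K I] r
    by (cases "I $ j") (auto simp: r_def[symmetric] algebra_simps)
qed

lemma leibniz_0 [simp]:
  fixes a b :: "nat ^ 'k \<Rightarrow> complex"
  shows "leibniz a b 0 = a 0 * b 0"
proof -
  have "{..0} = {0 :: nat ^ 'k}"
    by (auto simp: less_eq_vec_def vec_eq_iff)
  moreover have "mi_binom 0 (0 :: nat ^ 'k) = 1" by (simp add: mi_binom_def)
  ultimately show ?thesis by (simp add: leibniz_def)
qed

lemma leibniz_commute: "leibniz a b = leibniz b a"
proof
  fix K
  show "leibniz a b K = leibniz b a K"
    unfolding leibniz_def
    by (rule sum.reindex_bij_witness[where i = "\<lambda>I. K - I" and j = "\<lambda>I. K - I"])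
      (auto simp: mi_diff_diff mi_diff_le mi_binom_symmetric mult.commute)
qed

text \<open>Pascal's rule splits the sum at \<open>K + axis j 1\<close> into the terms whose extra
  derivative falls on \<open>b\<close> and those where it falls on \<open>a\<close>.\<close>

lemma shift_leibniz:
  fixes a b :: "nat ^ 'k \<Rightarrow> complex"
  shows "shift (axis j 1) (leibniz a b) K =
    leibniz (shift (axis j 1) a) b K + leibniz a (shift (axis j 1) b) K"
proof -
  let ?e = "axis j 1 :: nat ^ 'k"
  have "shift ?e (leibniz a b) K =
      (\<Sum>I\<le>K + ?e. of_nat (mi_binom K I) * (a I * b (K + ?e - I))) +
      (\<Sum>I\<le>K + ?e. if I $ j = 0 then 0 else of_nat (mi_binom K (I - ?e)) * (a I * b (K + ?e - I)))"
    unfolding shift_def leibniz_def mi_binom_pascal sum.distrib[symmetric]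
    by (rule sum.cong) (auto simp: algebra_simps)
  \<comment> \<open>Indices outside the smaller box have binomial coefficient 0; inside it the
    subtraction does not truncate.\<close>
  also have "(\<Sum>I\<le>K + ?e. of_nat (mi_binom K I) * (a I * b (K + ?e - I))) =
      (\<Sum>I\<le>K. of_nat (mi_binom K I) * (a I * b (K - I + ?e)))"
  proof (rule sum.mono_neutral_cong_right)
    show "{..K} \<subseteq> {..K + ?e}" by (auto simp: less_eq_vec_def trans_le_add1)
    fix I assume "I \<in> {..K}"
    then have "K + ?e - I = K - I + ?e" by (auto simp: less_eq_vec_def vec_eq_iff)
    then show "of_nat (mi_binom K I) * (a I * b (K + ?e - I)) =
        of_nat (mi_binom K I) * (a I * b (K - I + ?e))" by simp
  qed (auto simp: mi_binom_eq_0)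
  also have "(\<Sum>I\<le>K + ?e. if I $ j = 0 then 0 else of_nat (mi_binom K (I - ?e)) * (a I * b (K + ?e - I)))
      = (\<Sum>I\<in>{I. I \<le> K + ?e \<and> I $ j \<noteq> 0}. of_nat (mi_binom K (I - ?e)) * (a I * b (K + ?e - I)))"
    by (rule sum.mono_neutral_cong_right) auto
  also have "\<dots> = (\<Sum>I\<le>K. of_nat (mi_binom K I) * (a (I + ?e) * b (K - I)))"
  proof (rule sum.reindex_bij_witness[where i = "\<lambda>I. I + ?e" and j = "\<lambda>I. I - ?e"])
    fix I assume "I \<in> {I. I \<le> K + ?e \<and> I $ j \<noteq> 0}"
    then have I: "I - ?e + ?e = I" "I - ?e \<le> K" "K - (I - ?e) = K + ?e - I"
      by (auto simp: less_eq_vec_def vec_eq_iff axis_def le_diff_conv split: if_splits)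
    show "I - ?e + ?e = I" "I - ?e \<in> {..K}" using I by auto
    show "of_nat (mi_binom K (I - ?e)) * (a (I - ?e + ?e) * b (K - (I - ?e))) =
        of_nat (mi_binom K (I - ?e)) * (a I * b (K + ?e - I))"
      unfolding I(1) I(3) ..
  qed (auto simp: less_eq_vec_def vec_eq_iff axis_def)
  finally show ?thesis by (simp add: shift_def leibniz_def add.commute)
qed

lemma leibniz_add_left: "leibniz (\<lambda>K. a K + a' K) b K = leibniz a b K + leibniz a' b K"
  by (simp add: leibniz_def algebra_simps sum.distrib)

lemma leibniz_scale_left: "leibniz (\<lambda>K. c * a K) b K = c * leibniz a b K"
  by (simp add: leibniz_def sum_distrib_left algebra_simps)

lemma leibniz_add_right: "leibniz a (\<lambda>K. b K + b' K) K = leibniz a b K + leibniz a b' K"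
  by (simp add: leibniz_def algebra_simps sum.distrib)

lemma leibniz_scale_right: "leibniz a (\<lambda>K. c * b K) K = c * leibniz a b K"
  by (simp add: leibniz_def sum_distrib_left algebra_simps)

section \<open>Doubled multiindices: the left half counts z derivatives, the right half z-bar
  derivatives\<close>

definition mi_join :: "nat ^ 'n::finite \<Rightarrow> nat ^ 'n \<Rightarrow> nat ^ ('n + 'n)" where
  "mi_join R S = (\<chi> j. case j of Inl i \<Rightarrow> R $ i | Inr i \<Rightarrow> S $ i)"

definition mi_swap :: "nat ^ ('n::finite + 'n) \<Rightarrow> nat ^ ('n + 'n)" where
  "mi_swap K = (\<chi> j. case j of Inl i \<Rightarrow> K $ Inr i | Inr i \<Rightarrow> K $ Inl i)"

lemma mi_join_nth [simp]: "mi_join R S $ Inl i = R $ i" "mi_join R S $ Inr i = S $ i"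
  by (simp_all add: mi_join_def)

lemma mi_swap_nth [simp]: "mi_swap K $ Inl i = K $ Inr i" "mi_swap K $ Inr i = K $ Inl i"
  by (simp_all add: mi_swap_def)

lemma sum_vec_eq_iff:
  fixes K L :: "'a ^ ('n::finite + 'n)"
  shows "K = L \<longleftrightarrow> (\<forall>i. K $ Inl i = L $ Inl i) \<and> (\<forall>i. K $ Inr i = L $ Inr i)"
  by (metis sum.exhaust vec_eq_iff)

lemma sum_vec_le_iff:
  fixes K L :: "'a::ord ^ ('n::finite + 'n)"
  shows "K \<le> L \<longleftrightarrow> (\<forall>i. K $ Inl i \<le> L $ Inl i) \<and> (\<forall>i. K $ Inr i \<le> L $ Inr i)"
  by (metis sum.exhaust less_eq_vec_def)

lemma mi_join_cases: obtains R S where "K = mi_join R S"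
  by (rule that[of "\<chi> i. K $ Inl i" "\<chi> i. K $ Inr i"]) (simp add: sum_vec_eq_iff)

lemma mi_join_add: "mi_join R S + mi_join R' S' = mi_join (R + R') (S + S')"
  by (simp add: sum_vec_eq_iff)

lemma mi_join_diff: "mi_join R S - mi_join R' S' = mi_join (R - R') (S - S')"
  by (simp add: sum_vec_eq_iff)

lemma mi_join_le_iff [simp]: "mi_join R S \<le> mi_join R' S' \<longleftrightarrow> R \<le> R' \<and> S \<le> S'"
  by (simp add: sum_vec_le_iff less_eq_vec_def)

lemma mi_join_inject [simp]: "mi_join R S = mi_join R' S' \<longleftrightarrow> R = R' \<and> S = S'"
  by (simp add: sum_vec_eq_iff vec_eq_iff)

lemma mi_swap_join [simp]: "mi_swap (mi_join R S) = mi_join S R"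
  by (simp add: sum_vec_eq_iff)

lemma mi_swap_swap [simp]: "mi_swap (mi_swap K) = K"
  by (simp add: sum_vec_eq_iff)

lemma mi_swap_add: "mi_swap (K + L) = mi_swap K + mi_swap L"
  by (simp add: sum_vec_eq_iff)

lemma mi_swap_diff: "mi_swap (K - L) = mi_swap K - mi_swap L"
  by (simp add: sum_vec_eq_iff)

lemma mi_swap_le_iff [simp]: "mi_swap K \<le> mi_swap L \<longleftrightarrow> K \<le> L"
  by (auto simp: sum_vec_le_iff)

lemma prod_sum_type:
  fixes g :: "'n::finite + 'n \<Rightarrow> 'a::comm_monoid_mult"
  shows "(\<Prod>j\<in>UNIV. g j) = (\<Prod>i\<in>UNIV. g (Inl i)) * (\<Prod>i\<in>UNIV. g (Inr i))"
  by (subst UNIV_Plus_UNIV[symmetric], subst prod.Plus) auto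

lemma sum_sum_type:
  fixes g :: "'n::finite + 'n \<Rightarrow> 'a::comm_monoid_add"
  shows "(\<Sum>j\<in>UNIV. g j) = (\<Sum>i\<in>UNIV. g (Inl i)) + (\<Sum>i\<in>UNIV. g (Inr i))"
  by (subst UNIV_Plus_UNIV[symmetric], subst sum.Plus) auto

lemma mi_fact_join [simp]: "mi_fact (mi_join R S) = mi_fact R * mi_fact S"
  by (simp add: mi_fact_def prod_sum_type)

lemma mi_abs_join [simp]: "mi_abs (mi_join R S) = mi_abs R + mi_abs S"
  by (simp add: mi_abs_def sum_sum_type)

lemma mi_binom_join [simp]: "mi_binom (mi_join R S) (mi_join I J) = mi_binom R I * mi_binom S J"
  by (simp add: mi_binom_def prod_sum_type)

lemma mi_fact_swap [simp]: "mi_fact (mi_swap K) = mi_fact K"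
  by (simp add: mi_fact_def prod_sum_type mult.commute)

lemma mi_binom_swap [simp]: "mi_binom (mi_swap K) (mi_swap I) = mi_binom K I"
  by (simp add: mi_binom_def prod_sum_type mult.commute)

lemma axis_Inl: "axis (Inl i) 1 = mi_join (axis i 1) 0"
  by (simp add: sum_vec_eq_iff axis_def)

lemma axis_Inr: "axis (Inr i) 1 = mi_join 0 (axis i 1)"
  by (simp add: sum_vec_eq_iff axis_def)

section \<open>Growth bounds under linear operations and shifts\<close>

lemma fact_boundedD: "fact_bounded \<epsilon> A a \<Longrightarrow> cmod (a K) \<le> A * mi_fact K powr \<epsilon>"
  by (simp add: fact_bounded_def)

text \<open>At the index 0 the factorial is 1, so the bound there is \<open>A\<close>
  itself.\<close>

lemma fact_bounded_nonneg: "fact_bounded \<epsilon> A a \<Longrightarrow> 0 \<le> A"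
  by (metis fact_boundedD mi_fact_0 mult.right_neutral norm_ge_zero order.trans powr_one_eq_one)

lemma fact_bounded_mono:
  assumes "fact_bounded \<epsilon> A a" "\<epsilon> \<le> \<delta>" "A \<le> B" shows "fact_bounded \<delta> B a"
  unfolding fact_bounded_def
proof
  fix K
  have "cmod (a K) \<le> A * mi_fact K powr \<epsilon>" using assms(1) by (rule fact_boundedD)
  also have "\<dots> \<le> B * mi_fact K powr \<delta>"
    using assms mi_fact_ge1[of K] fact_bounded_nonneg[OF assms(1)]
    by (intro mult_mono powr_mono) auto
  finally show "cmod (a K) \<le> B * mi_fact K powr \<delta>" .
qed

lemma subfactorialD:
  assumes "a \<in> subfactorial" "0 < \<epsilon>" obtains A where "0 \<le> A" "fact_bounded \<epsilon> A a"
  using assms fact_bounded_nonneg unfolding subfactorial_def by blast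

lemma subfactorialI: "(\<And>\<epsilon>. 0 < \<epsilon> \<Longrightarrow> \<exists>A. fact_bounded \<epsilon> A a) \<Longrightarrow> a \<in> subfactorial"
  by (simp add: subfactorial_def)

lemma fact_bounded_add:
  "fact_bounded \<epsilon> A a \<Longrightarrow> fact_bounded \<epsilon> B b \<Longrightarrow> fact_bounded \<epsilon> (A + B) (\<lambda>K. a K + b K)"
  unfolding fact_bounded_def
  by (metis (no_types, lifting) add_mono distrib_right norm_triangle_le)

lemma fact_bounded_diff:
  "fact_bounded \<epsilon> A a \<Longrightarrow> fact_bounded \<epsilon> B b \<Longrightarrow> fact_bounded \<epsilon> (A + B) (\<lambda>K. a K - b K)"
  unfolding fact_bounded_def
  by (metis (no_types, lifting) add_mono distrib_right norm_triangle_le_diff)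

lemma fact_bounded_scale: "fact_bounded \<epsilon> A a \<Longrightarrow> fact_bounded \<epsilon> (cmod c * A) (\<lambda>K. c * a K)"
  unfolding fact_bounded_def by (simp add: norm_mult mult.assoc mult_left_mono)

text \<open>The factorial of \<open>K + L\<close> is at most a constant times the square of
  \<open>mi_fact K\<close>: one factor comes from splitting the factorial, one from absorbing
  \<open>2 ^ mi_abs K\<close>. The square doubles the exponent, hence the passage from
  \<open>\<epsilon> / 2\<close> to \<open>\<epsilon>\<close>.\<close>

lemma fact_bounded_shift:
  fixes L :: "nat ^ 'k"
  assumes "0 < \<epsilon>"
  obtains C where "0 \<le> C" "\<And>A a. fact_bounded (\<epsilon> / 2) A a \<Longrightarrow> fact_bounded \<epsilon> (C * A) (shift L a)"
proof -
  obtain D where D: "1 \<le> D" "\<And>K :: nat ^ 'k. 2 ^ mi_abs K \<le> D * mi_fact K powr 1"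
    by (rule power_le_fact_powr[of 2 1]) auto
  define C where "C = (D * 2 ^ mi_abs L * mi_fact L) powr (\<epsilon> / 2)"
  show ?thesis
  proof (rule that)
    show "0 \<le> C" by (simp add: C_def)
    fix A and a :: "nat ^ 'k \<Rightarrow> complex" assume a: "fact_bounded (\<epsilon> / 2) A a"
    show "fact_bounded \<epsilon> (C * A) (shift L a)"
      unfolding fact_bounded_def
    proof
      fix K
      have "mi_fact (K + L) \<le> 2 ^ mi_abs K * 2 ^ mi_abs L * (mi_fact K * mi_fact L)"
        by (rule mi_fact_add_le)
      also have "\<dots> \<le> (D * mi_fact K) * 2 ^ mi_abs L * (mi_fact K * mi_fact L)"
        using D(2)[of K] mi_fact_pos[of K] mi_fact_pos[of L] by (intro mult_right_mono) auto
      finally have "mi_fact (K + L) \<le> (D * 2 ^ mi_abs L * mi_fact L) * mi_fact K powr 2"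
        using mi_fact_pos[of K] by (simp add: power2_eq_square mult_ac)
      then have "mi_fact (K + L) powr (\<epsilon> / 2) \<le> ((D * 2 ^ mi_abs L * mi_fact L) * mi_fact K powr 2) powr (\<epsilon> / 2)"
        using assms mi_fact_pos[of "K + L"] by (intro powr_mono2) auto
      also have "\<dots> = C * mi_fact K powr \<epsilon>"
        unfolding C_def powr_mult powr_powr by simp
      finally have *: "mi_fact (K + L) powr (\<epsilon> / 2) \<le> C * mi_fact K powr \<epsilon>" .
      have "cmod (shift L a K) \<le> A * mi_fact (K + L) powr (\<epsilon> / 2)"
        unfolding shift_def using a by (rule fact_boundedD)
      also have "\<dots> \<le> A * (C * mi_fact K powr \<epsilon>)"
        using * fact_bounded_nonneg[OF a] by (rule mult_left_mono)
      finally show "cmod (shift L a K) \<le> C * A * mi_fact K powr \<epsilon>" by (simp add: mult_ac)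
    qed
  qed
qed

lemma subfactorial_add:
  "a \<in> subfactorial \<Longrightarrow> b \<in> subfactorial \<Longrightarrow> (\<lambda>K. a K + b K) \<in> subfactorial"
  unfolding subfactorial_def using fact_bounded_add by blast

lemma subfactorial_diff:
  "a \<in> subfactorial \<Longrightarrow> b \<in> subfactorial \<Longrightarrow> (\<lambda>K. a K - b K) \<in> subfactorial"
  unfolding subfactorial_def using fact_bounded_diff by blast

lemma subfactorial_scale: "a \<in> subfactorial \<Longrightarrow> (\<lambda>K. c * a K) \<in> subfactorial"
  unfolding subfactorial_def using fact_bounded_scale by blast

lemma subfactorial_0: "(\<lambda>K. 0) \<in> subfactorial"
  unfolding subfactorial_def fact_bounded_def by (auto intro!: exI[of _ 0])

lemma subfactorial_shift:
  assumes "a \<in> subfactorial" shows "shift L a \<in> subfactorial"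
  unfolding subfactorial_def
proof (intro CollectI allI impI)
  fix \<epsilon> :: real assume \<epsilon>: "0 < \<epsilon>"
  obtain A where A: "fact_bounded (\<epsilon> / 2) A a"
    using subfactorialD[OF assms, of "\<epsilon> / 2"] \<epsilon> by auto
  obtain C where "\<And>A a. fact_bounded (\<epsilon> / 2) A a \<Longrightarrow> fact_bounded \<epsilon> (C * A) (shift L a)"
    using fact_bounded_shift[OF \<epsilon>] by metis
  with A show "\<exists>A. fact_bounded \<epsilon> A (shift L a)" by blast
qed

section \<open>The Wick product of arrays\<close>

lemma fact_bounded_summable:
  fixes t :: "'i \<Rightarrow> nat ^ 'k \<Rightarrow> complex"
  assumes "\<And>N. fact_bounded \<epsilon> (u N) (t N)" "u summable_on UNIV"
  shows "(\<lambda>N. norm (t N K)) summable_on UNIV" "(\<lambda>N. t N K) summable_on UNIV"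
proof -
  show *: "(\<lambda>N. norm (t N K)) summable_on UNIV"
  proof (rule summable_on_comparison_test)
    show "(\<lambda>N. u N * mi_fact K powr \<epsilon>) summable_on UNIV"
      by (rule summable_on_cmult_left[OF assms(2)])
  qed (use fact_boundedD[OF assms(1)] in auto)
  show "(\<lambda>N. t N K) summable_on UNIV"
    using * by (rule abs_summable_summable)
qed

text \<open>A summable majorant controls the tail outside \<open>F\<close> at all indices
  \<open>K\<close> at once. This turns scalar summability into convergence for every seminorm;
  \<open>F = {}\<close> bounds the sum itself.\<close>

lemma fact_bounded_infsum_tail:
  fixes t :: "'i \<Rightarrow> nat ^ 'k \<Rightarrow> complex"
  assumes "\<And>N. fact_bounded \<epsilon> (u N) (t N)" "u summable_on UNIV" "finite F"
  shows "fact_bounded \<epsilon> (infsum u (- F)) (\<lambda>K. (\<Sum>\<^sub>\<infinity>N. t N K) - (\<Sum>N\<in>F. t N K))"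
  unfolding fact_bounded_def
proof
  fix K
  note sm = fact_bounded_summable[OF assms(1,2), of K]
  have "(\<Sum>\<^sub>\<infinity>N. t N K) - (\<Sum>N\<in>F. t N K) = (\<Sum>\<^sub>\<infinity>N\<in>-F. t N K)"
    using infsum_Diff[OF sm(2), of F] assms(3) by (simp add: Compl_eq_Diff_UNIV)
  moreover have "cmod (\<Sum>\<^sub>\<infinity>N\<in>-F. t N K) \<le> (\<Sum>\<^sub>\<infinity>N\<in>-F. u N * mi_fact K powr \<epsilon>)"
  proof (rule norm_infsum_le)
    show "((\<lambda>N. t N K) has_sum (\<Sum>\<^sub>\<infinity>N\<in>-F. t N K)) (- F)"
      by (rule has_sum_infsum[OF summable_on_subset_banach[OF sm(2)]]) simp
    show "((\<lambda>N. u N * mi_fact K powr \<epsilon>) has_sum (\<Sum>\<^sub>\<infinity>N\<in>-F. u N * mi_fact K powr \<epsilon>)) (- F)"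
      by (rule has_sum_infsum[OF summable_on_cmult_left[OF summable_on_subset_banach[OF assms(2)]]]) simp
  qed (rule fact_boundedD[OF assms(1)])
  ultimately show "cmod ((\<Sum>\<^sub>\<infinity>N. t N K) - (\<Sum>N\<in>F. t N K)) \<le> infsum u (- F) * mi_fact K powr \<epsilon>"
    by (simp add: infsum_cmult_left')
qed

lemma fact_bounded_infsum:
  fixes t :: "'i \<Rightarrow> nat ^ 'k \<Rightarrow> complex"
  assumes "\<And>N. fact_bounded \<epsilon> (u N) (t N)" "u summable_on UNIV"
  shows "fact_bounded \<epsilon> (infsum u UNIV) (\<lambda>K. \<Sum>\<^sub>\<infinity>N. t N K)"
  using fact_bounded_infsum_tail[OF assms, of "{}"] by simp

text \<open>The parameter \<open>c\<close> is \<open>2 * \<alpha>\<close> in the star product. The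
  left factor receives the z derivatives and the right factor the z-bar derivatives.\<close>

definition wick_coeff :: "complex \<Rightarrow> (nat ^ ('n::finite + 'n) \<Rightarrow> complex) \<Rightarrow> (nat ^ ('n + 'n) \<Rightarrow> complex)
    \<Rightarrow> nat ^ 'n \<Rightarrow> nat ^ ('n + 'n) \<Rightarrow> complex" where
  "wick_coeff c a b N = (\<lambda>K. c ^ mi_abs N / of_real (mi_fact N) *
     leibniz (shift (mi_join N 0) a) (shift (mi_join 0 N) b) K)"

definition wick_sum :: "complex \<Rightarrow> (nat ^ ('n::finite + 'n) \<Rightarrow> complex) \<Rightarrow> (nat ^ ('n + 'n) \<Rightarrow> complex)
    \<Rightarrow> nat ^ ('n + 'n) \<Rightarrow> complex" where
  "wick_sum c a b = (\<lambda>K. \<Sum>\<^sub>\<infinity>N. wick_coeff c a b N K)"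

text \<open>Each factor contributes \<open>mi_fact N powr \<epsilon>\<close>, so for
  \<open>\<epsilon> \<le> 1/4\<close> what remains after division by \<open>mi_fact N\<close> is at
  most \<open>mi_fact N powr - (1/2)\<close>. The weights \<open>u\<close> depend on neither
  array.\<close>

lemma fact_bounded_wick_coeff:
  assumes \<epsilon>: "0 < \<epsilon>" "\<epsilon> \<le> 1/4"
  obtains u :: "nat ^ 'n::finite \<Rightarrow> real" where
    "\<And>N. 0 \<le> u N" "u summable_on UNIV"
    "\<And>a b A B N. fact_bounded \<epsilon> A a \<Longrightarrow> fact_bounded \<epsilon> B b \<Longrightarrow>
       fact_bounded (2 * \<epsilon>) (A * B * u N) (wick_coeff c a b N)"
proof -
  \<comment> \<open>The base 4 collects two factors \<open>2 ^ mi_abs K\<close>: one from splitting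
    the factorials, one from the sum of the binomial coefficients.\<close>
  obtain C where C: "1 \<le> C" "\<And>K :: nat ^ ('n + 'n). 4 ^ mi_abs K \<le> C * mi_fact K powr \<epsilon>"
    by (rule power_le_fact_powr[of 4 \<epsilon>]) (use \<epsilon> in auto)
  define u :: "nat ^ 'n \<Rightarrow> real" where
    "u = (\<lambda>N. C * ((4 * cmod c) ^ mi_abs N * mi_fact N powr - (1/2)))"
  show ?thesis
  proof (rule that[of u])
    show "0 \<le> u N" for N using C by (simp add: u_def)
    show "u summable_on UNIV"
      unfolding u_def by (intro summable_on_cmult_right summable_power_fact) auto
    fix a b :: "nat ^ ('n + 'n) \<Rightarrow> complex" and A B N
    assume a: "fact_bounded \<epsilon> A a" and b: "fact_bounded \<epsilon> B b"
    have AB: "0 \<le> A" "0 \<le> B" using a b fact_bounded_nonneg by auto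
    show "fact_bounded (2 * \<epsilon>) (A * B * u N) (wick_coeff c a b N)"
      unfolding fact_bounded_def
    proof
      fix K :: "nat ^ ('n + 'n)"
      let ?L = "mi_join N 0" and ?M = "mi_join 0 N"
      define E where "E = A * B * (4 ^ mi_abs N * 2 ^ mi_abs K * (mi_fact N powr (2 * \<epsilon>) * mi_fact K powr \<epsilon>))"
      have summand: "cmod (shift ?L a I * shift ?M b (K - I)) \<le> E" if I: "I \<le> K" for I
      proof -
        have K: "mi_abs K = mi_abs I + mi_abs (K - I)"
          using mi_minus_add[OF I] by (metis add.commute mi_abs_add)
        have "mi_fact (I + ?L) * mi_fact (K - I + ?M) \<le>
            (2 ^ mi_abs I * 2 ^ mi_abs N * (mi_fact I * mi_fact N)) *
            (2 ^ mi_abs (K - I) * 2 ^ mi_abs N * (mi_fact (K - I) * mi_fact N))"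
          using mi_fact_add_le[of I ?L] mi_fact_add_le[of "K - I" ?M]
          by (intro mult_mono) auto
        also have "\<dots> = 4 ^ mi_abs N * 2 ^ mi_abs K * ((mi_fact N)\<^sup>2 * (mi_fact I * mi_fact (K - I)))"
        proof -
          have "(4::real) ^ mi_abs N = 2 ^ mi_abs N * 2 ^ mi_abs N"
            by (simp flip: power_mult_distrib)
          then show ?thesis by (simp add: K power_add power2_eq_square mult_ac)
        qed
        also have "\<dots> \<le> 4 ^ mi_abs N * 2 ^ mi_abs K * ((mi_fact N)\<^sup>2 * mi_fact K)"
          by (intro mult_left_mono mi_fact_mult_le I) auto
        finally have "(mi_fact (I + ?L) * mi_fact (K - I + ?M)) powr \<epsilon>
            \<le> (4 ^ mi_abs N * 2 ^ mi_abs K * ((mi_fact N)\<^sup>2 * mi_fact K)) powr \<epsilon>"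
          using \<epsilon> mi_fact_pos by (intro powr_mono2) (auto intro: less_imp_le mult_nonneg_nonneg)
        also have "\<dots> = (4 ^ mi_abs N * 2 ^ mi_abs K) powr \<epsilon> * (mi_fact N powr (2 * \<epsilon>) * mi_fact K powr \<epsilon>)"
          using mi_fact_pos[of N] by (simp add: powr_mult powr_powr flip: powr_numeral)
        \<comment> \<open>Geometric factors need no economy: a base of at least 1 may be raised from
          the exponent \<open>\<epsilon>\<close> to 1.\<close>
        also have "(4 ^ mi_abs N * 2 ^ mi_abs K) powr \<epsilon> \<le> (4 ^ mi_abs N * 2 ^ mi_abs K :: real) powr 1"
        proof (rule powr_mono)
          have "1 * 1 \<le> (4 ^ mi_abs N * 2 ^ mi_abs K :: real)"
            by (intro mult_mono one_le_power) auto
          then show "1 \<le> (4 ^ mi_abs N * 2 ^ mi_abs K :: real)" by simp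
        qed (use \<epsilon> in auto)
        finally have *: "(mi_fact (I + ?L) * mi_fact (K - I + ?M)) powr \<epsilon> \<le>
            4 ^ mi_abs N * 2 ^ mi_abs K * (mi_fact N powr (2 * \<epsilon>) * mi_fact K powr \<epsilon>)"
          by (simp add: mult_right_mono)
        have "cmod (shift ?L a I * shift ?M b (K - I)) \<le>
            (A * mi_fact (I + ?L) powr \<epsilon>) * (B * mi_fact (K - I + ?M) powr \<epsilon>)"
          unfolding norm_mult shift_def
          using fact_boundedD[OF a, of "I + ?L"] fact_boundedD[OF b, of "K - I + ?M"] AB
          by (intro mult_mono) auto
        also have "\<dots> = A * B * (mi_fact (I + ?L) * mi_fact (K - I + ?M)) powr \<epsilon>"
          using mi_fact_pos by (simp add: powr_mult less_imp_le)
        also have "\<dots> \<le> E"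
          unfolding E_def using AB * by (intro mult_left_mono) auto
        finally show ?thesis .
      qed
      have "cmod (leibniz (shift ?L a) (shift ?M b) K) \<le> (\<Sum>I\<le>K. real (mi_binom K I) * E)"
        unfolding leibniz_def
        by (rule sum_norm_le) (use summand in \<open>auto simp: norm_mult intro!: mult_left_mono\<close>)
      also have "\<dots> = 2 ^ mi_abs K * E"
        by (simp add: sum_mi_binom flip: sum_distrib_right of_nat_sum)
      finally have le: "cmod (leibniz (shift ?L a) (shift ?M b) K) \<le> 2 ^ mi_abs K * E" .
      have "cmod (wick_coeff c a b N K) = cmod c ^ mi_abs N / mi_fact N * cmod (leibniz (shift ?L a) (shift ?M b) K)"
        using mi_fact_pos[of N] by (simp add: wick_coeff_def norm_mult norm_divide norm_power)
      also have "\<dots> \<le> cmod c ^ mi_abs N / mi_fact N * (2 ^ mi_abs K * E)"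
        using le mi_fact_pos[of N] by (intro mult_left_mono) auto
      also have "\<dots> = A * B * ((4 * cmod c) ^ mi_abs N * (mi_fact N powr (2 * \<epsilon>) / mi_fact N)) * (4 ^ mi_abs K * mi_fact K powr \<epsilon>)"
      proof -
        have "(4::real) ^ mi_abs K = 2 ^ mi_abs K * 2 ^ mi_abs K"
          by (simp flip: power_mult_distrib)
        then show ?thesis by (simp add: E_def power_mult_distrib mult_ac)
      qed
      also have "\<dots> \<le> A * B * ((4 * cmod c) ^ mi_abs N * mi_fact N powr - (1/2)) * (C * mi_fact K powr \<epsilon> * mi_fact K powr \<epsilon>)"
      proof (intro mult_mono mult_left_mono)
        have "mi_fact N powr (2 * \<epsilon>) / mi_fact N = mi_fact N powr (2 * \<epsilon> - 1)"
          using mi_fact_pos[of N] by (simp add: powr_diff)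
        also have "\<dots> \<le> mi_fact N powr - (1/2)"
          using \<epsilon> mi_fact_ge1[of N] by (intro powr_mono) auto
        finally show "mi_fact N powr (2 * \<epsilon>) / mi_fact N \<le> mi_fact N powr - (1/2)" .
      qed (use AB C in \<open>auto intro!: mult_right_mono mult_nonneg_nonneg less_imp_le[OF mi_fact_pos]\<close>)
      also have "\<dots> = A * B * u N * mi_fact K powr (2 * \<epsilon>)"
        by (simp add: u_def mult_ac flip: powr_add)
      finally show "cmod (wick_coeff c a b N K) \<le> A * B * u N * mi_fact K powr (2 * \<epsilon>)" .
    qed
  qed
qed

lemma wick_coeff_subfactorial_bound:
  assumes "a \<in> subfactorial" "b \<in> subfactorial" "0 < \<delta>"
  obtains u where "\<And>N. 0 \<le> u N" "u summable_on UNIV" "\<And>N. fact_bounded \<delta> (u N) (wick_coeff c a b N)"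
proof -
  \<comment> \<open>The exponent doubles in \<open>fact_bounded_wick_coeff\<close>, which also asks
    for at most \<open>1/4\<close>.\<close>
  define \<epsilon> where "\<epsilon> = min (\<delta> / 2) (1/4)"
  have \<epsilon>: "0 < \<epsilon>" "\<epsilon> \<le> 1/4" "2 * \<epsilon> \<le> \<delta>" using assms(3) by (auto simp: \<epsilon>_def)
  obtain A where A: "0 \<le> A" "fact_bounded \<epsilon> A a" using subfactorialD[OF assms(1) \<epsilon>(1)] .
  obtain B where B: "0 \<le> B" "fact_bounded \<epsilon> B b" using subfactorialD[OF assms(2) \<epsilon>(1)] .
  obtain u :: "nat ^ 'a \<Rightarrow> real" where u: "\<And>N. 0 \<le> u N" "u summable_on UNIV"
    "\<And>a b A B N. fact_bounded \<epsilon> A a \<Longrightarrow> fact_bounded \<epsilon> B b \<Longrightarrow>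
       fact_bounded (2 * \<epsilon>) (A * B * u N) (wick_coeff c a b N)"
    by (rule fact_bounded_wick_coeff[OF \<epsilon>(1,2), where c = c and 'n = 'a]) blast
  show ?thesis
  proof (rule that[of "\<lambda>N. A * B * u N"])
    show "(\<lambda>N. A * B * u N) summable_on UNIV"
      by (rule summable_on_cmult_right[OF u(2)])
    show "fact_bounded \<delta> (A * B * u N) (wick_coeff c a b N)" for N
      using u(3)[OF A(2) B(2)] \<epsilon>(3) by (rule fact_bounded_mono) simp
  qed (use A B u in auto)
qed

lemma wick_coeff_subfactorial:
  assumes "a \<in> subfactorial" "b \<in> subfactorial"
  shows "wick_coeff c a b N \<in> subfactorial"
proof (rule subfactorialI)
  fix \<epsilon> :: real assume "0 < \<epsilon>"
  then show "\<exists>A. fact_bounded \<epsilon> A (wick_coeff c a b N)"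
    using wick_coeff_subfactorial_bound[OF assms] by metis
qed

lemma wick_coeff_summable:
  assumes "a \<in> subfactorial" "b \<in> subfactorial"
  shows "(\<lambda>N. wick_coeff c a b N K) summable_on UNIV"
  using wick_coeff_subfactorial_bound[OF assms zero_less_one] fact_bounded_summable(2) by metis

lemma wick_sum_subfactorial:
  assumes "a \<in> subfactorial" "b \<in> subfactorial"
  shows "wick_sum c a b \<in> subfactorial"
proof (rule subfactorialI)
  fix \<epsilon> :: real assume "0 < \<epsilon>"
  then obtain u where "u summable_on UNIV" "\<And>N. fact_bounded \<epsilon> (u N) (wick_coeff c a b N)"
    using wick_coeff_subfactorial_bound[OF assms, where c = c] by metis
  then show "\<exists>A. fact_bounded \<epsilon> A (wick_sum c a b)"
    unfolding wick_sum_def using fact_bounded_infsum by blast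
qed

text \<open>The constant is uniform in both arrays, so this is the estimate behind the joint
  continuity of the product.\<close>

lemma fact_bounded_wick_sum:
  assumes "0 < \<delta>"
  obtains \<epsilon> C where "0 < \<epsilon>" "0 \<le> C"
    "\<And>(a :: nat ^ ('n::finite + 'n) \<Rightarrow> complex) b A B. fact_bounded \<epsilon> A a \<Longrightarrow> fact_bounded \<epsilon> B b \<Longrightarrow>
      fact_bounded \<delta> (C * A * B) (wick_sum c a b)"
proof -
  define \<epsilon> where "\<epsilon> = min (\<delta> / 2) (1/4)"
  have \<epsilon>: "0 < \<epsilon>" "\<epsilon> \<le> 1/4" "2 * \<epsilon> \<le> \<delta>" using assms by (auto simp: \<epsilon>_def)
  obtain u :: "nat ^ 'n \<Rightarrow> real" where u: "\<And>N. 0 \<le> u N" "u summable_on UNIV"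
    "\<And>a b A B N. fact_bounded \<epsilon> A a \<Longrightarrow> fact_bounded \<epsilon> B b \<Longrightarrow>
       fact_bounded (2 * \<epsilon>) (A * B * u N) (wick_coeff c a b N)"
    by (rule fact_bounded_wick_coeff[OF \<epsilon>(1,2), where c = c and 'n = 'n]) blast
  show ?thesis
  proof (rule that[of \<epsilon> "infsum u UNIV"])
    show "0 \<le> infsum u UNIV" using u(1) by (intro infsum_nonneg) auto
    fix a b :: "nat ^ ('n + 'n) \<Rightarrow> complex" and A B
    assume "fact_bounded \<epsilon> A a" "fact_bounded \<epsilon> B b"
    then have "fact_bounded (2 * \<epsilon>) (\<Sum>\<^sub>\<infinity>N. A * B * u N) (\<lambda>K. \<Sum>\<^sub>\<infinity>N. wick_coeff c a b N K)"
      using u by (intro fact_bounded_infsum summable_on_cmult_right) auto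
    then show "fact_bounded \<delta> (infsum u UNIV * A * B) (wick_sum c a b)"
      unfolding wick_sum_def[symmetric]
      by (rule fact_bounded_mono) (use \<epsilon> in \<open>auto simp: infsum_cmult_right' mult_ac\<close>)
  qed (use \<epsilon> in auto)
qed

lemma wick_coeff_add_left:
  "wick_coeff c (\<lambda>K. a K + a' K) b N K = wick_coeff c a b N K + wick_coeff c a' b N K"
  by (simp add: wick_coeff_def shift_def leibniz_add_left distrib_left)

lemma wick_coeff_add_right:
  "wick_coeff c a (\<lambda>K. b K + b' K) N K = wick_coeff c a b N K + wick_coeff c a b' N K"
  by (simp add: wick_coeff_def shift_def leibniz_add_right distrib_left)

lemma wick_coeff_scale_left: "wick_coeff c (\<lambda>K. d * a K) b N K = d * wick_coeff c a b N K"
  by (simp add: wick_coeff_def shift_def leibniz_scale_left)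

lemma wick_coeff_scale_right: "wick_coeff c a (\<lambda>K. d * b K) N K = d * wick_coeff c a b N K"
  by (simp add: wick_coeff_def shift_def leibniz_scale_right)

lemma wick_sum_add_left:
  assumes "a \<in> subfactorial" "a' \<in> subfactorial" "b \<in> subfactorial"
  shows "wick_sum c (\<lambda>K. a K + a' K) b = (\<lambda>K. wick_sum c a b K + wick_sum c a' b K)"
  by (simp add: wick_sum_def wick_coeff_add_left infsum_add wick_coeff_summable assms)

lemma wick_sum_add_right:
  assumes "a \<in> subfactorial" "b \<in> subfactorial" "b' \<in> subfactorial"
  shows "wick_sum c a (\<lambda>K. b K + b' K) = (\<lambda>K. wick_sum c a b K + wick_sum c a b' K)"
  by (simp add: wick_sum_def wick_coeff_add_right infsum_add wick_coeff_summable assms)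

lemma wick_sum_scale_left: "wick_sum c (\<lambda>K. d * a K) b = (\<lambda>K. d * wick_sum c a b K)"
  by (simp add: wick_sum_def wick_coeff_scale_left infsum_cmult_right')

lemma wick_sum_scale_right: "wick_sum c a (\<lambda>K. d * b K) = (\<lambda>K. d * wick_sum c a b K)"
  by (simp add: wick_sum_def wick_coeff_scale_right infsum_cmult_right')

text \<open>Differentiation commutes with the shifts inside each term and with the convergent sum,
  so the product rule for \<open>leibniz\<close> carries over.\<close>

lemma shift_wick_sum:
  assumes "a \<in> subfactorial" "b \<in> subfactorial"
  shows "shift (axis j 1) (wick_sum c a b) =
    (\<lambda>K. wick_sum c (shift (axis j 1) a) b K + wick_sum c a (shift (axis j 1) b) K)"
proof
  fix K
  let ?e = "axis j 1"
  have "wick_coeff c a b N (K + ?e) =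
      wick_coeff c (shift ?e a) b N K + wick_coeff c a (shift ?e b) N K" for N
  proof -
    have "leibniz (shift (mi_join N 0) a) (shift (mi_join 0 N) b) (K + ?e) =
        leibniz (shift (mi_join N 0) (shift ?e a)) (shift (mi_join 0 N) b) K +
        leibniz (shift (mi_join N 0) a) (shift (mi_join 0 N) (shift ?e b)) K"
      using shift_leibniz[of j "shift (mi_join N 0) a" "shift (mi_join 0 N) b" K]
      unfolding shift_shift by (simp add: shift_def add_ac)
    then show ?thesis by (simp add: wick_coeff_def distrib_left add_divide_distrib)
  qed
  then show "shift ?e (wick_sum c a b) K = wick_sum c (shift ?e a) b K + wick_sum c a (shift ?e b) K"
    unfolding wick_sum_def
    by (subst shift_def) (simp add: infsum_add wick_coeff_summable subfactorial_shift assms)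
qed

section \<open>Associativity through an absolutely convergent triple series\<close>

lemma summable_on_mult_pair:
  fixes u :: "'i \<Rightarrow> real" and v :: "'j \<Rightarrow> real"
  assumes "\<And>x. 0 \<le> u x" "\<And>y. 0 \<le> v y" "u summable_on UNIV" "v summable_on UNIV"
  shows "(\<lambda>(x, y). u x * v y) summable_on UNIV"
proof -
  have "(\<lambda>(x, y). u x * v y) summable_on Sigma UNIV (\<lambda>_. UNIV)"
  proof (rule summable_on_SigmaI)
    show "((\<lambda>y. case (x, y) of (x, y) \<Rightarrow> u x * v y) has_sum u x * infsum v UNIV) UNIV" for x
      using has_sum_cmult_right[OF has_sum_infsum[OF assms(4)], of "u x"] by simp
  qed (use assms in \<open>auto intro!: summable_on_cmult_left\<close>)
  then show ?thesis by simp
qed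

text \<open>Collects the triples with \<open>I + K = M\<close>: pairs of an index \<open>M\<close>
  and some \<open>I\<close> below it are in bijection with pairs \<open>I\<close>, \<open>K\<close>,
  and summability over all triples justifies the rearrangement.\<close>

lemma infsum_multiindex_split:
  fixes g :: "nat ^ 'n \<Rightarrow> nat ^ 'n \<Rightarrow> nat ^ 'n \<Rightarrow> complex"
  assumes "(\<lambda>(N, I, K). g N I K) summable_on UNIV"
  shows "(\<Sum>\<^sub>\<infinity>M. \<Sum>\<^sub>\<infinity>N. \<Sum>I\<le>M. g N I (M - I)) = (\<Sum>\<^sub>\<infinity>(N, I, K). g N I K)"
proof -
  let ?S = "SIGMA M : UNIV. UNIV \<times> {..M}  :: ((nat ^ 'n) \<times> (nat ^ 'n) \<times> (nat ^ 'n)) set"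
  let ?f = "\<lambda>(M, N, I). g N I (M - I)"
  let ?h = "\<lambda>(M :: nat ^ 'n, N :: nat ^ 'n, I :: nat ^ 'n). (N, I, M - I)"
  have bij: "bij_betw ?h ?S UNIV"
    by (rule bij_betw_byWitness[where f' = "\<lambda>(N, I, K). (I + K, N, I)"])
      (auto simp: vec_eq_iff less_eq_vec_def)
  have fh: "?f = (\<lambda>x. (\<lambda>(N, I, K). g N I K) (?h x))" by auto
  have sm: "?f summable_on ?S"
    unfolding fh using summable_on_reindex_bij_betw[OF bij, of "\<lambda>(N, I, K). g N I K"] assms by blast
  have "(\<Sum>\<^sub>\<infinity>(N, I, K). g N I K) = infsum ?f ?S"
    unfolding fh by (rule infsum_reindex_bij_betw[OF bij, symmetric])
  also have "\<dots> = (\<Sum>\<^sub>\<infinity>M. \<Sum>\<^sub>\<infinity>y\<in>UNIV \<times> {..M}. ?f (M, y))"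
    using infsum_Sigma_banach[OF sm] by simp
  also have "\<dots> = (\<Sum>\<^sub>\<infinity>M. \<Sum>\<^sub>\<infinity>N. \<Sum>I\<le>M. g N I (M - I))"
  proof (rule infsum_cong)
    fix M
    have "(\<lambda>(N, I). g N I (M - I)) summable_on UNIV \<times> {..M}"
      using summable_on_SigmaD1[where f = "\<lambda>M y. ?f (M, y)" and A = UNIV and B = "\<lambda>M. UNIV \<times> {..M}"]
        sm by (simp add: case_prod_unfold)
    then have "(\<Sum>\<^sub>\<infinity>y\<in>UNIV \<times> {..M}. (\<lambda>(N, I). g N I (M - I)) y) = (\<Sum>\<^sub>\<infinity>N. \<Sum>\<^sub>\<infinity>I\<in>{..M}. g N I (M - I))"
      using infsum_Sigma_banach[of "\<lambda>(N, I). g N I (M - I)" UNIV "\<lambda>_. {..M}"] by simp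
    then show "(\<Sum>\<^sub>\<infinity>y\<in>UNIV \<times> {..M}. ?f (M, y)) = (\<Sum>\<^sub>\<infinity>N. \<Sum>I\<le>M. g N I (M - I))"
      by simp
  qed
  finally show ?thesis ..
qed

lemma wick_sum_at_0:
  "wick_sum c a b 0 = (\<Sum>\<^sub>\<infinity>N. c ^ mi_abs N / of_real (mi_fact N) * (a (mi_join N 0) * b (mi_join 0 N)))"
  by (simp add: wick_sum_def wick_coeff_def shift_def)

lemma mi_le_join_0: "{..mi_join M 0} = (\<lambda>I. mi_join I 0) ` {..M}"
proof -
  have "K \<in> (\<lambda>I. mi_join I 0) ` {..M}" if "K \<le> mi_join M 0" for K
  proof -
    obtain R S where K: "K = mi_join R S" by (rule mi_join_cases)
    with that have "S \<le> 0" by simp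
    then have "S = 0" by (simp add: less_eq_vec_def vec_eq_iff)
    with K that show ?thesis by auto
  qed
  then show ?thesis by auto
qed

lemma mi_le_0_join: "{..mi_join 0 M} = (\<lambda>I. mi_join 0 I) ` {..M}"
proof -
  have "K \<in> (\<lambda>I. mi_join 0 I) ` {..M}" if "K \<le> mi_join 0 M" for K
  proof -
    obtain R S where K: "K = mi_join R S" by (rule mi_join_cases)
    with that have "R \<le> 0" by simp
    then have "R = 0" by (simp add: less_eq_vec_def vec_eq_iff)
    with K that show ?thesis by auto
  qed
  then show ?thesis by auto
qed

lemma mi_binom_0 [simp]: "mi_binom 0 0 = 1"
  by (simp add: mi_binom_def)

lemma leibniz_join_0:
  "leibniz a b (mi_join M 0) = (\<Sum>I\<le>M. of_nat (mi_binom M I) * (a (mi_join I 0) * b (mi_join (M - I) 0)))"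
  unfolding leibniz_def mi_le_join_0
  by (subst sum.reindex) (auto simp: inj_on_def mi_join_diff)

lemma leibniz_0_join:
  "leibniz a b (mi_join 0 M) = (\<Sum>I\<le>M. of_nat (mi_binom M I) * (a (mi_join 0 I) * b (mi_join 0 (M - I))))"
  unfolding leibniz_def mi_le_0_join
  by (subst sum.reindex) (auto simp: inj_on_def mi_join_diff)

lemma mi_binom_div_fact:
  assumes "I \<le> M"
  shows "of_nat (mi_binom M I) / of_real (mi_fact M) =
    (1 / (of_real (mi_fact I) * of_real (mi_fact (M - I))) :: complex)"
proof -
  have "complex_of_real (real (mi_binom M I) * (mi_fact I * mi_fact (M - I))) = of_real (mi_fact M)"
    using mi_binom_fact[OF assms] by simp
  moreover have "mi_fact I \<noteq> 0" "mi_fact (M - I) \<noteq> 0" "mi_fact M \<noteq> 0"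
    using mi_fact_pos[of I] mi_fact_pos[of "M - I"] mi_fact_pos[of M] by simp_all
  ultimately show ?thesis by (simp add: field_simps)
qed

lemma power_mi_abs_split: "I \<le> M \<Longrightarrow> c ^ mi_abs M = c ^ mi_abs I * (c ^ mi_abs (M - I) :: complex)"
  by (metis add.commute mi_abs_add mi_minus_add power_add)

text \<open>One index for each pair of factors: \<open>N\<close> counts the contractions of
  \<open>a\<close> with \<open>b\<close>, \<open>I\<close> those of \<open>a\<close> with
  \<open>d\<close>, \<open>K\<close> those of \<open>b\<close> with \<open>d\<close>. Both
  bracketings expand into these terms.\<close>

definition triple_coeff :: "complex \<Rightarrow> (nat ^ ('n::finite + 'n) \<Rightarrow> complex) \<Rightarrow> (nat ^ ('n + 'n) \<Rightarrow> complex)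
    \<Rightarrow> (nat ^ ('n + 'n) \<Rightarrow> complex) \<Rightarrow> nat ^ 'n \<Rightarrow> nat ^ 'n \<Rightarrow> nat ^ 'n \<Rightarrow> complex" where
  "triple_coeff c a b d N I K =
    c ^ mi_abs N / of_real (mi_fact N) * (c ^ mi_abs I / of_real (mi_fact I)) * (c ^ mi_abs K / of_real (mi_fact K))
     * (a (mi_join (I + N) 0) * b (mi_join K N) * d (mi_join 0 (I + K)))"

lemma triple_coeff_summable:
  fixes a b d :: "nat ^ ('n::finite + 'n) \<Rightarrow> complex"
  assumes "a \<in> subfactorial" "b \<in> subfactorial" "d \<in> subfactorial"
  shows "(\<lambda>(N, I, K). triple_coeff c a b d N I K) summable_on UNIV"
proof -
  \<comment> \<open>Each of the three factorials occurs twice in the product of the bounds, so the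
    exponent \<open>1/4\<close> costs a square root, and the division by the factorials leaves the
    exponent \<open>- (1/2)\<close>.\<close>
  obtain A where A: "0 \<le> A" "fact_bounded (1/4) A a" using subfactorialD[OF assms(1), of "1/4"] by auto
  obtain B where B: "0 \<le> B" "fact_bounded (1/4) B b" using subfactorialD[OF assms(2), of "1/4"] by auto
  obtain D where D: "0 \<le> D" "fact_bounded (1/4) D d" using subfactorialD[OF assms(3), of "1/4"] by auto
  define u where "u = (\<lambda>N :: nat ^ 'n. (4 * cmod c) ^ mi_abs N * mi_fact N powr - (1/2))"
  have u: "u summable_on UNIV" "\<And>N. 0 \<le> u N"
    using summable_power_fact[of "4 * cmod c" "1/2"] by (simp_all add: u_def)
  have "(\<lambda>(N, I, K). u N * (u I * u K)) summable_on UNIV"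
    using summable_on_mult_pair[of u "\<lambda>(I, K). u I * u K"] summable_on_mult_pair[of u u] u
    by (auto simp: case_prod_unfold)
  then have sm: "(\<lambda>(N, I, K). A * B * D * (u N * (u I * u K))) summable_on UNIV"
    using summable_on_cmult_right[of "\<lambda>(N, I, K). u N * (u I * u K)" UNIV "A * B * D"]
    by (simp add: case_prod_unfold)
  have bound: "cmod (triple_coeff c a b d N I K) \<le> A * B * D * (u N * (u I * u K))" for N I K
  proof -
    let ?f = "mi_fact N * mi_fact I * mi_fact K"
    let ?p = "4 ^ mi_abs N * 4 ^ mi_abs I * 4 ^ mi_abs K :: real"
    have "mi_fact (I + N) * (mi_fact K * mi_fact N) * mi_fact (I + K) \<le>
        (2 ^ mi_abs I * 2 ^ mi_abs N * (mi_fact I * mi_fact N)) * (mi_fact K * mi_fact N)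
        * (2 ^ mi_abs I * 2 ^ mi_abs K * (mi_fact I * mi_fact K))"
      by (intro mult_mono mi_fact_add_le) auto
    also have "\<dots> = (4 ^ mi_abs I * 2 ^ mi_abs N * 2 ^ mi_abs K) * ?f\<^sup>2"
    proof -
      have "(4::real) ^ mi_abs I = 2 ^ mi_abs I * 2 ^ mi_abs I"
        by (simp flip: power_mult_distrib)
      then show ?thesis by (simp add: power2_eq_square mult_ac)
    qed
    also have "\<dots> \<le> (4 ^ mi_abs I * 4 ^ mi_abs N * 4 ^ mi_abs K) * ?f\<^sup>2"
      by (intro mult_right_mono mult_mono power_mono) auto
    finally have "(mi_fact (I + N) * (mi_fact K * mi_fact N) * mi_fact (I + K)) powr (1/4) \<le> (?p * ?f\<^sup>2) powr (1/4)"
      by (intro powr_mono2) (auto simp: mult_ac)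
    also have "\<dots> = ?p powr (1/4) * ?f powr (1/2)"
      using mi_fact_pos[of N] mi_fact_pos[of I] mi_fact_pos[of K]
      by (simp add: powr_mult powr_powr flip: powr_numeral)
    also have "?p powr (1/4) \<le> ?p powr 1"
    proof (rule powr_mono)
      have "1 * 1 * 1 \<le> ?p" by (intro mult_mono one_le_power) auto
      then show "1 \<le> ?p" by simp
    qed auto
    finally have f: "(mi_fact (I + N) * (mi_fact K * mi_fact N) * mi_fact (I + K)) powr (1/4) \<le> ?p * ?f powr (1/2)"
      by (simp add: mult_right_mono)
    have "cmod (a (mi_join (I + N) 0) * b (mi_join K N) * d (mi_join 0 (I + K))) \<le>
        (A * mi_fact (I + N) powr (1/4)) * (B * (mi_fact K * mi_fact N) powr (1/4)) * (D * mi_fact (I + K) powr (1/4))"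
      unfolding norm_mult
      using fact_boundedD[OF A(2), of "mi_join (I + N) 0"] fact_boundedD[OF B(2), of "mi_join K N"]
        fact_boundedD[OF D(2), of "mi_join 0 (I + K)"] A B D
      by (intro mult_mono) auto
    also have "\<dots> = A * B * D * (mi_fact (I + N) * (mi_fact K * mi_fact N) * mi_fact (I + K)) powr (1/4)"
      by (simp add: powr_mult mult_ac)
    also have "\<dots> \<le> A * B * D * (?p * ?f powr (1/2))"
      using f A B D by (intro mult_left_mono) auto
    finally have g: "cmod (a (mi_join (I + N) 0) * b (mi_join K N) * d (mi_join 0 (I + K))) \<le> \<dots>" .
    have half: "x powr (1/2) / x = x powr - (1/2)" if "0 < x" for x :: real
      using that powr_diff[of x "1/2" 1] by simp
    have "cmod (triple_coeff c a b d N I K) =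
        cmod c ^ mi_abs N / mi_fact N * (cmod c ^ mi_abs I / mi_fact I) * (cmod c ^ mi_abs K / mi_fact K) *
        cmod (a (mi_join (I + N) 0) * b (mi_join K N) * d (mi_join 0 (I + K)))"
      by (simp add: triple_coeff_def norm_mult norm_divide norm_power)
    also have "\<dots> \<le> cmod c ^ mi_abs N / mi_fact N * (cmod c ^ mi_abs I / mi_fact I) * (cmod c ^ mi_abs K / mi_fact K) *
        (A * B * D * (?p * ?f powr (1/2)))"
      by (intro mult_left_mono g) auto
    also have "\<dots> = A * B * D * (((4 * cmod c) ^ mi_abs N * (mi_fact N powr (1/2) / mi_fact N)) *
        (((4 * cmod c) ^ mi_abs I * (mi_fact I powr (1/2) / mi_fact I)) *
         ((4 * cmod c) ^ mi_abs K * (mi_fact K powr (1/2) / mi_fact K))))"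
      by (simp add: powr_mult power_mult_distrib mult_ac)
    also have "\<dots> = A * B * D * (u N * (u I * u K))"
      unfolding half[OF mi_fact_pos] u_def ..
    finally show ?thesis .
  qed
  have "(\<lambda>x. norm ((\<lambda>(N, I, K). triple_coeff c a b d N I K) x)) summable_on UNIV"
    by (rule summable_on_comparison_test[OF sm]) (use bound in auto)
  then show ?thesis by (rule abs_summable_summable)
qed

text \<open>On the left the outer index \<open>M\<close> distributes z derivatives over
  \<open>a\<close> and \<open>b\<close>, so \<open>M = I + K\<close>; on the right it distributes
  z-bar derivatives over \<open>b\<close> and \<open>d\<close>, so \<open>M = N + I\<close>. At the
  index 0 the outer product has no further derivatives to distribute.\<close>

lemma wick_sum_assoc_at_0:
  fixes a b d :: "nat ^ ('n::finite + 'n) \<Rightarrow> complex"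
  assumes "a \<in> subfactorial" "b \<in> subfactorial" "d \<in> subfactorial"
  shows "wick_sum c (wick_sum c a b) d 0 = wick_sum c a (wick_sum c b d) 0"
proof -
  let ?T = "triple_coeff c a b d"
  note T = triple_coeff_summable[OF assms, of c]
  \<comment> \<open>The cyclic permutation brings \<open>K\<close> to the front, where the second
    use of \<open>infsum_multiindex_split\<close> expects the inner index.\<close>
  have bij: "bij_betw (\<lambda>(K :: nat ^ 'n, N :: nat ^ 'n, I :: nat ^ 'n). (N, I, K)) UNIV UNIV"
    by (rule bij_betw_byWitness[where f' = "\<lambda>(N, I, K). (K, N, I)"]) auto
  have fact0: "complex_of_real (mi_fact N) \<noteq> 0" for N :: "nat ^ 'n"
    using mi_fact_pos[of N] by simp
  have "wick_sum c (wick_sum c a b) d 0 = (\<Sum>\<^sub>\<infinity>M. \<Sum>\<^sub>\<infinity>N. \<Sum>I\<le>M. ?T N I (M - I))"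
    unfolding wick_sum_at_0
  proof (rule infsum_cong)
    fix M :: "nat ^ 'n"
    let ?q = "c ^ mi_abs M / of_real (mi_fact M)"
    have "?q * (wick_sum c a b (mi_join M 0) * d (mi_join 0 M)) =
        (\<Sum>\<^sub>\<infinity>N. ?q * d (mi_join 0 M) * wick_coeff c a b N (mi_join M 0))"
      unfolding wick_sum_def infsum_cmult_right' by (simp add: mult_ac)
    also have "\<dots> = (\<Sum>\<^sub>\<infinity>N. \<Sum>I\<le>M. ?T N I (M - I))"
    proof (rule infsum_cong)
      fix N
      have "?q * d (mi_join 0 M) * wick_coeff c a b N (mi_join M 0) =
          (\<Sum>I\<le>M. (of_nat (mi_binom M I) / of_real (mi_fact M)) * c ^ mi_abs M * (c ^ mi_abs N / of_real (mi_fact N)) *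
            (a (mi_join (I + N) 0) * b (mi_join (M - I) N) * d (mi_join 0 M)))"
        unfolding wick_coeff_def leibniz_join_0 sum_distrib_left
        by (rule sum.cong) (auto simp: shift_def mi_join_add)
      also have "\<dots> = (\<Sum>I\<le>M. ?T N I (M - I))"
      proof (rule sum.cong)
        fix I assume "I \<in> {..M}"
        then have I: "I \<le> M" by simp
        then have "I + (M - I) = M" using mi_minus_add by (metis add.commute)
        then show "of_nat (mi_binom M I) / of_real (mi_fact M) * c ^ mi_abs M * (c ^ mi_abs N / of_real (mi_fact N)) *
            (a (mi_join (I + N) 0) * b (mi_join (M - I) N) * d (mi_join 0 M)) = ?T N I (M - I)"
          unfolding mi_binom_div_fact[OF I] power_mi_abs_split[OF I] triple_coeff_def
          by (simp add: mult_ac)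
      qed simp
      finally show "?q * d (mi_join 0 M) * wick_coeff c a b N (mi_join M 0) = (\<Sum>I\<le>M. ?T N I (M - I))" .
    qed
    finally show "?q * (wick_sum c a b (mi_join M 0) * d (mi_join 0 M)) = (\<Sum>\<^sub>\<infinity>N. \<Sum>I\<le>M. ?T N I (M - I))" .
  qed
  also have "\<dots> = (\<Sum>\<^sub>\<infinity>(N, I, K). ?T N I K)"
    by (rule infsum_multiindex_split[OF T])
  also have "\<dots> = (\<Sum>\<^sub>\<infinity>(K, N, I). ?T N I K)"
    using infsum_reindex_bij_betw[OF bij, of "\<lambda>(N, I, K). ?T N I K"] by (simp add: case_prod_unfold)
  also have "\<dots> = (\<Sum>\<^sub>\<infinity>M. \<Sum>\<^sub>\<infinity>K. \<Sum>N\<le>M. ?T N (M - N) K)"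
  proof (rule infsum_multiindex_split[symmetric])
    from summable_on_reindex_bij_betw[OF bij, of "\<lambda>(N, I, K). ?T N I K"] T
    show "(\<lambda>(K, N, I). ?T N I K) summable_on UNIV" by (simp add: case_prod_unfold)
  qed
  also have "\<dots> = wick_sum c a (wick_sum c b d) 0"
    unfolding wick_sum_at_0
  proof (rule infsum_cong)
    fix M :: "nat ^ 'n"
    let ?q = "c ^ mi_abs M / of_real (mi_fact M)"
    have "?q * (a (mi_join M 0) * wick_sum c b d (mi_join 0 M)) =
        (\<Sum>\<^sub>\<infinity>K. ?q * a (mi_join M 0) * wick_coeff c b d K (mi_join 0 M))"
      unfolding wick_sum_def infsum_cmult_right' by (simp add: mult_ac)
    also have "\<dots> = (\<Sum>\<^sub>\<infinity>K. \<Sum>N\<le>M. ?T N (M - N) K)"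
    proof (rule infsum_cong)
      fix K
      have "?q * a (mi_join M 0) * wick_coeff c b d K (mi_join 0 M) =
          (\<Sum>N\<le>M. (of_nat (mi_binom M N) / of_real (mi_fact M)) * c ^ mi_abs M * (c ^ mi_abs K / of_real (mi_fact K)) *
            (a (mi_join M 0) * b (mi_join K N) * d (mi_join 0 (M - N + K))))"
        unfolding wick_coeff_def leibniz_0_join sum_distrib_left
        by (rule sum.cong) (auto simp: shift_def mi_join_add)
      also have "\<dots> = (\<Sum>N\<le>M. ?T N (M - N) K)"
      proof (rule sum.cong)
        fix N assume "N \<in> {..M}"
        then have N: "N \<le> M" by simp
        then have "M - N + N = M" using mi_minus_add by metis
        then show "of_nat (mi_binom M N) / of_real (mi_fact M) * c ^ mi_abs M * (c ^ mi_abs K / of_real (mi_fact K)) *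
            (a (mi_join M 0) * b (mi_join K N) * d (mi_join 0 (M - N + K))) = ?T N (M - N) K"
          unfolding mi_binom_div_fact[OF N] power_mi_abs_split[OF N] triple_coeff_def
          by (simp add: mult_ac)
      qed simp
      finally show "?q * a (mi_join M 0) * wick_coeff c b d K (mi_join 0 M) = (\<Sum>N\<le>M. ?T N (M - N) K)" .
    qed
    finally show "(\<Sum>\<^sub>\<infinity>K. \<Sum>N\<le>M. ?T N (M - N) K) = ?q * (a (mi_join M 0) * wick_sum c b d (mi_join 0 M))" ..
  qed
  finally show ?thesis .
qed

text \<open>Shifts act as derivations of the product, hence of the associator; so it suffices that the
  associator vanishes at index \<open>0\<close>.\<close>

lemma wick_sum_assoc:
  assumes "a \<in> subfactorial" "b \<in> subfactorial" "d \<in> subfactorial"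
  shows "wick_sum c (wick_sum c a b) d = wick_sum c a (wick_sum c b d)"
proof
  fix K
  show "wick_sum c (wick_sum c a b) d K = wick_sum c a (wick_sum c b d) K"
    using assms
  proof (induction K arbitrary: a b d rule: multiindex_induct)
    case zero
    then show ?case by (rule wick_sum_assoc_at_0)
  next
    case (step K j)
    let ?s = "shift (axis j 1)"
    note sub = wick_sum_subfactorial subfactorial_shift step.prems
    have "?s (wick_sum c (wick_sum c a b) d) K = ?s (wick_sum c a (wick_sum c b d)) K"
      by (simp add: shift_wick_sum wick_sum_add_left wick_sum_add_right sub step.IH del: One_nat_def)
    then show ?case by (simp add: shift_def)
  qed
qed

section \<open>Complex conjugation of arrays\<close>

definition jet_cnj :: "(nat ^ ('n::finite + 'n) \<Rightarrow> complex) \<Rightarrow> nat ^ ('n + 'n) \<Rightarrow> complex" where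
  "jet_cnj a = (\<lambda>K. cnj (a (mi_swap K)))"

lemma fact_bounded_cnj: "fact_bounded \<epsilon> A a \<Longrightarrow> fact_bounded \<epsilon> A (jet_cnj a)"
  by (metis complex_mod_cnj fact_bounded_def jet_cnj_def mi_fact_swap)

lemma subfactorial_cnj: "a \<in> subfactorial \<Longrightarrow> jet_cnj a \<in> subfactorial"
  unfolding subfactorial_def using fact_bounded_cnj by blast

lemma mi_swap_le_eq: "mi_swap I \<le> K \<longleftrightarrow> I \<le> mi_swap K"
  by (metis mi_swap_le_iff mi_swap_swap)

lemma leibniz_jet_cnj: "leibniz (jet_cnj a) (jet_cnj b) = jet_cnj (leibniz a b)"
proof
  fix K :: "nat ^ ('a + 'a)"
  show "leibniz (jet_cnj a) (jet_cnj b) K = jet_cnj (leibniz a b) K"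
    unfolding leibniz_def jet_cnj_def cnj_sum
    by (rule sum.reindex_bij_witness[where i = mi_swap and j = mi_swap])
      (auto simp: mi_swap_le_eq simp flip: mi_swap_diff)
qed

lemma shift_jet_cnj: "shift L (jet_cnj a) = jet_cnj (shift (mi_swap L) a)"
  by (simp add: shift_def jet_cnj_def mi_swap_add)

text \<open>The swap exchanges z and z-bar derivatives, so the left factor of the product becomes
  the right one. The coefficients have to be real to be fixed by conjugation.\<close>

lemma wick_sum_cnj:
  assumes "cnj c = c"
  shows "wick_sum c (jet_cnj b) (jet_cnj a) = jet_cnj (wick_sum c a b)"
proof -
  have "wick_coeff c (jet_cnj b) (jet_cnj a) N = jet_cnj (wick_coeff c a b N)" for N
    unfolding wick_coeff_def shift_jet_cnj mi_swap_join leibniz_jet_cnj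
    using leibniz_commute[of "shift (mi_join 0 N) b" "shift (mi_join N 0) a"]
    by (simp add: jet_cnj_def assms)
  then show ?thesis
    by (simp add: wick_sum_def jet_cnj_def flip: infsum_cnj)
qed

section \<open>Smooth functions\<close>

lemma dir_deriv_eq: "(f has_derivative D) (at x) \<Longrightarrow> dir_deriv v f x = D v"
  using frechet_derivative_at unfolding dir_deriv_def by metis

lemma has_derivative_dir_deriv:
  "f differentiable (at x) \<Longrightarrow> (f has_derivative (\<lambda>v. dir_deriv v f x)) (at x)"
  unfolding dir_deriv_def using frechet_derivative_works by blast

lemma smooth_differentiable: "smooth f \<Longrightarrow> f differentiable (at x)"
  unfolding smooth_def by (metis fold_Nil id_apply)

lemma smooth_has_derivative: "smooth f \<Longrightarrow> (f has_derivative (\<lambda>v. dir_deriv v f x)) (at x)"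
  by (intro has_derivative_dir_deriv smooth_differentiable)

lemma smooth_dir_deriv: "smooth f \<Longrightarrow> smooth (dir_deriv v f)"
  unfolding smooth_def by (metis comp_apply fold_Cons)

text \<open>Induction over the list of directions happens here once. Later proofs of smoothness only
  exhibit a set that is stable under directional derivatives.\<close>

lemma smooth_coinduct:
  assumes "\<And>f x. f \<in> C \<Longrightarrow> f differentiable (at x)" "\<And>f v. f \<in> C \<Longrightarrow> dir_deriv v f \<in> C" "f \<in> C"
  shows "smooth f"
proof -
  have "fold dir_deriv vs f \<in> C" for vs
    using assms(3) by (induction vs arbitrary: f) (auto intro: assms(2))
  then show ?thesis unfolding smooth_def using assms(1) by blast
qed

lemma dir_deriv_add:
  assumes "f differentiable (at x)" "g differentiable (at x)"
  shows "dir_deriv v (\<lambda>x. f x + g x) x = dir_deriv v f x + dir_deriv v g x"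
  by (rule dir_deriv_eq) (intro has_derivative_add has_derivative_dir_deriv assms)

lemma dir_deriv_mult:
  assumes "f differentiable (at x)" "g differentiable (at x)"
  shows "dir_deriv v (\<lambda>x. f x * g x) x = f x * dir_deriv v g x + dir_deriv v f x * g x"
  by (rule dir_deriv_eq) (intro has_derivative_mult has_derivative_dir_deriv assms)

lemma dir_deriv_cnj:
  assumes "f differentiable (at x)"
  shows "dir_deriv v (\<lambda>x. cnj (f x)) x = cnj (dir_deriv v f x)"
  by (rule dir_deriv_eq) (intro has_derivative_cnj has_derivative_dir_deriv assms)

lemma dir_deriv_const [simp]: "dir_deriv v (\<lambda>x. c) = (\<lambda>x. 0)"
  by (simp add: dir_deriv_def)

text \<open>Derivatives of products are sums of products, so the products of smooth functions alone
  are not visibly stable under derivatives; the closure under all the operations is.\<close>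

inductive_set smooth_closure :: "(complex ^ 'n \<Rightarrow> complex) set" where
  smooth: "smooth f \<Longrightarrow> f \<in> smooth_closure"
| const: "(\<lambda>x. c) \<in> smooth_closure"
| add: "f \<in> smooth_closure \<Longrightarrow> g \<in> smooth_closure \<Longrightarrow> (\<lambda>x. f x + g x) \<in> smooth_closure"
| mult: "f \<in> smooth_closure \<Longrightarrow> g \<in> smooth_closure \<Longrightarrow> (\<lambda>x. f x * g x) \<in> smooth_closure"
| cnj: "f \<in> smooth_closure \<Longrightarrow> (\<lambda>x. cnj (f x)) \<in> smooth_closure"

lemma smooth_closure_step:
  "f \<in> smooth_closure \<Longrightarrow> (\<forall>x. f differentiable (at x)) \<and> (\<forall>v. dir_deriv v f \<in> smooth_closure)"
proof (induction rule: smooth_closure.induct)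
  case (smooth f)
  then show ?case by (auto intro: smooth_differentiable smooth_dir_deriv smooth_closure.smooth)
next
  case (const c)
  then show ?case by (auto intro: smooth_closure.const)
next
  case (add f g)
  then have "dir_deriv v (\<lambda>x. f x + g x) = (\<lambda>x. dir_deriv v f x + dir_deriv v g x)" for v
    by (intro ext dir_deriv_add) auto
  with add show ?case by (simp add: smooth_closure.add)
next
  case (mult f g)
  then have "dir_deriv v (\<lambda>x. f x * g x) = (\<lambda>x. f x * dir_deriv v g x + dir_deriv v f x * g x)" for v
    by (intro ext dir_deriv_mult) auto
  with mult show ?case by (simp add: smooth_closure.add smooth_closure.mult)
next
  case (cnj f)
  then have "dir_deriv v (\<lambda>x. cnj (f x)) = (\<lambda>x. cnj (dir_deriv v f x))" for v
    by (intro ext dir_deriv_cnj) auto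
  moreover have "(\<lambda>x. cnj (f x)) differentiable (at x)" for x
    by (rule differentiableI[OF has_derivative_cnj[OF has_derivative_dir_deriv]]) (use cnj in auto)
  ultimately show ?case using cnj by (simp add: smooth_closure.cnj)
qed

lemma smooth_closure_smooth: "f \<in> smooth_closure \<Longrightarrow> smooth f"
  by (rule smooth_coinduct[of smooth_closure]) (use smooth_closure_step in auto)

lemma smooth_const [simp]: "smooth (\<lambda>x. c)"
  by (intro smooth_closure_smooth smooth_closure.const)

lemma smooth_add: "smooth f \<Longrightarrow> smooth g \<Longrightarrow> smooth (\<lambda>x. f x + g x)"
  by (rule smooth_closure_smooth[OF smooth_closure.add[OF smooth_closure.smooth smooth_closure.smooth]])

lemma smooth_mult: "smooth f \<Longrightarrow> smooth g \<Longrightarrow> smooth (\<lambda>x. f x * g x)"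
  by (rule smooth_closure_smooth[OF smooth_closure.mult[OF smooth_closure.smooth smooth_closure.smooth]])

lemma smooth_cnj: "smooth f \<Longrightarrow> smooth (\<lambda>x. cnj (f x))"
  by (rule smooth_closure_smooth[OF smooth_closure.cnj[OF smooth_closure.smooth]])

lemma smooth_cmult: "smooth f \<Longrightarrow> smooth (\<lambda>x. c * f x)"
  by (intro smooth_mult smooth_const)

lemma smooth_diff: "smooth f \<Longrightarrow> smooth g \<Longrightarrow> smooth (\<lambda>x. f x - g x)"
  using smooth_add[OF _ smooth_cmult[of g "-1"]] by simp

text \<open>The second difference minus its expected value is the increment of \<open>\<phi>\<close>
  from 0 to \<open>s\<close>. The derivative of \<open>\<phi>\<close> compares two values of
  \<open>dir_deriv v f\<close> near \<open>x\<close>, which the total differentiability of that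
  function at \<open>x\<close> controls; the mean value inequality concludes.\<close>

lemma second_difference:
  fixes f :: "complex ^ 'n \<Rightarrow> complex"
  assumes f: "\<And>y. f differentiable (at y)" and L: "(dir_deriv v f has_derivative L) (at x)" and e: "0 < e"
  obtains d where "0 < d" "\<And>s. 0 < s \<Longrightarrow> s < d \<Longrightarrow>
    cmod (f (x + s *\<^sub>R v + s *\<^sub>R w) - f (x + s *\<^sub>R v) - f (x + s *\<^sub>R w) + f x - s\<^sup>2 *\<^sub>R L w) \<le> e * s\<^sup>2"
proof -
  let ?g = "dir_deriv v f"
  \<comment> \<open>The points at which \<open>dir_deriv v f\<close> is evaluated lie within
    \<open>s * M\<close> of \<open>x\<close>; the summand 1 keeps \<open>M\<close> positive when
    both directions vanish.\<close>
  define M where "M = norm v + norm w + 1"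
  have M: "0 < M" "norm v + norm w \<le> M" by (auto simp: M_def add_nonneg_pos)
  interpret L: bounded_linear L using L by (rule has_derivative_bounded_linear)
  \<comment> \<open>Half of \<open>e\<close>, because \<open>bound\<close> subtracts two such
    estimates.\<close>
  have "0 < e / (2 * M)" using e M by simp
  then obtain \<delta> where \<delta>: "0 < \<delta>"
    "\<And>y. norm (y - x) < \<delta> \<Longrightarrow> norm (?g y - ?g x - L (y - x)) \<le> e / (2 * M) * norm (y - x)"
    using L unfolding has_derivative_at_alt by metis
  show ?thesis
  proof (rule that[of "\<delta> / M"])
    show "0 < \<delta> / M" using \<delta> M by simp
    fix s :: real assume s: "0 < s" "s < \<delta> / M"
    define \<phi> where "\<phi> t = f (x + t *\<^sub>R v + s *\<^sub>R w) - f (x + t *\<^sub>R v) - (t * s) *\<^sub>R L w" for t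
    let ?\<phi>' = "\<lambda>t h. h *\<^sub>R (?g (x + t *\<^sub>R v + s *\<^sub>R w) - ?g (x + t *\<^sub>R v) - s *\<^sub>R L w)"
    have scale: "dir_deriv (h *\<^sub>R v) f y = h *\<^sub>R ?g y" for h y
      using has_derivative_bounded_linear[OF has_derivative_dir_deriv[OF f]]
        bounded_linear.linear linear_scale by blast
    have deriv: "(\<phi> has_derivative ?\<phi>' t) (at t within {0..s})" for t
    proof -
      have 1: "((\<lambda>t. f (x + t *\<^sub>R v + z)) has_derivative (\<lambda>h. dir_deriv (h *\<^sub>R v) f (x + t *\<^sub>R v + z))) (at t)" for z
      proof (rule has_derivative_compose[OF _ has_derivative_dir_deriv[OF f]])
        have "((\<lambda>t. x + (t *\<^sub>R v + z)) has_derivative (\<lambda>h. 0 + (h *\<^sub>R v + 0))) (at t)"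
          by (intro has_derivative_add has_derivative_const has_derivative_scaleR_left has_derivative_ident)
        then show "((\<lambda>t. x + t *\<^sub>R v + z) has_derivative (\<lambda>h. h *\<^sub>R v)) (at t)"
          by (simp add: add.assoc)
      qed
      have 2: "((\<lambda>t. (t * s) *\<^sub>R L w) has_derivative (\<lambda>h. (h * s) *\<^sub>R L w)) (at t)"
        by (intro has_derivative_scaleR_left has_derivative_mult_left has_derivative_ident)
      have "(\<phi> has_derivative (\<lambda>h. dir_deriv (h *\<^sub>R v) f (x + t *\<^sub>R v + s *\<^sub>R w)
          - dir_deriv (h *\<^sub>R v) f (x + t *\<^sub>R v) - (h * s) *\<^sub>R L w)) (at t)"
        unfolding \<phi>_def
        by (rule has_derivative_diff[OF has_derivative_diff[OF 1 1[of 0, unfolded add_0_right]] 2])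
      also have "(\<lambda>h. dir_deriv (h *\<^sub>R v) f (x + t *\<^sub>R v + s *\<^sub>R w)
          - dir_deriv (h *\<^sub>R v) f (x + t *\<^sub>R v) - (h * s) *\<^sub>R L w) = ?\<phi>' t"
        by (simp add: scale scaleR_diff_right)
      finally show ?thesis by (rule has_derivative_at_withinI)
    qed
    have near: "norm (?g (x + y) - ?g x - L y) \<le> e * s / 2" if "norm y \<le> s * M" for y
    proof -
      have "norm y < \<delta>" using that s M by (simp add: field_simps)
      then have "norm (?g (x + y) - ?g x - L y) \<le> e / (2 * M) * norm y"
        using \<delta>(2)[of "x + y"] by simp
      also have "\<dots> \<le> e / (2 * M) * (s * M)" using that e M by (intro mult_left_mono) auto
      also have "\<dots> = e * s / 2" using M by simp
      finally show ?thesis .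
    qed
    have bound: "norm (?g (x + t *\<^sub>R v + s *\<^sub>R w) - ?g (x + t *\<^sub>R v) - s *\<^sub>R L w) \<le> e * s"
      if t: "t \<in> {0..s}" for t
    proof -
      have v: "norm (t *\<^sub>R v) \<le> s * norm v" using t s by (auto intro!: mult_right_mono)
      have "norm (t *\<^sub>R v + s *\<^sub>R w) \<le> s * norm v + s * norm w"
        using v s by (intro norm_triangle_le add_mono) auto
      also have "\<dots> \<le> s * M" using s M by (simp flip: distrib_left)
      finally have 1: "norm (?g (x + (t *\<^sub>R v + s *\<^sub>R w)) - ?g x - L (t *\<^sub>R v + s *\<^sub>R w)) \<le> e * s / 2"
        by (rule near)
      have "s * norm v \<le> s * M" using s by (intro mult_left_mono) (auto simp: M_def)
      with v have 2: "norm (?g (x + t *\<^sub>R v) - ?g x - L (t *\<^sub>R v)) \<le> e * s / 2"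
        by (intro near) auto
      have "?g (x + t *\<^sub>R v + s *\<^sub>R w) - ?g (x + t *\<^sub>R v) - s *\<^sub>R L w =
          (?g (x + (t *\<^sub>R v + s *\<^sub>R w)) - ?g x - L (t *\<^sub>R v + s *\<^sub>R w)) - (?g (x + t *\<^sub>R v) - ?g x - L (t *\<^sub>R v))"
        by (simp add: L.add L.scaleR add.assoc)
      also have "norm \<dots> \<le> e * s / 2 + e * s / 2"
        by (rule order.trans[OF norm_triangle_ineq4 add_mono[OF 1 2]])
      finally show ?thesis by simp
    qed
    have "norm (\<phi> s - \<phi> 0) \<le> (e * s) * norm (s - 0)"
    proof (rule differentiable_bound[where S = "{0..s}" and f' = "?\<phi>'"])
      fix t assume t: "t \<in> {0..s}"
      show "onorm (?\<phi>' t) \<le> e * s"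
      proof (rule onorm_le)
        fix h :: real
        show "norm (?\<phi>' t h) \<le> e * s * norm h"
          using mult_left_mono[OF bound[OF t], of "\<bar>h\<bar>"] by (simp add: mult.commute)
      qed
      show "(\<phi> has_derivative ?\<phi>' t) (at t within {0..s})" by (rule deriv)
    next
      show "s \<in> {0..s}" "0 \<in> {0..s}" using s(1) by simp_all
    qed (rule convex_real_interval)
    moreover have "\<phi> s - \<phi> 0 =
        f (x + s *\<^sub>R v + s *\<^sub>R w) - f (x + s *\<^sub>R v) - f (x + s *\<^sub>R w) + f x - s\<^sup>2 *\<^sub>R L w"
      by (simp add: \<phi>_def power2_eq_square)
    moreover have "e * s * norm (s - 0) = e * s\<^sup>2"
      using s by (simp add: power2_eq_square)
    ultimately show "cmod (f (x + s *\<^sub>R v + s *\<^sub>R w) - f (x + s *\<^sub>R v) - f (x + s *\<^sub>R w) + f x - s\<^sup>2 *\<^sub>R L w) \<le> e * s\<^sup>2"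
      by (simp only:)
  qed
qed

text \<open>The second difference is symmetric in the two directions, and divided by
  \<open>s\<^sup>2\<close> it tends to either mixed derivative.\<close>

lemma dir_deriv_commute:
  assumes "smooth f"
  shows "dir_deriv v (dir_deriv w f) = dir_deriv w (dir_deriv v f)"
proof (rule ext, rule ccontr)
  fix x
  let ?a = "dir_deriv v (dir_deriv w f) x" and ?b = "dir_deriv w (dir_deriv v f) x"
  assume ne: "?a \<noteq> ?b"
  \<comment> \<open>A third of the gap: two errors of size \<open>e\<close> cannot bridge
    it.\<close>
  define e where "e = cmod (?a - ?b) / 3"
  have e: "0 < e" using ne by (simp add: e_def)
  note D = smooth_differentiable[OF assms] smooth_has_derivative[OF smooth_dir_deriv[OF assms]]
  obtain d where d: "0 < d" "\<And>s. 0 < s \<Longrightarrow> s < d \<Longrightarrow>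
      cmod (f (x + s *\<^sub>R v + s *\<^sub>R w) - f (x + s *\<^sub>R v) - f (x + s *\<^sub>R w) + f x - s\<^sup>2 *\<^sub>R ?b) \<le> e * s\<^sup>2"
    by (rule second_difference[OF D e, of x v w]) (rule that; assumption)
  obtain d' where d': "0 < d'" "\<And>s. 0 < s \<Longrightarrow> s < d' \<Longrightarrow>
      cmod (f (x + s *\<^sub>R w + s *\<^sub>R v) - f (x + s *\<^sub>R w) - f (x + s *\<^sub>R v) + f x - s\<^sup>2 *\<^sub>R ?a) \<le> e * s\<^sup>2"
    by (rule second_difference[OF D e, of x w v]) (rule that; assumption)
  obtain s where s: "0 < s" "s < d" "s < d'"
    using d(1) d'(1) by (metis field_lbound_gt_zero)
  let ?\<Delta> = "f (x + s *\<^sub>R v + s *\<^sub>R w) - f (x + s *\<^sub>R v) - f (x + s *\<^sub>R w) + f x"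
  have 1: "cmod (?\<Delta> - s\<^sup>2 *\<^sub>R ?b) \<le> e * s\<^sup>2"
    by (rule d(2)[OF s(1,2)])
  have "f (x + s *\<^sub>R w + s *\<^sub>R v) - f (x + s *\<^sub>R w) - f (x + s *\<^sub>R v) + f x = ?\<Delta>"
    by (simp add: add_ac)
  with d'(2)[OF s(1,3)] have 2: "cmod (?\<Delta> - s\<^sup>2 *\<^sub>R ?a) \<le> e * s\<^sup>2"
    by (simp only:)
  have "cmod ((?\<Delta> - s\<^sup>2 *\<^sub>R ?b) - (?\<Delta> - s\<^sup>2 *\<^sub>R ?a)) \<le> e * s\<^sup>2 + e * s\<^sup>2"
    by (rule order.trans[OF norm_triangle_ineq4 add_mono[OF 1 2]])
  moreover have "(?\<Delta> - s\<^sup>2 *\<^sub>R ?b) - (?\<Delta> - s\<^sup>2 *\<^sub>R ?a) = s\<^sup>2 *\<^sub>R (?a - ?b)"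
    by (simp add: scaleR_diff_right)
  ultimately have "s\<^sup>2 * cmod (?a - ?b) \<le> s\<^sup>2 * (2 * e)" by (simp add: mult_ac)
  then have "cmod (?a - ?b) \<le> 2 * e" using s by simp
  then show False using ne by (simp add: e_def)
qed

section \<open>Jets\<close>

lemma dir_deriv_add_fun:
  "smooth f \<Longrightarrow> smooth g \<Longrightarrow> dir_deriv v (\<lambda>x. f x + g x) = (\<lambda>x. dir_deriv v f x + dir_deriv v g x)"
  by (intro ext dir_deriv_add smooth_differentiable)

lemma dir_deriv_cmult_fun: "smooth f \<Longrightarrow> dir_deriv v (\<lambda>x. c * f x) = (\<lambda>x. c * dir_deriv v f x)"
  by (rule ext) (simp add: dir_deriv_mult smooth_differentiable)

lemma dir_deriv_direction_add:
  "f differentiable (at x) \<Longrightarrow> dir_deriv (v + w) f x = dir_deriv v f x + dir_deriv w f x"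
  using linear_add[OF bounded_linear.linear[OF has_derivative_bounded_linear[OF has_derivative_dir_deriv]]] .

lemma dir_deriv_direction_scaleR:
  "f differentiable (at x) \<Longrightarrow> dir_deriv (r *\<^sub>R v) f x = r *\<^sub>R dir_deriv v f x"
  using linear_scale[OF bounded_linear.linear[OF has_derivative_bounded_linear[OF has_derivative_dir_deriv]]] .

lemma dir_deriv_direction_sum:
  "f differentiable (at x) \<Longrightarrow> dir_deriv (\<Sum>i\<in>A. v i) f x = (\<Sum>i\<in>A. dir_deriv (v i) f x)"
  using linear_sum[OF bounded_linear.linear[OF has_derivative_bounded_linear[OF has_derivative_dir_deriv]]] .

definition der :: "'n::finite + 'n \<Rightarrow> (complex ^ 'n \<Rightarrow> complex) \<Rightarrow> complex ^ 'n \<Rightarrow> complex" where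
  "der j = (case j of Inl i \<Rightarrow> dz i | Inr i \<Rightarrow> dzbar i)"

text \<open>The coefficients dual to \<open>der\<close>: by \<open>dir_deriv_eq_der\<close>, a real
  directional derivative is the combination of the \<open>der j\<close> with these weights.\<close>

definition coord :: "'n::finite + 'n \<Rightarrow> complex ^ 'n \<Rightarrow> complex" where
  "coord j v = (case j of Inl i \<Rightarrow> v $ i | Inr i \<Rightarrow> cnj (v $ i))"

definition opposite :: "'n + 'n \<Rightarrow> 'n + 'n" where
  "opposite j = (case j of Inl i \<Rightarrow> Inr i | Inr i \<Rightarrow> Inl i)"

lemma der_simps [simp]: "der (Inl i) = dz i" "der (Inr i) = dzbar i"
  by (simp_all add: der_def)

lemma coord_simps [simp]: "coord (Inl i) v = v $ i" "coord (Inr i) v = cnj (v $ i)"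
  by (simp_all add: coord_def)

lemma opposite_simps [simp]: "opposite (Inl i) = Inr i" "opposite (Inr i) = Inl i"
  by (simp_all add: opposite_def)

text \<open>Lets one argument serve z and z-bar: the directions and coefficients do not depend on
  the function, so linearity, smoothness and commutation are inherited from
  \<open>dir_deriv\<close>.\<close>

lemma der_dir_deriv:
  obtains v w b c where "\<And>f. der j f = (\<lambda>x. b * dir_deriv v f x + c * dir_deriv w f x)"
proof (cases j)
  case (Inl i)
  show ?thesis
    by (rule that[of "1 / 2" "axis i 1" "- \<i> / 2" "axis i \<i>"]) (simp add: Inl dz_def diff_divide_distrib)
next
  case (Inr i)
  show ?thesis
    by (rule that[of "1 / 2" "axis i 1" "\<i> / 2" "axis i \<i>"]) (simp add: Inr dzbar_def add_divide_distrib)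
qed

lemma smooth_der: "smooth f \<Longrightarrow> smooth (der j f)"
  by (rule der_dir_deriv[of j]) (simp only: smooth_add smooth_cmult smooth_dir_deriv)

lemma der_add: "smooth f \<Longrightarrow> smooth g \<Longrightarrow> der j (\<lambda>x. f x + g x) = (\<lambda>x. der j f x + der j g x)"
  by (rule der_dir_deriv[of j]) (simp add: dir_deriv_add_fun algebra_simps)

lemma der_cmult: "smooth f \<Longrightarrow> der j (\<lambda>x. c * f x) = (\<lambda>x. c * der j f x)"
  by (rule der_dir_deriv[of j]) (simp add: dir_deriv_cmult_fun algebra_simps)

lemma der_mult:
  "smooth f \<Longrightarrow> smooth g \<Longrightarrow> der j (\<lambda>x. f x * g x) = (\<lambda>x. der j f x * g x + f x * der j g x)"
  by (rule der_dir_deriv[of j]) (simp add: dir_deriv_mult smooth_differentiable algebra_simps)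

lemma der_cnj: "smooth f \<Longrightarrow> der j (\<lambda>x. cnj (f x)) = (\<lambda>x. cnj (der (opposite j) f x))"
  by (cases j) (simp_all add: dz_def dzbar_def dir_deriv_cnj smooth_differentiable)

lemma der_commute:
  assumes "smooth f" shows "der j (der k f) = der k (der j f)"
proof -
  obtain v w b c where j: "\<And>f. der j f = (\<lambda>x. b * dir_deriv v f x + c * dir_deriv w f x)"
    by (rule der_dir_deriv[of j]) (rule that; assumption)
  obtain v' w' b' c' where k: "\<And>f. der k f = (\<lambda>x. b' * dir_deriv v' f x + c' * dir_deriv w' f x)"
    by (rule der_dir_deriv[of k]) (rule that; assumption)
  note lin = dir_deriv_add_fun dir_deriv_cmult_fun smooth_cmult smooth_dir_deriv assms
  note comm = dir_deriv_commute[OF assms, of v v'] dir_deriv_commute[OF assms, of v w']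
    dir_deriv_commute[OF assms, of w v'] dir_deriv_commute[OF assms, of w w']
  show ?thesis
    unfolding j k by (simp add: lin comm algebra_simps)
qed

lemma wirtinger_decomposition:
  "of_real (Re z) * a + of_real (Im z) * b = z * ((a - \<i> * b) / 2) + cnj z * ((a + \<i> * b) / 2)"
  by (simp add: complex_eq_iff algebra_simps add_divide_distrib diff_divide_distrib)

lemma dir_deriv_eq_der:
  assumes "smooth f"
  shows "dir_deriv v f x = (\<Sum>j\<in>UNIV. coord j v * der j f x)"
proof -
  note f = smooth_differentiable[OF assms, of x]
  define w where "w = (\<Sum>i\<in>UNIV. Re (v $ i) *\<^sub>R axis i 1 + Im (v $ i) *\<^sub>R axis i \<i>)"
  have "v = w"
    by (simp add: w_def vec_eq_iff axis_def sum.distrib complex_eq_iff if_distrib if_distribR cong: if_cong)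
  then have "dir_deriv v f x = dir_deriv w f x" by simp
  also have "\<dots> = (\<Sum>i\<in>UNIV. of_real (Re (v $ i)) * dir_deriv (axis i 1) f x
      + of_real (Im (v $ i)) * dir_deriv (axis i \<i>) f x)"
    unfolding w_def dir_deriv_direction_sum[OF f] dir_deriv_direction_add[OF f]
      dir_deriv_direction_scaleR[OF f] scaleR_conv_of_real[where 'a = complex] ..
  also have "\<dots> = (\<Sum>i\<in>UNIV. v $ i * dz i f x + cnj (v $ i) * dzbar i f x)"
    unfolding wirtinger_decomposition dz_def dzbar_def ..
  also have "\<dots> = (\<Sum>j\<in>UNIV. coord j v * der j f x)"
    by (simp add: sum_sum_type sum.distrib)
  finally show ?thesis .
qed

section \<open>Iterated derivatives along the fixed enumeration\<close>

lemma index_list: "distinct (index_list :: 'n::finite list)" "set (index_list :: 'n list) = UNIV"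
proof -
  have "\<exists>xs :: 'n list. distinct xs \<and> set xs = UNIV"
    using finite_distinct_list[OF finite_class.finite_UNIV] by auto
  from someI_ex[OF this] show "distinct (index_list :: 'n list)" "set (index_list :: 'n list) = UNIV"
    by (auto simp: index_list_def)
qed

text \<open>Derivatives are known to commute on smooth functions only. The set \<open>S\<close>
  carries this restriction through the following lemmas; it is instantiated by
  \<open>Collect smooth\<close>.\<close>

lemma funpow_closed: "(\<And>f. f \<in> S \<Longrightarrow> d f \<in> S) \<Longrightarrow> f \<in> S \<Longrightarrow> (d ^^ k) f \<in> S"
  by (induction k) auto

lemma funpow_commute:
  assumes "\<And>f. f \<in> S \<Longrightarrow> d f \<in> S" "\<And>f. f \<in> S \<Longrightarrow> d (e f) = e (d f)" "f \<in> S"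
  shows "(d ^^ k) (e f) = e ((d ^^ k) f)"
  by (induction k) (simp_all add: assms funpow_closed)

lemma fold_funpow_closed:
  assumes "\<And>i f. f \<in> S \<Longrightarrow> d i f \<in> S" "f \<in> S"
  shows "fold (\<lambda>i. d i ^^ R i) xs f \<in> S"
  using assms(2) by (induction xs arbitrary: f) (auto intro: funpow_closed assms(1))

lemma fold_funpow_commute:
  assumes "\<And>i f. f \<in> S \<Longrightarrow> d i f \<in> S" "\<And>i f. f \<in> S \<Longrightarrow> d i (e f) = e (d i f)" "f \<in> S"
  shows "fold (\<lambda>i. d i ^^ R i) xs (e f) = e (fold (\<lambda>i. d i ^^ R i) xs f)"
  using assms(3)
proof (induction xs arbitrary: f)
  case (Cons x xs)
  then show ?case
    by (simp add: funpow_commute[of S "d x" e] assms(1,2) funpow_closed)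
qed simp

text \<open>The extra derivative is moved through the powers in front of \<open>j\<close> by
  commutation and then joins the power at \<open>j\<close>. Distinctness ensures that no later power
  is changed.\<close>

lemma fold_funpow_Suc:
  assumes "\<And>i f. f \<in> S \<Longrightarrow> d i f \<in> S" "\<And>i k f. f \<in> S \<Longrightarrow> d i (d k f) = d k (d i f)"
    "f \<in> S" "distinct xs" "j \<in> set xs"
  shows "fold (\<lambda>i. d i ^^ (if i = j then Suc (R i) else R i)) xs f = fold (\<lambda>i. d i ^^ R i) xs (d j f)"
  using assms(3-5)
proof (induction xs arbitrary: f)
  case (Cons x xs)
  show ?case
  proof (cases "x = j")
    case True
    with Cons.prems have "fold (\<lambda>i. d i ^^ (if i = j then Suc (R i) else R i)) xs g =
        fold (\<lambda>i. d i ^^ R i) xs g" for g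
      by (intro fold_cong) auto
    with True show ?thesis by (simp add: funpow_swap1)
  next
    case False
    with Cons.prems Cons.IH[of "(d x ^^ R x) f"] show ?thesis
      by (simp add: funpow_commute[of S "d x" "d j"] assms(1,2) funpow_closed)
  qed
qed simp

lemma multi_deriv_axis:
  fixes j :: "'k::finite"
  assumes "\<And>i f. f \<in> S \<Longrightarrow> d i f \<in> S" "\<And>i k f. f \<in> S \<Longrightarrow> d i (d k f) = d k (d i f)" "f \<in> S"
  shows "multi_deriv d (R + axis j 1) f = multi_deriv d R (d j f)"
proof -
  have "(\<lambda>i. d i ^^ ((R + axis j 1) $ i)) = (\<lambda>i. d i ^^ (if i = j then Suc (R $ i) else R $ i))"
    by (auto simp: axis_def)
  then show ?thesis
    unfolding multi_deriv_def
    using fold_funpow_Suc[where S = S and d = d and R = "($) R" and f = f and xs = index_list and j = j]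
      assms index_list[where 'n = 'k] by (simp del: vector_add_component)
qed

definition mi_left :: "nat ^ ('n::finite + 'n) \<Rightarrow> nat ^ 'n" where
  "mi_left K = (\<chi> i. K $ Inl i)"

definition mi_right :: "nat ^ ('n::finite + 'n) \<Rightarrow> nat ^ 'n" where
  "mi_right K = (\<chi> i. K $ Inr i)"

definition jet :: "complex ^ 'n \<Rightarrow> (complex ^ 'n \<Rightarrow> complex) \<Rightarrow> nat ^ ('n::finite + 'n) \<Rightarrow> complex" where
  "jet p f = (\<lambda>K. wirtinger (mi_left K) (mi_right K) f p)"

lemma mi_left_right_join [simp]: "mi_left (mi_join R S) = R" "mi_right (mi_join R S) = S"
  by (simp_all add: mi_left_def mi_right_def vec_eq_iff)

lemma smooth_multi_deriv:
  assumes "\<And>i f. smooth f \<Longrightarrow> smooth (d i f)" "smooth f"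
  shows "smooth (multi_deriv d R f)"
  using fold_funpow_closed[where S = "Collect smooth" and d = d and f = f] assms
  by (simp add: multi_deriv_def)

lemma smooth_wirtinger: "smooth f \<Longrightarrow> smooth (wirtinger R S f)"
  unfolding wirtinger_def
  by (intro smooth_multi_deriv) (use smooth_der[of _ "Inl _"] smooth_der[of _ "Inr _"] in simp_all)

lemma wirtinger_0 [simp]:
  fixes f :: "complex ^ 'n \<Rightarrow> complex"
  shows "wirtinger 0 0 f = f"
proof -
  have "fold (\<lambda>i. id) xs g = g" for xs :: "'n list" and g :: "complex ^ 'n \<Rightarrow> complex"
    by (induction xs) auto
  then show ?thesis by (simp add: wirtinger_def multi_deriv_def id_def[symmetric])
qed

text \<open>The additional derivative is placed innermost, so that proofs by
  \<open>multiindex_induct\<close> can generalise over the function. A z derivative has to pass all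
  z-bar derivatives for this.\<close>

lemma wirtinger_join_axis:
  assumes "smooth f"
  shows "wirtinger (mi_left (K + axis j 1)) (mi_right (K + axis j 1)) f =
    wirtinger (mi_left K) (mi_right K) (der j f)"
proof -
  obtain R S where K: "K = mi_join R S" by (rule mi_join_cases)
  have sm: "f \<in> Collect smooth" using assms by simp
  have closed: "g \<in> Collect smooth \<Longrightarrow> dz i g \<in> Collect smooth"
    "g \<in> Collect smooth \<Longrightarrow> dzbar i g \<in> Collect smooth" for g and i :: 'a
    using smooth_der[of g "Inl i"] smooth_der[of g "Inr i"] by simp_all
  have comm: "g \<in> Collect smooth \<Longrightarrow> dz i (dz k g) = dz k (dz i g)"
    "g \<in> Collect smooth \<Longrightarrow> dzbar i (dzbar k g) = dzbar k (dzbar i g)"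
    "g \<in> Collect smooth \<Longrightarrow> dzbar i (dz k g) = dz k (dzbar i g)" for g and i k :: 'a
    using der_commute[of g "Inl i" "Inl k"] der_commute[of g "Inr i" "Inr k"]
      der_commute[of g "Inr i" "Inl k"] by simp_all
  show ?thesis
  proof (cases j)
    case (Inl i)
    have S: "multi_deriv dzbar S f \<in> Collect smooth"
      using smooth_multi_deriv[of dzbar f S] sm closed(2) by simp
    have "multi_deriv dz (R + axis i 1) (multi_deriv dzbar S f) = multi_deriv dz R (dz i (multi_deriv dzbar S f))"
      by (rule multi_deriv_axis[where S = "Collect smooth"]; fact closed(1) comm(1) S)
    also have "dz i (multi_deriv dzbar S f) = multi_deriv dzbar S (dz i f)"
      unfolding multi_deriv_def
      by (rule fold_funpow_commute[where S = "Collect smooth" and e = "dz i", symmetric]; fact closed(2) comm(3) sm)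
    finally show ?thesis
      unfolding K Inl axis_Inl mi_join_add by (simp add: wirtinger_def)
  next
    case (Inr i)
    have "multi_deriv dzbar (S + axis i 1) f = multi_deriv dzbar S (dzbar i f)"
      by (rule multi_deriv_axis[where S = "Collect smooth"]; fact closed(2) comm(2) sm)
    then show ?thesis
      unfolding K Inr axis_Inr mi_join_add by (simp add: wirtinger_def)
  qed
qed

section \<open>The calculus of jets\<close>

lemma wirtinger_eq_jet: "wirtinger R S f p = jet p f (mi_join R S)"
  by (simp add: jet_def)

lemma jet_0 [simp]: "jet p f 0 = f p"
proof -
  have "mi_left 0 = (0 :: nat ^ 'a)" "mi_right 0 = (0 :: nat ^ 'a)"
    by (simp_all add: mi_left_def mi_right_def vec_eq_iff)
  then show ?thesis by (simp add: jet_def)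
qed

lemma jet_axis: "smooth f \<Longrightarrow> jet p f (K + axis j 1) = jet p (der j f) K"
  unfolding jet_def by (simp only: wirtinger_join_axis)

lemma jet_der: "smooth f \<Longrightarrow> jet p (der j f) = shift (axis j 1) (jet p f)"
  by (rule ext) (simp only: shift_def jet_axis)

lemma jet_add: "smooth f \<Longrightarrow> smooth g \<Longrightarrow> jet p (\<lambda>x. f x + g x) = (\<lambda>K. jet p f K + jet p g K)"
proof (rule ext)
  fix K assume "smooth f" "smooth g"
  then show "jet p (\<lambda>x. f x + g x) K = jet p f K + jet p g K"
  proof (induction K arbitrary: f g rule: multiindex_induct)
    case (step K j)
    then show ?case by (simp only: jet_axis smooth_add der_add smooth_der)
  qed simp
qed

lemma jet_cmult: "smooth f \<Longrightarrow> jet p (\<lambda>x. c * f x) = (\<lambda>K. c * jet p f K)"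
proof (rule ext)
  fix K assume "smooth f"
  then show "jet p (\<lambda>x. c * f x) K = c * jet p f K"
  proof (induction K arbitrary: f rule: multiindex_induct)
    case (step K j)
    then show ?case by (simp only: jet_axis smooth_cmult der_cmult smooth_der)
  qed simp
qed

lemma jet_diff: "smooth f \<Longrightarrow> smooth g \<Longrightarrow> jet p (\<lambda>x. f x - g x) = (\<lambda>K. jet p f K - jet p g K)"
  using jet_add[of f "\<lambda>x. -1 * g x" p] jet_cmult[of g p "-1"] smooth_cmult[of g "-1"] by simp

lemma jet_zero: "jet p (\<lambda>x. 0) = (\<lambda>K. 0)"
  using jet_cmult[of "\<lambda>x. 0" p 0] by simp

lemma jet_mult: "smooth f \<Longrightarrow> smooth g \<Longrightarrow> jet p (\<lambda>x. f x * g x) = leibniz (jet p f) (jet p g)"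
proof (rule ext)
  fix K assume "smooth f" "smooth g"
  then show "jet p (\<lambda>x. f x * g x) K = leibniz (jet p f) (jet p g) K"
  proof (induction K arbitrary: f g rule: multiindex_induct)
    case (step K j)
    have "jet p (\<lambda>x. f x * g x) (K + axis j 1) = jet p (\<lambda>x. der j f x * g x + f x * der j g x) K"
      using step.prems by (simp only: jet_axis smooth_mult der_mult)
    also have "\<dots> = leibniz (shift (axis j 1) (jet p f)) (jet p g) K + leibniz (jet p f) (shift (axis j 1) (jet p g)) K"
      using step.prems by (simp only: jet_add smooth_mult smooth_der step.IH jet_der)
    also have "\<dots> = leibniz (jet p f) (jet p g) (K + axis j 1)"
      unfolding shift_leibniz[symmetric] by (simp add: shift_def)
    finally show ?case .
  qed simp
qed

lemma jet_of_cnj: "smooth f \<Longrightarrow> jet p (\<lambda>x. cnj (f x)) = jet_cnj (jet p f)"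
proof (rule ext)
  fix K assume "smooth f"
  then show "jet p (\<lambda>x. cnj (f x)) K = jet_cnj (jet p f) K"
  proof (induction K arbitrary: f rule: multiindex_induct)
    case zero
    have "mi_swap 0 = (0 :: nat ^ ('a + 'a))" by (simp add: sum_vec_eq_iff)
    then show ?case by (simp add: jet_cnj_def)
  next
    case (step K j)
    have "mi_swap (axis j 1) = axis (opposite j) 1"
      by (cases j) (simp_all add: sum_vec_eq_iff axis_def)
    with step show ?case
      by (simp only: jet_axis smooth_cnj der_cnj smooth_der jet_cnj_def mi_swap_add)
  qed
qed

lemma jet_wirtinger:
  assumes "smooth f" shows "jet p (wirtinger R S f) = shift (mi_join R S) (jet p f)"
proof -
  have "jet p (wirtinger (mi_left L) (mi_right L) f) = shift L (jet p f)" for L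
    using assms
  proof (induction L arbitrary: f rule: multiindex_induct)
    case zero
    have "mi_left 0 = (0 :: nat ^ 'a)" "mi_right 0 = (0 :: nat ^ 'a)"
      by (simp_all add: mi_left_def mi_right_def vec_eq_iff)
    then show ?case by (simp add: shift_def)
  next
    case (step L j)
    then show ?case by (simp only: wirtinger_join_axis jet_der smooth_der shift_shift)
  qed
  from this[of "mi_join R S"] show ?thesis by simp
qed

lemma jet_sum:
  "finite A \<Longrightarrow> (\<And>i. i \<in> A \<Longrightarrow> smooth (f i)) \<Longrightarrow>
    smooth (\<lambda>x. \<Sum>i\<in>A. f i x) \<and> jet p (\<lambda>x. \<Sum>i\<in>A. f i x) = (\<lambda>K. \<Sum>i\<in>A. jet p (f i) K)"
  by (induction A rule: finite_induct) (auto simp: jet_zero smooth_add jet_add)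

lemma jet_dir_deriv:
  "smooth f \<Longrightarrow> jet p (dir_deriv v f) = (\<lambda>K. \<Sum>j\<in>UNIV. coord j v * jet p (der j f) K)"
proof -
  assume f: "smooth f"
  have eq: "dir_deriv v f = (\<lambda>x. \<Sum>j\<in>UNIV. coord j v * der j f x)"
    by (rule ext) (rule dir_deriv_eq_der[OF f])
  show ?thesis
    unfolding eq
    using jet_sum[of UNIV "\<lambda>j x. coord j v * der j f x" p] by (simp add: smooth_cmult smooth_der jet_cmult f)
qed

text \<open>The definition of \<open>jet_null\<close> speaks of real directional derivatives, the
  arrays of Wirtinger derivatives; each kind is a complex combination of the other. One direction is
  an induction over the list of directions, the other over the multiindex, using that
  \<open>jet_null p\<close> is stable under derivatives and linear combinations.\<close>

lemma jet_null_iff: "f \<in> jet_null p \<longleftrightarrow> smooth f \<and> jet p f = (\<lambda>K. 0)"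
proof safe
  assume f: "smooth f" "jet p f = (\<lambda>K. 0)"
  have "fold dir_deriv vs f p = 0" for vs
    using f
  proof (induction vs arbitrary: f)
    case Nil
    then show ?case using jet_0[of p f] by simp
  next
    case (Cons v vs)
    have "jet p (dir_deriv v f) = (\<lambda>K. 0)"
      using Cons.prems by (simp add: jet_dir_deriv jet_der shift_def)
    from Cons.IH[OF smooth_dir_deriv[OF Cons.prems(1)] this] show ?case by simp
  qed
  with f show "f \<in> jet_null p" by (simp add: jet_null_def)
next
  assume f: "f \<in> jet_null p"
  then show "smooth f" by (simp add: jet_null_def)
  have null_dir: "dir_deriv v g \<in> jet_null p" if "g \<in> jet_null p" for g v
  proof -
    have "fold dir_deriv (v # vs) g p = 0" for vs
      using that unfolding jet_null_def by blast
    then show ?thesis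
      using that by (simp add: jet_null_def smooth_dir_deriv)
  qed
  have fold_lin: "fold dir_deriv vs (\<lambda>x. c * g x + d * h x) =
      (\<lambda>x. c * fold dir_deriv vs g x + d * fold dir_deriv vs h x)" if "smooth g" "smooth h" for vs c d g h
    using that
    by (induction vs arbitrary: g h)
      (simp_all add: dir_deriv_add_fun dir_deriv_cmult_fun smooth_cmult smooth_dir_deriv)
  have null_lin: "(\<lambda>x. c * g x + d * h x) \<in> jet_null p" if "g \<in> jet_null p" "h \<in> jet_null p" for c d g h
  proof -
    have "smooth g" "smooth h" using that by (simp_all add: jet_null_def)
    with that show ?thesis
      using fold_lin[of g h] by (simp add: jet_null_def smooth_add smooth_cmult)
  qed
  have null_der: "der j g \<in> jet_null p" if "g \<in> jet_null p" for j g
    by (rule der_dir_deriv[of j]) (simp only: null_lin null_dir that)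
  show "jet p f = (\<lambda>K. 0)"
  proof (rule ext)
    fix K show "jet p f K = 0"
      using f
    proof (induction K arbitrary: f rule: multiindex_induct)
      case (zero f)
      then have "fold dir_deriv [] f p = 0" unfolding jet_null_def by blast
      then show ?case by simp
    next
      case (step K j f)
      moreover have "smooth f" using step.prems by (simp add: jet_null_def)
      ultimately show ?case using null_der by (simp only: jet_axis)
    qed
  qed
qed

section \<open>Entire functions with prescribed jets\<close>

text \<open>The division by factorials makes each derivative lower the index without a
  coefficient.\<close>

definition monomial_fn :: "complex ^ 'n \<Rightarrow> nat ^ ('n::finite + 'n) \<Rightarrow> complex ^ 'n \<Rightarrow> complex" where
  "monomial_fn p K x = (\<Prod>j\<in>UNIV. coord j (x - p) ^ (K $ j) / fact (K $ j))"

definition taylor_fn :: "complex ^ 'n \<Rightarrow> (nat ^ ('n::finite + 'n) \<Rightarrow> complex) \<Rightarrow> complex ^ 'n \<Rightarrow> complex" where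
  "taylor_fn p a x = (\<Sum>\<^sub>\<infinity>K. a K * monomial_fn p K x)"

lemma bounded_linear_coord: "bounded_linear (coord j)"
proof (cases j)
  case (Inl i)
  then have "coord j = (\<lambda>v. v $ i)" by auto
  then show ?thesis by (simp add: bounded_linear_vec_nth)
next
  case (Inr i)
  then have "coord j = (\<lambda>v. cnj (v $ i))" by auto
  then show ?thesis
    using bounded_linear_compose[OF bounded_linear_cnj bounded_linear_vec_nth] by simp
qed

lemma norm_coord_le: "cmod (coord j v) \<le> norm v"
  by (cases j) (simp_all add: Finite_Cartesian_Product.norm_nth_le)

lemma norm_monomial_fn_le:
  assumes "norm (x - p) \<le> r"
  shows "cmod (monomial_fn p K x) \<le> r ^ mi_abs K / mi_fact K"
proof -
  have "cmod (monomial_fn p K x) = (\<Prod>j\<in>UNIV. cmod (coord j (x - p)) ^ (K $ j) / fact (K $ j))"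
    by (simp add: monomial_fn_def norm_divide norm_power flip: prod_norm)
  also have "\<dots> \<le> (\<Prod>j\<in>UNIV. r ^ (K $ j) / fact (K $ j))"
    by (intro prod_mono conjI divide_right_mono power_mono order.trans[OF norm_coord_le assms]) auto
  also have "\<dots> = r ^ mi_abs K / mi_fact K"
    by (simp add: prod_dividef power_mi_abs mi_fact_def)
  finally show ?thesis .
qed

text \<open>The explicit 0 is needed because \<open>K - axis j 1\<close> truncates to
  \<open>K\<close> when \<open>K $ j = 0\<close>.\<close>

definition monomial_der :: "complex ^ 'n \<Rightarrow> nat ^ ('n::finite + 'n) \<Rightarrow> complex ^ 'n \<Rightarrow> 'n + 'n \<Rightarrow> complex" where
  "monomial_der p K x j = (if K $ j = 0 then 0 else monomial_fn p (K - axis j 1) x)"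

lemma monomial_fn_has_derivative:
  "(monomial_fn p K has_derivative (\<lambda>w. \<Sum>j\<in>UNIV. coord j w * monomial_der p K x j)) (at x)"
proof -
  let ?q = "\<lambda>j x. coord j (x - p) ^ (K $ j) / fact (K $ j)"
  let ?q' = "\<lambda>j w. coord j w * (if K $ j = 0 then 0 else coord j (x - p) ^ (K $ j - 1) / fact (K $ j - 1))"
  have q: "(?q j has_derivative ?q' j) (at x)" for j
  proof -
    have "((\<lambda>x. coord j (x - p)) has_derivative (\<lambda>w. coord j (w - 0))) (at x)"
      by (intro bounded_linear.has_derivative[OF bounded_linear_coord] has_derivative_diff
          has_derivative_ident has_derivative_const)
    then have "((\<lambda>x. coord j (x - p)) has_derivative coord j) (at x)" by simp
    from has_derivative_power[OF this, of "K $ j"]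
    have "((\<lambda>x. coord j (x - p) ^ (K $ j)) has_derivative
        (\<lambda>w. of_nat (K $ j) * coord j w * coord j (x - p) ^ (K $ j - 1))) (at x)" .
    then have "(?q j has_derivative
        (\<lambda>w. of_nat (K $ j) * coord j w * coord j (x - p) ^ (K $ j - 1) / fact (K $ j))) (at x)"
      using bounded_linear.has_derivative[OF bounded_linear_divide] by fast
    moreover have "(\<lambda>w. of_nat (K $ j) * coord j w * coord j (x - p) ^ (K $ j - 1) / fact (K $ j)) = ?q' j"
    proof (rule ext)
      fix w show "of_nat (K $ j) * coord j w * coord j (x - p) ^ (K $ j - 1) / fact (K $ j) = ?q' j w"
        by (cases "K $ j") (simp_all add: divide_simps del: of_nat_Suc)
    qed
    ultimately show ?thesis by simp
  qed
  have "((\<lambda>x. \<Prod>j\<in>UNIV. ?q j x) has_derivative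
      (\<lambda>w. \<Sum>j\<in>UNIV. ?q' j w * (\<Prod>i\<in>UNIV - {j}. ?q i x))) (at x)"
    by (rule has_derivative_prod[OF q])
  also have "(\<lambda>w. \<Sum>j\<in>UNIV. ?q' j w * (\<Prod>i\<in>UNIV - {j}. ?q i x)) =
      (\<lambda>w. \<Sum>j\<in>UNIV. coord j w * monomial_der p K x j)"
  proof (intro ext sum.cong refl)
    fix w and j :: "'a + 'a"
    have "monomial_fn p (K - axis j 1) x = coord j (x - p) ^ (K $ j - 1) / fact (K $ j - 1) *
        (\<Prod>i\<in>UNIV - {j}. ?q i x)"
    proof -
      have "(\<Prod>i\<in>UNIV - {j}. coord i (x - p) ^ ((K - axis j 1) $ i) / fact ((K - axis j 1) $ i)) =
          (\<Prod>i\<in>UNIV - {j}. ?q i x)"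
        by (rule prod.cong) (auto simp: axis_def)
      then show ?thesis
        unfolding monomial_fn_def
        by (subst prod.remove[of UNIV j]) (auto simp: axis_def)
    qed
    then show "?q' j w * (\<Prod>i\<in>UNIV - {j}. ?q i x) = coord j w * monomial_der p K x j"
      by (simp add: monomial_der_def)
  qed
  finally show ?thesis unfolding monomial_fn_def[abs_def] .
qed

text \<open>Crude, but of the right shape: the derivative of a monomial then obeys the bound of the
  monomial itself with the radius doubled.\<close>

lemma mi_fact_diff_axis: "K $ j \<noteq> 0 \<Longrightarrow> mi_fact K \<le> 2 ^ mi_abs K * mi_fact (K - axis j 1)"
proof -
  assume K: "K $ j \<noteq> 0"
  let ?r = "\<Prod>i\<in>UNIV - {j}. fact (K $ i) :: real"
  have r: "(\<Prod>i\<in>UNIV - {j}. fact ((K - axis j 1) $ i)) = ?r"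
    by (rule prod.cong) (auto simp: axis_def)
  have "mi_fact K = fact (K $ j) * ?r"
    unfolding mi_fact_def by (rule prod.remove) auto
  moreover have "mi_fact (K - axis j 1) = fact (K $ j - 1) * ?r"
    unfolding mi_fact_def using r by (subst prod.remove[of UNIV j]) (auto simp: axis_def)
  moreover have "fact (K $ j) = real (K $ j) * fact (K $ j - 1)"
    using K by (cases "K $ j") auto
  ultimately have eq: "mi_fact K = real (K $ j) * mi_fact (K - axis j 1)"
    by simp
  have "K $ j \<le> mi_abs K" unfolding mi_abs_def by (rule member_le_sum) auto
  then have "real (K $ j) \<le> 2 ^ mi_abs K"
    by (metis less_exp less_imp_le numeral_power_eq_of_nat_cancel_iff of_nat_le_iff order.trans)
  then show ?thesis unfolding eq by (rule mult_right_mono) simp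
qed

lemma norm_monomial_der_le:
  assumes "norm (x - p) \<le> r" "1 \<le> r"
  shows "cmod (monomial_der p K x j) \<le> (2 * r) ^ mi_abs K / mi_fact K"
proof (cases "K $ j = 0")
  case True
  then show ?thesis using assms by (simp add: monomial_der_def)
next
  case False
  have "K = K - axis j 1 + axis j 1"
    using False by (auto simp: vec_eq_iff axis_def)
  then have "mi_abs (K - axis j 1) \<le> mi_abs K"
    by (metis le_add1 mi_abs_add)
  then have r: "r ^ mi_abs (K - axis j 1) \<le> r ^ mi_abs K"
    using assms(2) by (intro power_increasing)
  have "1 / mi_fact (K - axis j 1) \<le> 2 ^ mi_abs K / mi_fact K"
    using mi_fact_diff_axis[OF False] mi_fact_pos[of K] mi_fact_pos[of "K - axis j 1"]
    by (simp add: field_simps)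
  then have "r ^ mi_abs (K - axis j 1) * (1 / mi_fact (K - axis j 1)) \<le> r ^ mi_abs K * (2 ^ mi_abs K / mi_fact K)"
    using r assms(2) by (intro mult_mono) auto
  with norm_monomial_fn_le[OF assms(1), of "K - axis j 1"] False show ?thesis
    by (simp add: monomial_der_def power_mult_distrib mult.commute)
qed

section \<open>Termwise differentiation of Taylor series\<close>

lemma subfactorial_power_summable:
  assumes "a \<in> subfactorial" "0 \<le> r"
  shows "(\<lambda>K. cmod (a K) * (r ^ mi_abs K / mi_fact K)) summable_on UNIV"
proof -
  obtain A where A: "0 \<le> A" "fact_bounded (1/2) A a" using subfactorialD[OF assms(1), of "1/2"] by auto
  show ?thesis
  proof (rule summable_on_comparison_test)
    show "(\<lambda>K :: nat ^ 'a. A * (r ^ mi_abs K * mi_fact K powr - (1/2))) summable_on UNIV"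
      by (intro summable_on_cmult_right summable_power_fact assms) auto
    fix K
    have "cmod (a K) * (r ^ mi_abs K / mi_fact K) \<le> A * mi_fact K powr (1/2) * (r ^ mi_abs K / mi_fact K)"
      using fact_boundedD[OF A(2)] assms(2) by (intro mult_right_mono) auto
    also have "\<dots> = A * (r ^ mi_abs K * (mi_fact K powr (1/2) / mi_fact K))" by simp
    also have "mi_fact K powr (1/2) / mi_fact K = mi_fact K powr - (1/2)"
      using mi_fact_pos[of K] powr_diff[of "mi_fact K" "1/2" 1] by simp
    finally show "cmod (a K) * (r ^ mi_abs K / mi_fact K) \<le> A * (r ^ mi_abs K * mi_fact K powr - (1/2))" .
  qed (use assms in auto)
qed

lemma taylor_fn_summable:
  assumes "a \<in> subfactorial"
  shows "(\<lambda>K. a K * monomial_fn p K x) summable_on UNIV"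
proof (rule abs_summable_summable)
  show "(\<lambda>K. norm (a K * monomial_fn p K x)) summable_on UNIV"
    by (rule summable_on_comparison_test[OF subfactorial_power_summable[OF assms, of "norm (x - p)"]];
        simp only: norm_mult norm_ge_zero mult_nonneg_nonneg mult_left_mono norm_monomial_fn_le order.refl)
qed

lemma infsum_tail_le:
  fixes t :: "'i \<Rightarrow> complex"
  assumes "\<And>K. cmod (t K) \<le> u K" "u summable_on UNIV" "finite F"
  shows "cmod ((\<Sum>K\<in>F. t K) - infsum t UNIV) \<le> infsum u UNIV - (\<Sum>K\<in>F. u K)"
proof -
  have t: "t summable_on UNIV"
    by (rule abs_summable_summable, rule summable_on_comparison_test[OF assms(2)]) (use assms(1) in auto)
  have "infsum t UNIV - (\<Sum>K\<in>F. t K) = infsum t (- F)" "infsum u UNIV - (\<Sum>K\<in>F. u K) = infsum u (- F)"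
    using infsum_Diff[OF t, of F] infsum_Diff[OF assms(2), of F] assms(3)
    by (simp_all add: Compl_eq_Diff_UNIV)
  moreover have "cmod (infsum t (- F)) \<le> infsum u (- F)"
    by (rule norm_infsum_le[OF has_sum_infsum has_sum_infsum assms(1)])
      (auto intro: summable_on_subset_banach[OF t] summable_on_subset_banach[OF assms(2)])
  ultimately show ?thesis by (metis norm_minus_commute)
qed

lemma infinite_multiindices: "infinite (UNIV :: (nat ^ 'k) set)"
proof -
  have "inj (\<lambda>n. vec n :: nat ^ 'k)" by (auto simp: inj_def vec_eq_iff)
  then show ?thesis using range_inj_infinite rev_finite_subset by blast
qed

lemma infsum_finite_sum:
  fixes t :: "'j \<Rightarrow> 'i \<Rightarrow> complex"
  assumes "finite A" "\<And>j. j \<in> A \<Longrightarrow> t j summable_on UNIV"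
  shows "(\<Sum>\<^sub>\<infinity>K. \<Sum>j\<in>A. t j K) = (\<Sum>j\<in>A. \<Sum>\<^sub>\<infinity>K. t j K)"
proof -
  have "((\<lambda>K. \<Sum>j\<in>A. t j K) has_sum (\<Sum>j\<in>A. \<Sum>\<^sub>\<infinity>K. t j K)) UNIV"
    using assms
  proof (induction A rule: finite_induct)
    case (insert x F)
    then show ?case by (simp add: has_sum_add has_sum_infsum)
  qed simp
  then show ?thesis by (rule infsumI)
qed

text \<open>The terms with \<open>K $ j = 0\<close> vanish and all other indices are of the form
  \<open>K + axis j 1\<close>, so differentiating the series shifts the array.\<close>

lemma taylor_fn_derivative_term:
  assumes a: "a \<in> subfactorial"
  shows "(\<Sum>\<^sub>\<infinity>K. a K * (\<Sum>j\<in>UNIV. coord j w * monomial_der p K x j)) =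
    (\<Sum>j\<in>UNIV. coord j w * taylor_fn p (shift (axis j 1) a) x)"
proof -
  define r where "r = max 1 (norm (x - p))"
  have r: "norm (x - p) \<le> r" "1 \<le> r" by (auto simp: r_def)
  then have r2: "0 \<le> 2 * r" by simp
  have sm: "(\<lambda>K. a K * monomial_der p K x j) summable_on UNIV" for j
  proof (rule abs_summable_summable)
    show "(\<lambda>K. norm (a K * monomial_der p K x j)) summable_on UNIV"
      by (rule summable_on_comparison_test[OF subfactorial_power_summable[OF a r2]];
          simp only: norm_mult norm_ge_zero mult_nonneg_nonneg mult_left_mono norm_monomial_der_le[OF r])
  qed
  have "(\<Sum>\<^sub>\<infinity>K. a K * (\<Sum>j\<in>UNIV. coord j w * monomial_der p K x j)) =
      (\<Sum>\<^sub>\<infinity>K. \<Sum>j\<in>UNIV. coord j w * (a K * monomial_der p K x j))"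
    by (simp add: sum_distrib_left mult_ac)
  also have "\<dots> = (\<Sum>j\<in>UNIV. \<Sum>\<^sub>\<infinity>K. coord j w * (a K * monomial_der p K x j))"
    by (rule infsum_finite_sum[OF finite]) (intro summable_on_cmult_right sm)
  also have "\<dots> = (\<Sum>j\<in>UNIV. coord j w * taylor_fn p (shift (axis j 1) a) x)"
  proof (rule sum.cong)
    fix j :: "'a + 'a"
    let ?e = "axis j 1 :: nat ^ ('a + 'a)"
    have "(\<Sum>\<^sub>\<infinity>K. a K * monomial_der p K x j) = (\<Sum>\<^sub>\<infinity>K\<in>range (\<lambda>K. K + ?e). a K * monomial_der p K x j)"
    proof (rule infsum_cong_neutral)
      fix K assume "K \<in> UNIV - range (\<lambda>K. K + ?e)"
      moreover have "K = K - ?e + ?e" if "K $ j \<noteq> 0"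
        using that by (auto simp: vec_eq_iff axis_def)
      ultimately show "a K * monomial_der p K x j = 0"
        unfolding monomial_der_def by auto
    qed auto
    also have "\<dots> = (\<Sum>\<^sub>\<infinity>K. a (K + ?e) * monomial_der p (K + ?e) x j)"
      by (subst infsum_reindex) (auto simp: inj_on_def o_def)
    also have "\<dots> = taylor_fn p (shift ?e a) x"
    proof -
      have "(K + ?e) $ j \<noteq> 0" "K + ?e - ?e = K" for K
        by (auto simp: axis_def vec_eq_iff)
      then show ?thesis by (simp add: taylor_fn_def shift_def monomial_der_def)
    qed
    finally show "(\<Sum>\<^sub>\<infinity>K. coord j w * (a K * monomial_der p K x j)) = coord j w * taylor_fn p (shift ?e a) x"
      by (simp add: infsum_cmult_right')
  qed simp
  finally show ?thesis .
qed

text \<open>On a ball about \<open>p\<close> the differentiated terms have a summable majorant, so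
  the series may be differentiated term by term; every point lies in such a ball.\<close>

lemma taylor_fn_has_derivative:
  assumes a: "a \<in> subfactorial"
  shows "(taylor_fn p a has_derivative (\<lambda>w. \<Sum>j\<in>UNIV. coord j w * taylor_fn p (shift (axis j 1) a) x)) (at x)"
proof -
  \<comment> \<open>The summand 1 puts \<open>x\<close> inside the open ball and gives
    \<open>1 \<le> r\<close>, as \<open>norm_monomial_der_le\<close> asks.\<close>
  define r where "r = norm (x - p) + 1"
  have r: "1 \<le> r" by (simp add: r_def)
  \<comment> \<open>\<open>has_derivative_series\<close> speaks of sequences, so the multiindices
    are enumerated.\<close>
  define \<pi> :: "nat \<Rightarrow> nat ^ ('a + 'a)" where "\<pi> = from_nat_into UNIV"
  have \<pi>: "bij_betw \<pi> UNIV UNIV"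
    unfolding \<pi>_def by (rule bij_betw_from_nat_into[OF _ infinite_multiindices]) simp
  define D where "D = (\<lambda>K y w. a K * (\<Sum>j\<in>UNIV. coord j w * monomial_der p K y j))"
  \<comment> \<open>The cardinality counts the summands of the derivative; the factor 2 comes from
    \<open>norm_monomial_der_le\<close>.\<close>
  define u where "u = (\<lambda>K. real CARD('a + 'a) * (cmod (a K) * ((2 * r) ^ mi_abs K / mi_fact K)))"
  have u: "u summable_on UNIV"
    unfolding u_def using r by (intro summable_on_cmult_right subfactorial_power_summable[OF a]) auto
  have Du: "cmod (D K y w) \<le> u K * norm w" if y: "y \<in> ball p r" for K y w
  proof -
    have y': "norm (y - p) \<le> r" using y by (simp add: dist_norm norm_minus_commute)
    have "cmod (\<Sum>j\<in>UNIV. coord j w * monomial_der p K y j) \<le>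
        (\<Sum>j\<in>(UNIV :: ('a + 'a) set). norm w * ((2 * r) ^ mi_abs K / mi_fact K))"
      by (rule sum_norm_le)
        (simp only: norm_mult mult_mono norm_coord_le norm_monomial_der_le[OF y' r] norm_ge_zero)
    then have "cmod (D K y w) \<le> cmod (a K) * (\<Sum>j\<in>(UNIV :: ('a + 'a) set). norm w * ((2 * r) ^ mi_abs K / mi_fact K))"
      unfolding D_def norm_mult by (rule mult_left_mono) simp
    also have "\<dots> = u K * norm w"
      unfolding u_def sum_constant by (simp only: mult_ac)
    finally show ?thesis .
  qed
  have usum: "(\<lambda>n. \<Sum>i<n. u (\<pi> i)) \<longlonglongrightarrow> infsum u UNIV"
  proof -
    have "((\<lambda>n. u (\<pi> n)) has_sum infsum u UNIV) UNIV"
      using has_sum_reindex_bij_betw[OF \<pi>, of u] has_sum_infsum[OF u] by simp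
    then show ?thesis using has_sum_imp_sums sums_def by blast
  qed
  have "\<exists>g. \<forall>y\<in>ball p r. (\<lambda>n. a (\<pi> n) * monomial_fn p (\<pi> n) y) sums g y \<and>
      (g has_derivative (\<lambda>w. \<Sum>\<^sub>\<infinity>K. D K y w)) (at y within ball p r)"
  proof (rule has_derivative_series[where x = x])
    show "convex (ball p r)" by (rule convex_ball)
    show "x \<in> ball p r" by (simp add: r_def dist_norm norm_minus_commute)
    show "((\<lambda>y. a (\<pi> n) * monomial_fn p (\<pi> n) y) has_derivative D (\<pi> n) y) (at y within ball p r)" for n y
      unfolding D_def
      by (rule has_derivative_at_withinI[OF has_derivative_mult_right[OF monomial_fn_has_derivative]])
    show "(\<lambda>n. a (\<pi> n) * monomial_fn p (\<pi> n) x) sums (\<Sum>\<^sub>\<infinity>K. a K * monomial_fn p K x)"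
      by (rule has_sum_imp_sums)
        (use has_sum_reindex_bij_betw[OF \<pi>, of "\<lambda>K. a K * monomial_fn p K x"]
          has_sum_infsum[OF taylor_fn_summable[OF a]] in simp)
    fix e :: real assume "0 < e"
    then have "\<forall>\<^sub>F n in sequentially. dist (\<Sum>i<n. u (\<pi> i)) (infsum u UNIV) < e"
      using usum tendstoD by blast
    then show "\<forall>\<^sub>F n in sequentially. \<forall>y\<in>ball p r. \<forall>w.
        norm ((\<Sum>i<n. D (\<pi> i) y w) - (\<Sum>\<^sub>\<infinity>K. D K y w)) \<le> e * norm w"
    proof (rule eventually_mono, intro ballI allI)
      fix n y w
      assume n: "dist (\<Sum>i<n. u (\<pi> i)) (infsum u UNIV) < e" and y: "y \<in> ball p r"
      have inj: "inj_on \<pi> {..<n}" using \<pi> by (auto simp: bij_betw_def inj_on_def)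
      have "norm ((\<Sum>K\<in>\<pi> ` {..<n}. D K y w) - (\<Sum>\<^sub>\<infinity>K. D K y w)) \<le>
          (\<Sum>\<^sub>\<infinity>K. u K * norm w) - (\<Sum>K\<in>\<pi> ` {..<n}. u K * norm w)"
        by (rule infsum_tail_le) (use Du[OF y] in \<open>auto intro!: summable_on_cmult_left u\<close>)
      also have "\<dots> = (infsum u UNIV - (\<Sum>i<n. u (\<pi> i))) * norm w"
        by (simp add: infsum_cmult_left' sum.reindex[OF inj] left_diff_distrib flip: sum_distrib_right)
      also have "\<dots> \<le> e * norm w"
        using n by (intro mult_right_mono) (auto simp: dist_real_def)
      finally show "norm ((\<Sum>i<n. D (\<pi> i) y w) - (\<Sum>\<^sub>\<infinity>K. D K y w)) \<le> e * norm w"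
        by (simp add: sum.reindex[OF inj])
    qed
  qed
  then obtain g where g: "\<And>y. y \<in> ball p r \<Longrightarrow> (\<lambda>n. a (\<pi> n) * monomial_fn p (\<pi> n) y) sums g y"
    "\<And>y. y \<in> ball p r \<Longrightarrow> (g has_derivative (\<lambda>w. \<Sum>\<^sub>\<infinity>K. D K y w)) (at y within ball p r)"
    by blast
  have x: "x \<in> ball p r" by (simp add: r_def dist_norm norm_minus_commute)
  have eq: "g y = taylor_fn p a y" if "y \<in> ball p r" for y
  proof -
    have "(\<lambda>n. a (\<pi> n) * monomial_fn p (\<pi> n) y) sums taylor_fn p a y"
      unfolding taylor_fn_def
      by (rule has_sum_imp_sums)
        (use has_sum_reindex_bij_betw[OF \<pi>, of "\<lambda>K. a K * monomial_fn p K y"]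
          has_sum_infsum[OF taylor_fn_summable[OF a]] in simp)
    with g(1)[OF that] show ?thesis by (rule sums_unique2)
  qed
  have "(g has_derivative (\<lambda>w. \<Sum>\<^sub>\<infinity>K. D K x w)) (at x)"
    using g(2)[OF x] at_within_open[OF x open_ball] by simp
  then have "(taylor_fn p a has_derivative (\<lambda>w. \<Sum>\<^sub>\<infinity>K. D K x w)) (at x)"
    by (rule has_derivative_transform_within_open[OF _ open_ball x eq])
  then show ?thesis unfolding D_def taylor_fn_derivative_term[OF a] .
qed

lemma taylor_fn_lincomb:
  assumes "\<And>j. b j \<in> subfactorial"
  shows "(\<Sum>j\<in>UNIV. c j * taylor_fn p (b j) x) = taylor_fn p (\<lambda>K. \<Sum>j\<in>(UNIV :: 'j::finite set). c j * b j K) x"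
proof -
  have "(\<Sum>j\<in>UNIV. c j * taylor_fn p (b j) x) = (\<Sum>j\<in>UNIV. \<Sum>\<^sub>\<infinity>K. c j * (b j K * monomial_fn p K x))"
    by (simp add: taylor_fn_def infsum_cmult_right')
  also have "\<dots> = (\<Sum>\<^sub>\<infinity>K. \<Sum>j\<in>UNIV. c j * (b j K * monomial_fn p K x))"
    by (rule infsum_finite_sum[OF finite, symmetric]) (intro summable_on_cmult_right taylor_fn_summable assms)
  finally show ?thesis by (simp add: taylor_fn_def sum_distrib_right mult.assoc)
qed

lemma subfactorial_sum:
  "finite A \<Longrightarrow> (\<And>i. i \<in> A \<Longrightarrow> t i \<in> subfactorial) \<Longrightarrow> (\<lambda>K. \<Sum>i\<in>A. t i K) \<in> subfactorial"
  by (induction A rule: finite_induct) (simp_all add: subfactorial_0 subfactorial_add)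

lemma dir_deriv_taylor_fn:
  assumes "a \<in> subfactorial"
  shows "dir_deriv v (taylor_fn p a) x = (\<Sum>j\<in>UNIV. coord j v * taylor_fn p (shift (axis j 1) a) x)"
  by (rule dir_deriv_eq[OF taylor_fn_has_derivative[OF assms]])

text \<open>The Taylor functions of all subfactorial arrays form a set stable under directional
  derivatives, since these act on the array by linear combinations of shifts.\<close>

lemma smooth_taylor_fn:
  assumes "a \<in> subfactorial"
  shows "smooth (taylor_fn p a)"
proof (rule smooth_coinduct[where C = "taylor_fn p ` subfactorial"])
  fix f x assume "f \<in> taylor_fn p ` subfactorial"
  then show "f differentiable (at x)"
    using taylor_fn_has_derivative differentiableI by blast
next
  fix f v assume "f \<in> taylor_fn p ` subfactorial"
  then obtain b where b: "b \<in> subfactorial" "f = taylor_fn p b" by blast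
  let ?d = "\<lambda>K. \<Sum>j\<in>UNIV. coord j v * shift (axis j 1) b K"
  have "dir_deriv v f = taylor_fn p ?d"
    unfolding b(2)
    by (rule ext) (simp only: dir_deriv_taylor_fn[OF b(1)] taylor_fn_lincomb subfactorial_shift[OF b(1)])
  moreover have "?d \<in> subfactorial"
    by (intro subfactorial_sum subfactorial_scale subfactorial_shift b) simp
  ultimately show "dir_deriv v f \<in> taylor_fn p ` subfactorial" by blast
qed (use assms in blast)

text \<open>The two coordinates are 1, 1 in the direction \<open>axis i 1\<close> and
  \<open>\<i>\<close>, \<open>- \<i>\<close> in the direction \<open>axis i \<i>\<close>, so each
  Wirtinger combination singles out one summand.\<close>

lemma der_taylor_fn:
  assumes "a \<in> subfactorial"
  shows "der j (taylor_fn p a) = taylor_fn p (shift (axis j 1) a)"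
proof (rule ext)
  fix x
  let ?t = "\<lambda>j. taylor_fn p (shift (axis j 1) a) x"
  have 1: "dir_deriv (axis i 1) (taylor_fn p a) x = ?t (Inl i) + ?t (Inr i)" for i
    unfolding dir_deriv_taylor_fn[OF assms] sum_sum_type
    by (simp add: axis_def if_distrib if_distribR cong: if_cong)
  have 2: "dir_deriv (axis i \<i>) (taylor_fn p a) x = \<i> * ?t (Inl i) - \<i> * ?t (Inr i)" for i
    unfolding dir_deriv_taylor_fn[OF assms] sum_sum_type
    by (simp add: axis_def if_distrib if_distribR cong: if_cong)
  show "der j (taylor_fn p a) x = ?t j"
    by (cases j) (simp_all add: dz_def dzbar_def 1 2 algebra_simps)
qed

lemma taylor_fn_at:
  "taylor_fn p a p = a 0"
proof -
  have "monomial_fn p K p = (if K = 0 then 1 else 0)" for K :: "nat ^ ('a + 'a)"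
  proof (cases "K = 0")
    case False
    then obtain j where "K $ j \<noteq> 0" by (auto simp: vec_eq_iff)
    moreover have "coord j (p - p) = 0" for j :: "'a + 'a" by (cases j) auto
    ultimately have "\<exists>j. coord j (p - p) ^ (K $ j) / fact (K $ j) = 0" by auto
    with False show ?thesis unfolding monomial_fn_def by (simp add: prod_zero_iff)
  qed (simp add: monomial_fn_def)
  then have "taylor_fn p a p = (\<Sum>\<^sub>\<infinity>K\<in>{0}. a K)"
    unfolding taylor_fn_def by (intro infsum_cong_neutral) auto
  then show ?thesis by simp
qed

lemma jet_taylor_fn: "a \<in> subfactorial \<Longrightarrow> jet p (taylor_fn p a) = a"
proof (rule ext)
  fix K assume "a \<in> subfactorial"
  then show "jet p (taylor_fn p a) K = a K"
  proof (induction K arbitrary: a rule: multiindex_induct)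
    case zero
    then show ?case by (simp add: taylor_fn_at)
  next
    case (step K j)
    then show ?case
      by (simp only: jet_axis smooth_taylor_fn der_taylor_fn subfactorial_shift) (simp add: shift_def)
  qed
qed

section \<open>Comparison of the seminorms\<close>

lemma ennreal_summable: "(g :: 'i \<Rightarrow> ennreal) summable_on A"
  by (rule nonneg_summable_on_complete) simp

lemma ennreal_finite_sum_le_infsum:
  fixes g :: "'i \<Rightarrow> ennreal"
  assumes "finite F" shows "sum g F \<le> infsum g UNIV"
  by (subst nonneg_infsum_complete) (use assms in \<open>auto intro!: SUP_upper\<close>)

lemma ennreal_le_infsum: "g x \<le> (\<Sum>\<^sub>\<infinity>x. g x :: ennreal)"
  using ennreal_finite_sum_le_infsum[of "{x}" g] by simp

lemma ennreal_infsum_leI: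
  "(\<And>F. finite F \<Longrightarrow> sum g F \<le> b) \<Longrightarrow> (\<Sum>\<^sub>\<infinity>x. g x :: ennreal) \<le> b"
  by (rule infsum_le_finite_sums[OF ennreal_summable]) auto

lemma ennreal_infsum_mono: "(\<And>x. g x \<le> k x) \<Longrightarrow> (\<Sum>\<^sub>\<infinity>x. g x :: ennreal) \<le> (\<Sum>\<^sub>\<infinity>x. k x)"
  by (rule infsum_mono[OF ennreal_summable ennreal_summable])

lemma ennreal_infsum_cmult_le: "(\<Sum>\<^sub>\<infinity>x. c * g x :: ennreal) \<le> c * (\<Sum>\<^sub>\<infinity>x. g x)"
  by (rule ennreal_infsum_leI)
    (auto simp flip: sum_distrib_left intro!: mult_left_mono ennreal_finite_sum_le_infsum)

lemma ennreal_infsum_le_real: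
  fixes u :: "'i \<Rightarrow> real"
  assumes "\<And>N. g N \<le> ennreal (u N)" "\<And>N. 0 \<le> u N" "u summable_on UNIV"
  shows "(\<Sum>\<^sub>\<infinity>N. g N) \<le> ennreal (infsum u UNIV)"
proof (rule ennreal_infsum_leI)
  fix F :: "'i set" assume F: "finite F"
  have "sum g F \<le> (\<Sum>N\<in>F. ennreal (u N))" by (rule sum_mono) (rule assms(1))
  also have "\<dots> = ennreal (sum u F)" using assms(2) by simp
  also have "\<dots> \<le> ennreal (infsum u UNIV)"
    by (intro ennreal_leI finite_sum_le_infsum) (use F assms in auto)
  finally show "sum g F \<le> ennreal (infsum u UNIV)" .
qed

text \<open>Merges both parities of the digit, so that the estimates below treat one recursion
  instead of two.\<close>

definition h_sub :: "real \<Rightarrow> complex ^ 'n \<Rightarrow> nat \<Rightarrow> nat \<Rightarrow> nat ^ 'n \<Rightarrow> nat ^ 'n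
    \<Rightarrow> (complex ^ 'n \<Rightarrow> complex) \<Rightarrow> ennreal" where
  "h_sub hb p m l I J f = (if even l then h hb p m (l div 2) I J f else h hb p m ((l - 1) div 2) J I f)"

definition h_inner :: "real \<Rightarrow> complex ^ 'n \<Rightarrow> nat \<Rightarrow> nat \<Rightarrow> nat ^ 'n \<Rightarrow> nat ^ 'n
    \<Rightarrow> (complex ^ 'n \<Rightarrow> complex) \<Rightarrow> ennreal" where
  "h_inner hb p m l R S f =
    (\<Sum>I\<le>R. \<Sum>J\<le>S. of_nat (mi_binom R I * mi_binom S J) * h_sub hb p m l I J f)"

lemma h_Suc: "h hb p (Suc m) l R S f =
    (\<Sum>\<^sub>\<infinity>N. ennreal (1 / mi_fact N) *
      (h_inner hb p m l R (N + S) f)\<^sup>2)"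
  by (simp add: h_inner_def h_sub_def)

declare h.simps(2) [simp del]

lemma mi_fact_mono: "I \<le> K \<Longrightarrow> mi_fact I \<le> mi_fact K"
  using mi_fact_mult_le[of I K] mult_left_mono[OF mi_fact_ge1[of "K - I"], of "mi_fact I"] by simp

text \<open>One level of the recursion in a single inequality: \<open>1 / mi_fact N\<close> absorbs
  all growth in \<open>N\<close>, and the geometric factors in \<open>R\<close> and \<open>S\<close>
  are paid by raising the exponent of their factorials from \<open>\<kappa>\<close> to
  \<open>\<delta>\<close>.\<close>

lemma absorb_bound:
  assumes "1 \<le> x" "0 < \<delta>"
  obtains \<kappa> and u :: "nat ^ 'n \<Rightarrow> real" where "0 < \<kappa>" "\<And>N. 0 \<le> u N" "u summable_on UNIV"
    "\<And>(R :: nat ^ 'n) S N. x ^ (mi_abs R + mi_abs S + mi_abs N) / mi_fact N * (mi_fact R * mi_fact (N + S)) powr \<kappa>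
      \<le> u N * (mi_fact R * mi_fact S) powr \<delta>"
proof -
  \<comment> \<open>Half of \<open>\<delta>\<close> is reserved for the geometric growth in
    \<open>R\<close> and \<open>S\<close>; the cap \<open>1/2\<close> leaves
    \<open>mi_fact N powr - (1/2)\<close> for the sum over \<open>N\<close>.\<close>
  define \<kappa> where "\<kappa> = min (\<delta> / 2) (1/2)"
  have \<kappa>: "0 < \<kappa>" "\<kappa> \<le> 1/2" "\<kappa> + \<delta> / 2 \<le> \<delta>" using assms(2) by (auto simp: \<kappa>_def)
  \<comment> \<open>The base \<open>2 * x\<close> includes the powers of 2 from splitting the
    factorial of \<open>N + S\<close>.\<close>
  obtain C where C: "1 \<le> C" "\<And>K :: nat ^ 'n. (2 * x) ^ mi_abs K \<le> C * mi_fact K powr (\<delta> / 2)"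
    by (rule power_le_fact_powr[of "2 * x" "\<delta> / 2"]) (use assms in auto)
  define u :: "nat ^ 'n \<Rightarrow> real" where
    "u = (\<lambda>N. C * C * ((2 * x) ^ mi_abs N * mi_fact N powr - (1/2)))"
  show ?thesis
  proof (rule that[of \<kappa> u])
    show "0 < \<kappa>" by (rule \<kappa>)
    show "0 \<le> u N" for N using C assms by (simp add: u_def)
    show "u summable_on UNIV"
      unfolding u_def by (intro summable_on_cmult_right summable_power_fact) (use assms in auto)
    fix R S N :: "nat ^ 'n"
    have "(mi_fact R * mi_fact (N + S)) powr \<kappa> \<le> (mi_fact R * (2 ^ mi_abs N * 2 ^ mi_abs S * (mi_fact N * mi_fact S))) powr \<kappa>"
      using \<kappa>(1) by (intro powr_mono2 mult_left_mono mi_fact_add_le) auto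
    also have "\<dots> = (2 ^ mi_abs N * 2 ^ mi_abs S) powr \<kappa> * (mi_fact N powr \<kappa> * (mi_fact R * mi_fact S) powr \<kappa>)"
      by (simp add: powr_mult mult_ac)
    also have "(2 ^ mi_abs N * 2 ^ mi_abs S) powr \<kappa> \<le> (2 ^ mi_abs N * 2 ^ mi_abs S :: real) powr 1"
    proof (rule powr_mono)
      have "1 * 1 \<le> (2 ^ mi_abs N * 2 ^ mi_abs S :: real)" by (intro mult_mono one_le_power) auto
      then show "1 \<le> (2 ^ mi_abs N * 2 ^ mi_abs S :: real)" by simp
    qed (use \<kappa> in auto)
    also have "\<dots> = 2 ^ mi_abs N * 2 ^ mi_abs S" by simp
    finally have 1: "(mi_fact R * mi_fact (N + S)) powr \<kappa> \<le>
        2 ^ mi_abs N * 2 ^ mi_abs S * (mi_fact N powr \<kappa> * (mi_fact R * mi_fact S) powr \<kappa>)"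
      by (simp add: mult_right_mono)
    have "x ^ (mi_abs R + mi_abs S + mi_abs N) / mi_fact N * (mi_fact R * mi_fact (N + S)) powr \<kappa>
        \<le> x ^ (mi_abs R + mi_abs S + mi_abs N) / mi_fact N *
          (2 ^ mi_abs N * 2 ^ mi_abs S * (mi_fact N powr \<kappa> * (mi_fact R * mi_fact S) powr \<kappa>))"
      using assms by (intro mult_left_mono[OF 1]) auto
    also have "\<dots> = (x ^ mi_abs R * (2 * x) ^ mi_abs S) * ((2 * x) ^ mi_abs N * (mi_fact N powr \<kappa> / mi_fact N)) * (mi_fact R * mi_fact S) powr \<kappa>"
      by (simp add: power_add power_mult_distrib mult_ac)
    also have "\<dots> \<le> ((C * mi_fact R powr (\<delta> / 2)) * (C * mi_fact S powr (\<delta> / 2))) *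
        ((2 * x) ^ mi_abs N * mi_fact N powr - (1/2)) * (mi_fact R * mi_fact S) powr \<kappa>"
    proof (intro mult_mono)
      show "x ^ mi_abs R \<le> C * mi_fact R powr (\<delta> / 2)"
        using C(2)[of R] power_mono[of x "2 * x" "mi_abs R"] assms by linarith
      show "(2 * x) ^ mi_abs S \<le> C * mi_fact S powr (\<delta> / 2)" by (rule C)
      have "mi_fact N powr \<kappa> / mi_fact N = mi_fact N powr (\<kappa> - 1)"
        using mi_fact_pos[of N] by (simp add: powr_diff)
      also have "\<dots> \<le> mi_fact N powr - (1/2)"
        using \<kappa> mi_fact_ge1[of N] by (intro powr_mono) auto
      finally show "mi_fact N powr \<kappa> / mi_fact N \<le> mi_fact N powr - (1/2)" .
    qed (use assms C in auto)
    also have "\<dots> = u N * (mi_fact R * mi_fact S) powr (\<kappa> + \<delta> / 2)"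
      by (simp add: u_def powr_add powr_mult mult_ac)
    also have "\<dots> \<le> u N * (mi_fact R * mi_fact S) powr \<delta>"
    proof (intro mult_left_mono powr_mono \<kappa>)
      show "1 \<le> mi_fact R * mi_fact S"
        using mult_mono[OF mi_fact_ge1[of R] mi_fact_ge1[of S]] by simp
      show "0 \<le> u N" using C assms by (simp add: u_def)
    qed
    finally show "x ^ (mi_abs R + mi_abs S + mi_abs N) / mi_fact N * (mi_fact R * mi_fact (N + S)) powr \<kappa>
      \<le> u N * (mi_fact R * mi_fact S) powr \<delta>" .
  qed
qed

text \<open>The induction generalises \<open>\<delta>\<close>: level \<open>m + 1\<close> with
  exponent \<open>\<delta>\<close> needs level \<open>m\<close> with the smaller exponent
  \<open>\<kappa> / 2\<close>. The power of \<open>q\<close> is the degree of homogeneity, which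
  doubles with each square.\<close>

lemma h_upper_bound:
  assumes "0 < hb" "0 < \<delta>"
  shows "\<exists>\<epsilon> C. 0 < \<epsilon> \<and> 0 \<le> C \<and> (\<forall>(f :: complex ^ 'n \<Rightarrow> complex) p q l R S. fact_bounded \<epsilon> q (jet p f) \<longrightarrow>
    h hb p m l R S f \<le> ennreal (C * q ^ (2 ^ (m + 1)) * (mi_fact R * mi_fact S) powr \<delta>))"
  using assms(2)
proof (induction m arbitrary: \<delta>)
  case 0
  \<comment> \<open>\<open>absorb_bound\<close> asks for a base of at least 1, while
    \<open>2 * hb\<close> may be smaller.\<close>
  define x where "x = max 1 (2 * hb)"
  obtain \<kappa> and u :: "nat ^ 'n \<Rightarrow> real" where u: "0 < \<kappa>" "\<And>N. 0 \<le> u N" "u summable_on UNIV"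
    "\<And>(R :: nat ^ 'n) S N. x ^ (mi_abs R + mi_abs S + mi_abs N) / mi_fact N * (mi_fact R * mi_fact (N + S)) powr \<kappa>
      \<le> u N * (mi_fact R * mi_fact S) powr \<delta>"
    by (rule absorb_bound[of x \<delta>, where 'n = 'n]) (use 0 in \<open>auto simp: x_def\<close>)
  show ?case
  proof (intro exI conjI allI impI)
    \<comment> \<open>Halved, since the modulus of the derivative is squared.\<close>
    show "0 < \<kappa> / 2" using u(1) by simp
    show "0 \<le> infsum u UNIV" using u(2) by (intro infsum_nonneg) auto
    fix f :: "complex ^ 'n \<Rightarrow> complex" and p q l and R S :: "nat ^ 'n"
    assume f: "fact_bounded (\<kappa> / 2) q (jet p f)"
    let ?w = "(mi_fact R * mi_fact S) powr \<delta>"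
    have "h hb p 0 l R S f \<le> ennreal (\<Sum>\<^sub>\<infinity>N. q\<^sup>2 * ?w * u N)"
      unfolding h.simps
    proof (rule ennreal_infsum_le_real)
      fix N
      have "cmod (wirtinger R (N + S) f p) \<le> q * (mi_fact R * mi_fact (N + S)) powr (\<kappa> / 2)"
        using fact_boundedD[OF f, of "mi_join R (N + S)"] by (simp add: wirtinger_eq_jet)
      then have "(cmod (wirtinger R (N + S) f p))\<^sup>2 \<le> (q * (mi_fact R * mi_fact (N + S)) powr (\<kappa> / 2))\<^sup>2"
        by (rule power_mono) simp
      also have "\<dots> = q\<^sup>2 * (mi_fact R * mi_fact (N + S)) powr \<kappa>"
        by (simp add: power_mult_distrib powr_powr flip: powr_realpow powr_numeral)
      finally have 1: "(cmod (wirtinger R (N + S) f p))\<^sup>2 \<le> q\<^sup>2 * (mi_fact R * mi_fact (N + S)) powr \<kappa>" .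
      have "(2 * hb) ^ (mi_abs R + mi_abs S + mi_abs N) \<le> x ^ (mi_abs R + mi_abs S + mi_abs N)"
        using assms(1) by (intro power_mono) (auto simp: x_def)
      with 1 have "(2 * hb) ^ (mi_abs R + mi_abs S + mi_abs N) / mi_fact N * (cmod (wirtinger R (N + S) f p))\<^sup>2
          \<le> x ^ (mi_abs R + mi_abs S + mi_abs N) / mi_fact N * (q\<^sup>2 * (mi_fact R * mi_fact (N + S)) powr \<kappa>)"
        using assms(1) by (intro mult_mono divide_right_mono) (auto simp: x_def)
      also have "\<dots> = q\<^sup>2 * (x ^ (mi_abs R + mi_abs S + mi_abs N) / mi_fact N * (mi_fact R * mi_fact (N + S)) powr \<kappa>)"
        by simp
      also have "\<dots> \<le> q\<^sup>2 * (u N * ?w)" by (intro mult_left_mono u) simp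
      finally show "ennreal ((2 * hb) ^ (mi_abs R + mi_abs S + mi_abs N) / mi_fact N * (cmod (wirtinger R (N + S) f p))\<^sup>2)
          \<le> ennreal (q\<^sup>2 * ?w * u N)"
        by (intro ennreal_leI) (simp add: mult_ac)
    qed (use u in \<open>auto intro!: summable_on_cmult_right\<close>)
    also have "(\<Sum>\<^sub>\<infinity>N. q\<^sup>2 * ?w * u N) = infsum u UNIV * q ^ 2 ^ (0 + 1) * ?w"
      unfolding infsum_cmult_right' by simp
    finally show "h hb p 0 l R S f \<le> ennreal (infsum u UNIV * q ^ 2 ^ (0 + 1) * ?w)" .
  qed
next
  case (Suc m)
  \<comment> \<open>The base 4 is the square of 2: the binomial coefficients sum to a power of 2,
    and the inner sum is squared.\<close>
  obtain \<kappa> and u :: "nat ^ 'n \<Rightarrow> real" where u: "0 < \<kappa>" "\<And>N. 0 \<le> u N" "u summable_on UNIV"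
    "\<And>(R :: nat ^ 'n) S N. 4 ^ (mi_abs R + mi_abs S + mi_abs N) / mi_fact N * (mi_fact R * mi_fact (N + S)) powr \<kappa>
      \<le> u N * (mi_fact R * mi_fact S) powr \<delta>"
    by (rule absorb_bound[of 4 \<delta>, where 'n = 'n]) (use Suc in auto)
  obtain \<epsilon> C where IH: "0 < \<epsilon>" "0 \<le> C"
    "\<And>(f :: complex ^ 'n \<Rightarrow> complex) p q l R S. fact_bounded \<epsilon> q (jet p f) \<Longrightarrow>
      h hb p m l R S f \<le> ennreal (C * q ^ (2 ^ (m + 1)) * (mi_fact R * mi_fact S) powr (\<kappa> / 2))"
    using Suc.IH[of "\<kappa> / 2"] u(1) by auto
  show ?case
  proof (intro exI conjI allI impI)
    show "0 < \<epsilon>" by (rule IH)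
    show "0 \<le> C\<^sup>2 * infsum u UNIV" using u(2) by (intro mult_nonneg_nonneg infsum_nonneg) auto
    fix f :: "complex ^ 'n \<Rightarrow> complex" and p q l and R S :: "nat ^ 'n"
    assume f: "fact_bounded \<epsilon> q (jet p f)"
    then have q: "0 \<le> q" by (rule fact_bounded_nonneg)
    let ?w = "(mi_fact R * mi_fact S) powr \<delta>"
    define B where "B = C * q ^ (2 ^ (m + 1))"
    have B: "0 \<le> B" using q IH by (simp add: B_def)
    have "h hb p (Suc m) l R S f \<le> ennreal (\<Sum>\<^sub>\<infinity>N. B\<^sup>2 * ?w * u N)"
      unfolding h_Suc
    proof (rule ennreal_infsum_le_real)
      fix N
      define E where "E = B * (mi_fact R * mi_fact (N + S)) powr (\<kappa> / 2)"
      have E: "0 \<le> E" using B by (simp add: E_def)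
      have "h_sub hb p m l I J f \<le> ennreal E" if "I \<le> R" "J \<le> N + S" for I J
      proof -
        have "h_sub hb p m l I J f \<le> ennreal (B * (mi_fact I * mi_fact J) powr (\<kappa> / 2))"
          using IH(3)[OF f, of "l div 2" I J] IH(3)[OF f, of "(l - 1) div 2" J I]
          by (simp add: h_sub_def B_def mult.commute[of "mi_fact J"])
        also have "\<dots> \<le> ennreal E"
          unfolding E_def using that u(1) B
          by (intro ennreal_leI mult_left_mono powr_mono2 mult_mono mi_fact_mono) auto
        finally show ?thesis .
      qed
      then have "h_inner hb p m l R (N + S) f
          \<le> (\<Sum>I\<le>R. \<Sum>J\<le>N + S. of_nat (mi_binom R I * mi_binom (N + S) J) * ennreal E)"
        unfolding h_inner_def by (intro sum_mono mult_left_mono) auto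
      also have "\<dots> = of_nat (\<Sum>I\<le>R. \<Sum>J\<le>N + S. mi_binom R I * mi_binom (N + S) J) * ennreal E"
        by (simp add: sum_distrib_right)
      also have "(\<Sum>I\<le>R. \<Sum>J\<le>N + S. mi_binom R I * mi_binom (N + S) J) = 2 ^ (mi_abs R + mi_abs S + mi_abs N)"
        by (simp add: sum_mi_binom mi_abs_add power_add flip: sum_distrib_left sum_distrib_right)
      also have "of_nat (2 ^ (mi_abs R + mi_abs S + mi_abs N)) * ennreal E = ennreal (2 ^ (mi_abs R + mi_abs S + mi_abs N) * E)"
      proof -
        have "ennreal (2 ^ k) = 2 ^ k" for k using ennreal_power[of 2 k] by simp
        then show ?thesis by (simp add: ennreal_mult E)
      qed
      finally have "(h_inner hb p m l R (N + S) f)\<^sup>2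
          \<le> (ennreal (2 ^ (mi_abs R + mi_abs S + mi_abs N) * E))\<^sup>2"
        by (rule power_mono) simp
      also have "\<dots> = ennreal ((2 ^ (mi_abs R + mi_abs S + mi_abs N) * E)\<^sup>2)"
        using E by (simp add: ennreal_power)
      also have "(2 ^ (mi_abs R + mi_abs S + mi_abs N) * E)\<^sup>2 =
          B\<^sup>2 * (4 ^ (mi_abs R + mi_abs S + mi_abs N) * (mi_fact R * mi_fact (N + S)) powr \<kappa>)"
      proof -
        have "((mi_fact R * mi_fact (N + S)) powr (\<kappa> / 2))\<^sup>2 = (mi_fact R * mi_fact (N + S)) powr \<kappa>"
          by (simp add: powr_powr flip: powr_realpow powr_numeral)
        moreover have "((2::real) ^ k)\<^sup>2 = 4 ^ k" for k
          by (simp add: power2_eq_square flip: power_mult_distrib)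
        ultimately show ?thesis by (simp add: E_def power_mult_distrib)
      qed
      finally have "ennreal (1 / mi_fact N) *
          (h_inner hb p m l R (N + S) f)\<^sup>2
          \<le> ennreal (1 / mi_fact N) * ennreal (B\<^sup>2 * (4 ^ (mi_abs R + mi_abs S + mi_abs N) * (mi_fact R * mi_fact (N + S)) powr \<kappa>))"
        by (rule mult_left_mono) simp
      also have "\<dots> = ennreal (B\<^sup>2 * (4 ^ (mi_abs R + mi_abs S + mi_abs N) / mi_fact N * (mi_fact R * mi_fact (N + S)) powr \<kappa>))"
        by (simp flip: ennreal_mult)
      also have "\<dots> \<le> ennreal (B\<^sup>2 * (u N * ?w))"
        by (intro ennreal_leI mult_left_mono u) simp
      finally show "ennreal (1 / mi_fact N) *
          (h_inner hb p m l R (N + S) f)\<^sup>2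
          \<le> ennreal (B\<^sup>2 * ?w * u N)"
        by (simp add: mult_ac)
    qed (use u in \<open>auto intro!: summable_on_cmult_right\<close>)
    also have "(\<Sum>\<^sub>\<infinity>N. B\<^sup>2 * ?w * u N) = C\<^sup>2 * infsum u UNIV * q ^ 2 ^ (Suc m + 1) * ?w"
      unfolding infsum_cmult_right' B_def by (simp add: power_mult_distrib mult_ac flip: power_mult)
    finally show "h hb p (Suc m) l R S f \<le> ennreal (C\<^sup>2 * infsum u UNIV * q ^ 2 ^ (Suc m + 1) * ?w)" .
  qed
qed

section \<open>Bounds for the recursion from below\<close>

lemma h_0_ge: "ennreal ((2 * hb) ^ (mi_abs R + mi_abs S) * (cmod (jet p f (mi_join R S)))\<^sup>2) \<le> h hb p 0 l R S f"
  using ennreal_le_infsum[of "\<lambda>N. ennreal ((2 * hb) ^ (mi_abs R + mi_abs S + mi_abs N) / mi_fact N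
      * (cmod (wirtinger R (N + S) f p))\<^sup>2)" 0]
  by (simp add: wirtinger_eq_jet)

text \<open>Of the sum over \<open>N\<close> one term is kept, and of the inner sums the top index,
  whose binomial coefficients are 1.\<close>

lemma h_Suc_ge:
  "ennreal (1 / mi_fact N) * (h_sub hb p m l R (N + S) f)\<^sup>2 \<le> h hb p (Suc m) l R S f"
proof -
  let ?t = "\<lambda>I J. of_nat (mi_binom R I * mi_binom (N + S) J) * h_sub hb p m l I J f"
  have "h_sub hb p m l R (N + S) f = ?t R (N + S)"
    by (simp add: mi_binom_def)
  also have "\<dots> \<le> (\<Sum>J\<le>N + S. ?t R J)"
    by (rule member_le_sum) auto
  also have "\<dots> \<le> h_inner hb p m l R (N + S) f"
    unfolding h_inner_def by (rule member_le_sum[of R _ "\<lambda>I. \<Sum>J\<le>N + S. ?t I J"]) auto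
  finally have "ennreal (1 / mi_fact N) * (h_sub hb p m l R (N + S) f)\<^sup>2 \<le>
      ennreal (1 / mi_fact N) * (h_inner hb p m l R (N + S) f)\<^sup>2"
    by (intro mult_left_mono power_mono) auto
  also have "\<dots> \<le> h hb p (Suc m) l R S f"
    unfolding h_Suc
    using ennreal_le_infsum[of "\<lambda>N. ennreal (1 / mi_fact N) * (h_inner hb p m l R (N + S) f)\<^sup>2" N] .
  finally show ?thesis .
qed

text \<open>With all digits even, the term \<open>N = 0\<close> alone shows that each level at least
  squares the previous one.\<close>

lemma h_even_ge_power: "(h hb p 0 0 R S f) ^ (2 ^ m) \<le> h hb p m 0 R S f"
proof (induction m)
  case (Suc m)
  have "(h hb p 0 0 R S f) ^ (2 ^ Suc m) = ((h hb p 0 0 R S f) ^ (2 ^ m))\<^sup>2"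
    by (simp add: mult.commute flip: power_mult)
  also have "\<dots> \<le> (h hb p m 0 R S f)\<^sup>2" by (rule power_mono[OF Suc]) simp
  also have "\<dots> \<le> h hb p (Suc m) 0 R S f"
    using h_Suc_ge[of 0 hb p m 0 R S f] by (simp add: h_sub_def)
  finally show ?case .
qed simp

text \<open>The two leading digits of the index \<open>1\<close> (odd, then even) make both orders of the derivative
  appear, each at the price of a small power of a factorial.\<close>

lemma h_lower_bound:
  fixes N M :: "nat ^ 'n"
  assumes "0 < hb"
  shows "ennreal (((2 * hb) ^ (mi_abs N + mi_abs M) * (cmod (jet p f (mi_join N M)))\<^sup>2) ^ (2 ^ (m + 2)))
    \<le> ennreal (mi_fact N * (mi_fact M)\<^sup>2) * h hb p (m + 2) 1 0 0 f"
proof -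
  let ?X = "(2 * hb) ^ (mi_abs N + mi_abs M) * (cmod (jet p f (mi_join N M)))\<^sup>2"
  let ?g = "h hb p m 0 N M f"
  have X: "0 \<le> ?X" using assms by simp
  have "ennreal (?X ^ (2 ^ m)) = ennreal ?X ^ (2 ^ m)" using X by (simp add: ennreal_power)
  also have "\<dots> \<le> (h hb p 0 0 N M f) ^ (2 ^ m)" by (intro power_mono h_0_ge) simp
  also have "\<dots> \<le> ?g" by (rule h_even_ge_power)
  finally have g: "ennreal (?X ^ (2 ^ m)) \<le> ?g" .
  \<comment> \<open>The even digit: the summation index \<open>M\<close> supplies the z-bar
    derivatives.\<close>
  have "ennreal (1 / mi_fact M) * ?g\<^sup>2 \<le> h hb p (Suc m) 0 N 0 f"
    using h_Suc_ge[of M hb p m 0 N 0 f] by (simp add: h_sub_def)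
  \<comment> \<open>The odd digit: after the swap the summation index \<open>N\<close> supplies the
    z derivatives. The factor \<open>1 / mi_fact M\<close> of the previous level is squared here,
    hence \<open>(mi_fact M)\<^sup>2\<close> in the statement.\<close>
  then have "ennreal (1 / mi_fact N) * (ennreal (1 / mi_fact M) * ?g\<^sup>2)\<^sup>2 \<le>
      ennreal (1 / mi_fact N) * (h hb p (Suc m) 0 N 0 f)\<^sup>2"
    by (intro mult_left_mono power_mono) auto
  also have "\<dots> \<le> h hb p (m + 2) 1 0 0 f"
    using h_Suc_ge[of N hb p "Suc m" 1 0 0 f] by (simp add: h_sub_def)
  finally have 1: "ennreal (1 / mi_fact N) * (ennreal (1 / mi_fact M) * ?g\<^sup>2)\<^sup>2 \<le> h hb p (m + 2) 1 0 0 f" .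
  have "ennreal (?X ^ (2 ^ (m + 2))) = ((ennreal (?X ^ (2 ^ m)))\<^sup>2)\<^sup>2"
    using X by (simp add: ennreal_power mult.commute flip: power_mult)
  also have "\<dots> \<le> (?g\<^sup>2)\<^sup>2" by (intro power_mono g) auto
  also have "\<dots> = ennreal (mi_fact N * (mi_fact M)\<^sup>2) * (ennreal (1 / mi_fact N) * (ennreal (1 / mi_fact M) * ?g\<^sup>2)\<^sup>2)"
  proof -
    have "ennreal (mi_fact N * (mi_fact M)\<^sup>2) * (ennreal (1 / mi_fact N) * (ennreal (1 / mi_fact M))\<^sup>2) = 1"
      using mi_fact_pos[of N] mi_fact_pos[of M]
      by (simp add: ennreal_power ennreal_mult[symmetric] power_divide)
    then show ?thesis by (simp add: power_mult_distrib mult.assoc[symmetric])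
  qed
  also have "\<dots> \<le> ennreal (mi_fact N * (mi_fact M)\<^sup>2) * h hb p (m + 2) 1 0 0 f"
    by (rule mult_left_mono[OF 1]) simp
  finally show ?thesis .
qed

text \<open>The root of order \<open>2 ^ (m + 3)\<close> turns the factorials in
  \<open>h_lower_bound\<close> into an arbitrarily small power, since \<open>m\<close> may be chosen
  large.\<close>

lemma jet_bound_A_norm:
  assumes "0 < hb" "0 < \<epsilon>"
  obtains m C where "0 \<le> C"
    "\<And>(f :: complex ^ 'n \<Rightarrow> complex) p. h hb p (m + 2) 1 0 0 f < \<infinity> \<Longrightarrow>
      fact_bounded \<epsilon> (C * A_norm hb p (m + 2) 1 0 0 f) (jet p f)"
proof -
  \<comment> \<open>\<open>Y\<close> compensates the powers of \<open>2 * hb\<close>, which may be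
    small; its own geometric growth costs one half of \<open>\<epsilon>\<close>.\<close>
  define Y where "Y = max 1 (1 / sqrt (2 * hb))"
  have Y: "1 \<le> Y" "1 \<le> Y\<^sup>2 * (2 * hb)"
  proof -
    have "(1 / sqrt (2 * hb))\<^sup>2 \<le> Y\<^sup>2"
      by (intro power_mono) (use assms(1) in \<open>auto simp: Y_def\<close>)
    then show "1 \<le> Y\<^sup>2 * (2 * hb)"
      using assms(1) by (simp add: power_divide divide_simps)
  qed (simp add: Y_def)
  obtain C where C: "1 \<le> C" "\<And>K :: nat ^ ('n + 'n). Y ^ mi_abs K \<le> C * mi_fact K powr (\<epsilon> / 2)"
    by (rule power_le_fact_powr[of Y "\<epsilon> / 2"]) (use assms Y in auto)
  \<comment> \<open>The root leaves the exponent \<open>e = 1 / 2 ^ (m + 2)\<close> of the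
    factorial, which has to fit into the other half of \<open>\<epsilon>\<close>.\<close>
  obtain m where m: "(1/2 :: real) ^ m < \<epsilon> / 2"
    using real_arch_pow_inv[of "\<epsilon> / 2" "1/2"] assms by auto
  define n where "n = (2::nat) ^ (m + 2)"
  define e where "e = 1 / real n"
  have n: "0 < n" by (simp add: n_def)
  have e: "e \<le> \<epsilon> / 2"
  proof -
    have "e = (1/2) ^ m * (1/4)" by (simp add: e_def n_def power_one_over power_add)
    also have "\<dots> \<le> (1/2) ^ m" by simp
    finally show ?thesis using m by simp
  qed
  have pow: "2 ^ (m + 2 + 1) = 2 * n" by (simp add: n_def)
  show ?thesis
  proof (rule that[of C m])
    show "0 \<le> C" using C by simp
    fix f :: "complex ^ 'n \<Rightarrow> complex" and p
    assume fin: "h hb p (m + 2) 1 0 0 f < \<infinity>"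
    define H where "H = enn2real (h hb p (m + 2) 1 0 0 f)"
    define q where "q = A_norm hb p (m + 2) 1 0 0 f"
    have H: "h hb p (m + 2) 1 0 0 f = ennreal H" "0 \<le> H"
      using fin by (auto simp: H_def)
    have q: "0 \<le> q" "q ^ (2 * n) = H"
      unfolding q_def A_norm_def H_def[symmetric] pow using H(2) n by (auto intro: real_root_pow_pos2)
    show "fact_bounded \<epsilon> (C * q) (jet p f)"
      unfolding fact_bounded_def
    proof
      fix K :: "nat ^ ('n + 'n)"
      obtain N M where K: "K = mi_join N M" by (rule mi_join_cases)
      let ?a = "cmod (jet p f K)"
      have "ennreal (((2 * hb) ^ mi_abs K * ?a\<^sup>2) ^ n) \<le> ennreal (mi_fact N * (mi_fact M)\<^sup>2 * H)"
        using h_lower_bound[OF assms(1), of N M p f m] H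
        by (simp add: K n_def ennreal_mult)
      then have 1: "((2 * hb) ^ mi_abs K * ?a\<^sup>2) ^ n \<le> mi_fact N * (mi_fact M)\<^sup>2 * H"
        using H(2) by (subst (asm) ennreal_le_iff) auto
      \<comment> \<open>The factorial of \<open>N\<close> is squared as well, so that the bound
        becomes a power of \<open>mi_fact K\<close>.\<close>
      have "mi_fact N * (mi_fact M)\<^sup>2 \<le> mi_fact N * (mi_fact M)\<^sup>2 * mi_fact N"
        using mult_left_mono[OF mi_fact_ge1[of N], of "mi_fact N * (mi_fact M)\<^sup>2"] by simp
      then have "mi_fact N * (mi_fact M)\<^sup>2 \<le> (mi_fact K)\<^sup>2"
        by (simp add: K power2_eq_square mult_ac)
      then have 2: "((2 * hb) ^ mi_abs K * ?a\<^sup>2) ^ n \<le> (mi_fact K)\<^sup>2 * H"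
        using 1 H(2) mult_right_mono order.trans by blast
      have "?a\<^sup>2 \<le> (Y\<^sup>2 * (2 * hb)) ^ mi_abs K * ?a\<^sup>2"
        using mult_right_mono[OF one_le_power[OF Y(2)], of "?a\<^sup>2"] by simp
      also have "\<dots> = (Y\<^sup>2) ^ mi_abs K * ((2 * hb) ^ mi_abs K * ?a\<^sup>2)"
        unfolding power_mult_distrib[of "Y\<^sup>2"] by simp
      finally have "(?a\<^sup>2) ^ n \<le> ((Y\<^sup>2) ^ mi_abs K * ((2 * hb) ^ mi_abs K * ?a\<^sup>2)) ^ n"
        by (rule power_mono) simp
      also have "\<dots> = ((Y\<^sup>2) ^ mi_abs K) ^ n * ((2 * hb) ^ mi_abs K * ?a\<^sup>2) ^ n"
        by (rule power_mult_distrib)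
      also have "\<dots> \<le> ((Y\<^sup>2) ^ mi_abs K) ^ n * ((mi_fact K)\<^sup>2 * H)"
        by (rule mult_left_mono[OF 2]) simp
      also have "\<dots> = (Y ^ mi_abs K * (mi_fact K powr e * q)) ^ (2 * n)"
      proof -
        have "(mi_fact K powr e) ^ (2 * n) = (mi_fact K)\<^sup>2"
          using mi_fact_pos[of K] n
          by (simp add: powr_powr e_def flip: powr_realpow powr_numeral)
        moreover have "((Y\<^sup>2) ^ mi_abs K) ^ n = (Y ^ mi_abs K) ^ (2 * n)"
          by (simp add: mult_ac flip: power_mult)
        ultimately show ?thesis using q by (simp add: power_mult_distrib)
      qed
      finally have "?a ^ (2 * n) \<le> (Y ^ mi_abs K * (mi_fact K powr e * q)) ^ (2 * n)"
        by (simp add: power_mult)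
      then have "?a \<le> Y ^ mi_abs K * (mi_fact K powr e * q)"
        using power_mono_iff[of ?a "Y ^ mi_abs K * (mi_fact K powr e * q)" "2 * n"] n Y q by simp
      also have "\<dots> \<le> (C * mi_fact K powr (\<epsilon> / 2)) * (mi_fact K powr (\<epsilon> / 2) * q)"
        using C q e mi_fact_ge1[of K] Y by (intro mult_mono powr_mono) auto
      also have "\<dots> = C * q * mi_fact K powr \<epsilon>"
        using powr_add[of "mi_fact K" "\<epsilon> / 2" "\<epsilon> / 2"] by simp
      finally show "?a \<le> C * q * mi_fact K powr \<epsilon>" .
    qed
  qed
qed

section \<open>Convexity and homogeneity of \<open>h\<close>\<close>

lemma ennreal_power2_convex:
  assumes "0 < t" "0 < s" "t + s = 1"
  shows "(ennreal t * x + ennreal s * y)\<^sup>2 \<le> ennreal t * x\<^sup>2 + ennreal s * y\<^sup>2"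
proof (cases "x = \<infinity> \<or> y = \<infinity>")
  case True
  then show ?thesis
    using assms by (auto simp: ennreal_mult_top ennreal_top_mult power2_eq_square)
next
  case False
  then obtain a b where ab: "x = ennreal a" "0 \<le> a" "y = ennreal b" "0 \<le> b"
    by (cases x rule: ennreal_cases; cases y rule: ennreal_cases) auto
  have s: "s = 1 - t" using assms by simp
  have "t * a\<^sup>2 + s * b\<^sup>2 - (t * a + s * b)\<^sup>2 = t * s * (a - b)\<^sup>2"
    unfolding s by (simp add: power2_eq_square algebra_simps)
  also have "\<dots> \<ge> 0" using assms by simp
  finally have "(t * a + s * b)\<^sup>2 \<le> t * a\<^sup>2 + s * b\<^sup>2" by simp
  then show ?thesis
    using ab assms by (simp add: ennreal_power ennreal_plus[symmetric] ennreal_mult[symmetric] ennreal_leI del: ennreal_plus)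
qed

lemma real_power2_convex:
  assumes "0 \<le> t" "0 \<le> s" "t + s = 1"
  shows "(cmod (of_real t * a + of_real s * b))\<^sup>2 \<le> t * (cmod a)\<^sup>2 + s * (cmod b)\<^sup>2"
proof -
  have s: "s = 1 - t" using assms by simp
  have "cmod (of_real t * a + of_real s * b) \<le> t * cmod a + s * cmod b"
    using norm_triangle_ineq[of "of_real t * a" "of_real s * b"] assms by (simp add: norm_mult)
  then have "(cmod (of_real t * a + of_real s * b))\<^sup>2 \<le> (t * cmod a + s * cmod b)\<^sup>2"
    by (rule power_mono) simp
  also have "t * (cmod a)\<^sup>2 + s * (cmod b)\<^sup>2 - (t * cmod a + s * cmod b)\<^sup>2 = t * s * (cmod a - cmod b)\<^sup>2"
    unfolding s by (simp add: power2_eq_square algebra_simps)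
  then have "(t * cmod a + s * cmod b)\<^sup>2 \<le> t * (cmod a)\<^sup>2 + s * (cmod b)\<^sup>2"
    using assms by (metis diff_ge_0_iff_ge mult_nonneg_nonneg zero_le_power2)
  finally show ?thesis .
qed

lemma ennreal_lincomb:
  "0 \<le> t \<Longrightarrow> 0 \<le> s \<Longrightarrow> 0 \<le> x \<Longrightarrow> 0 \<le> y \<Longrightarrow>
    ennreal (t * x + s * y) = ennreal t * ennreal x + ennreal s * ennreal y"
  by (simp add: ennreal_mult)

text \<open>Sums with nonnegative coefficients preserve convexity, and so does squaring, which is
  monotone and convex on nonnegative values. The induction uses these two facts at every
  level.\<close>

lemma h_convex:
  assumes "smooth f" "smooth g" "0 < hb" "0 < t" "0 < s" "t + s = 1"
  shows "h hb p m l R S (\<lambda>x. of_real t * f x + of_real s * g x) \<le>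
    ennreal t * h hb p m l R S f + ennreal s * h hb p m l R S g"
proof (induction m arbitrary: l R S)
  case 0
  let ?k = "\<lambda>x. of_real t * f x + of_real s * g x"
  let ?c = "\<lambda>N. (2 * hb) ^ (mi_abs R + mi_abs S + mi_abs N) / mi_fact N"
  let ?t = "\<lambda>u N. ennreal (?c N * (cmod (wirtinger R (N + S) u p))\<^sup>2)"
  have "?t ?k N \<le> ennreal t * ?t f N + ennreal s * ?t g N" for N
  proof -
    have "jet p ?k = (\<lambda>K. of_real t * jet p f K + of_real s * jet p g K)"
      using assms by (simp add: jet_add jet_cmult smooth_cmult)
    then have "?c N * (cmod (wirtinger R (N + S) ?k p))\<^sup>2 \<le>
        ?c N * (t * (cmod (wirtinger R (N + S) f p))\<^sup>2 + s * (cmod (wirtinger R (N + S) g p))\<^sup>2)"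
      using assms by (intro mult_left_mono) (auto simp: wirtinger_eq_jet intro!: real_power2_convex)
    then have "?t ?k N \<le> ennreal (t * (?c N * (cmod (wirtinger R (N + S) f p))\<^sup>2) + s * (?c N * (cmod (wirtinger R (N + S) g p))\<^sup>2))"
      by (intro ennreal_leI) (simp add: distrib_left mult.left_commute)
    also have "\<dots> = ennreal t * ?t f N + ennreal s * ?t g N"
      using assms by (intro ennreal_lincomb) auto
    finally show ?thesis .
  qed
  then have "h hb p 0 l R S ?k \<le> (\<Sum>\<^sub>\<infinity>N. ennreal t * ?t f N + ennreal s * ?t g N)"
    unfolding h.simps by (rule ennreal_infsum_mono)
  also have "\<dots> = (\<Sum>\<^sub>\<infinity>N. ennreal t * ?t f N) + (\<Sum>\<^sub>\<infinity>N. ennreal s * ?t g N)"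
    by (rule infsum_add[OF ennreal_summable ennreal_summable])
  also have "\<dots> \<le> ennreal t * h hb p 0 l R S f + ennreal s * h hb p 0 l R S g"
    unfolding h.simps by (intro add_mono ennreal_infsum_cmult_le)
  finally show ?case .
next
  case (Suc m)
  let ?k = "\<lambda>x. of_real t * f x + of_real s * g x"
  let ?v = "\<lambda>u N. h_inner hb p m l R (N + S) u"
  let ?t = "\<lambda>u N. ennreal (1 / mi_fact N) * (?v u N)\<^sup>2"
  have "?t ?k N \<le> ennreal t * ?t f N + ennreal s * ?t g N" for N
  proof -
    have "h_sub hb p m l I J ?k \<le> ennreal t * h_sub hb p m l I J f + ennreal s * h_sub hb p m l I J g" for I J
      unfolding h_sub_def by (cases "even l") (simp_all only: if_True if_False Suc.IH)
    then have "?v ?k N \<le> (\<Sum>I\<le>R. \<Sum>J\<le>N + S. of_nat (mi_binom R I * mi_binom (N + S) J) *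
        (ennreal t * h_sub hb p m l I J f + ennreal s * h_sub hb p m l I J g))"
      unfolding h_inner_def by (intro sum_mono mult_left_mono) auto
    also have "\<dots> = ennreal t * ?v f N + ennreal s * ?v g N"
      unfolding h_inner_def by (simp add: sum_distrib_left sum.distrib distrib_left mult_ac)
    finally have "(?v ?k N)\<^sup>2 \<le> (ennreal t * ?v f N + ennreal s * ?v g N)\<^sup>2"
      by (rule power_mono) simp
    also have "\<dots> \<le> ennreal t * (?v f N)\<^sup>2 + ennreal s * (?v g N)\<^sup>2"
      by (rule ennreal_power2_convex[OF assms(4-6)])
    finally have "?t ?k N \<le> ennreal (1 / mi_fact N) * (ennreal t * (?v f N)\<^sup>2 + ennreal s * (?v g N)\<^sup>2)"
      by (rule mult_left_mono) simp
    also have "\<dots> = ennreal t * ?t f N + ennreal s * ?t g N"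
      by (simp only: distrib_left mult_ac)
    finally show ?thesis .
  qed
  then have "h hb p (Suc m) l R S ?k \<le> (\<Sum>\<^sub>\<infinity>N. ennreal t * ?t f N + ennreal s * ?t g N)"
    unfolding h_Suc by (rule ennreal_infsum_mono)
  also have "\<dots> = (\<Sum>\<^sub>\<infinity>N. ennreal t * ?t f N) + (\<Sum>\<^sub>\<infinity>N. ennreal s * ?t g N)"
    by (rule infsum_add[OF ennreal_summable ennreal_summable])
  also have "\<dots> \<le> ennreal t * h hb p (Suc m) l R S f + ennreal s * h hb p (Suc m) l R S g"
    unfolding h_Suc by (intro add_mono ennreal_infsum_cmult_le)
  finally show ?case .
qed

lemma h_cmult_le:
  assumes "smooth f" "0 < hb"
  shows "h hb p m l R S (\<lambda>x. c * f x) \<le> ennreal (cmod c ^ (2 ^ (m + 1))) * h hb p m l R S f"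
proof (induction m arbitrary: l R S)
  case 0
  have "ennreal (k * (cmod (wirtinger R (N + S) (\<lambda>x. c * f x) p))\<^sup>2) =
      ennreal ((cmod c)\<^sup>2) * ennreal (k * (cmod (wirtinger R (N + S) f p))\<^sup>2)" if "0 \<le> k" for N k
    using assms that by (simp add: wirtinger_eq_jet jet_cmult norm_mult power_mult_distrib mult_ac flip: ennreal_mult)
  from this[of "(2 * hb) ^ (mi_abs R + mi_abs S + mi_abs N) / mi_fact N" N for N] assms(2)
  have eq: "ennreal ((2 * hb) ^ (mi_abs R + mi_abs S + mi_abs N) / mi_fact N
        * (cmod (wirtinger R (N + S) (\<lambda>x. c * f x) p))\<^sup>2) =
      ennreal (cmod c ^ (2 ^ (0 + 1))) * ennreal ((2 * hb) ^ (mi_abs R + mi_abs S + mi_abs N) / mi_fact N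
        * (cmod (wirtinger R (N + S) f p))\<^sup>2)" for N
    by simp
  show ?case unfolding h.simps eq by (rule ennreal_infsum_cmult_le)
next
  case (Suc m)
  let ?c = "ennreal (cmod c ^ (2 ^ (m + 1)))"
  let ?v = "\<lambda>u N. h_inner hb p m l R (N + S) u"
  have "ennreal (1 / mi_fact N) * (?v (\<lambda>x. c * f x) N)\<^sup>2 \<le> ?c\<^sup>2 * (ennreal (1 / mi_fact N) * (?v f N)\<^sup>2)" for N
  proof -
    have "h_sub hb p m l I J (\<lambda>x. c * f x) \<le> ?c * h_sub hb p m l I J f" for I J
      unfolding h_sub_def by (cases "even l") (simp_all only: if_True if_False Suc.IH)
    then have "?v (\<lambda>x. c * f x) N \<le> (\<Sum>I\<le>R. \<Sum>J\<le>N + S. of_nat (mi_binom R I * mi_binom (N + S) J) *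
        (?c * h_sub hb p m l I J f))"
      unfolding h_inner_def by (intro sum_mono mult_left_mono) auto
    also have "\<dots> = ?c * ?v f N"
      unfolding h_inner_def by (simp add: sum_distrib_left mult_ac)
    finally have "(?v (\<lambda>x. c * f x) N)\<^sup>2 \<le> (?c * ?v f N)\<^sup>2"
      by (rule power_mono) simp
    then have "ennreal (1 / mi_fact N) * (?v (\<lambda>x. c * f x) N)\<^sup>2 \<le> ennreal (1 / mi_fact N) * (?c * ?v f N)\<^sup>2"
      by (rule mult_left_mono) simp
    then show ?thesis by (simp only: power_mult_distrib mult_ac)
  qed
  then have "h hb p (Suc m) l R S (\<lambda>x. c * f x) \<le> (\<Sum>\<^sub>\<infinity>N. ?c\<^sup>2 * (ennreal (1 / mi_fact N) * (?v f N)\<^sup>2))"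
    unfolding h_Suc by (rule ennreal_infsum_mono)
  also have "\<dots> \<le> ?c\<^sup>2 * h hb p (Suc m) l R S f"
    unfolding h_Suc by (rule ennreal_infsum_cmult_le)
  also have "?c\<^sup>2 = ennreal (cmod c ^ (2 ^ (Suc m + 1)))"
    by (simp add: ennreal_power mult.commute flip: power_mult)
  finally show ?case .
qed

lemma A_norm_nonneg: "0 \<le> A_norm hb p m l R S f"
  by (simp add: A_norm_def)

lemma h_eq_A_norm:
  assumes "h hb p m l R S f < \<infinity>"
  shows "h hb p m l R S f = ennreal (A_norm hb p m l R S f ^ (2 ^ (m + 1)))"
  using assms by (simp add: A_norm_def real_root_pow_pos2)

lemma A_norm_leI:
  assumes "h hb p m l R S f \<le> ennreal (a ^ (2 ^ (m + 1)))" "0 \<le> a"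
  shows "A_norm hb p m l R S f \<le> a"
proof -
  have "enn2real (h hb p m l R S f) \<le> a ^ (2 ^ (m + 1))"
    using assms by (intro enn2real_leI) auto
  then have "A_norm hb p m l R S f \<le> root (2 ^ (m + 1)) (a ^ (2 ^ (m + 1)))"
    unfolding A_norm_def by simp
  then show ?thesis using assms(2) by (simp only: real_root_power_cancel zero_less_power zero_less_numeral)
qed

lemma A_norm_cmult_le:
  assumes "smooth f" "0 < hb" "h hb p m l R S f < \<infinity>"
  shows "A_norm hb p m l R S (\<lambda>x. c * f x) \<le> cmod c * A_norm hb p m l R S f"
proof (rule A_norm_leI)
  show "h hb p m l R S (\<lambda>x. c * f x) \<le> ennreal ((cmod c * A_norm hb p m l R S f) ^ 2 ^ (m + 1))"
    using h_cmult_le[OF assms(1,2), of p m l R S c] A_norm_nonneg[of hb p m l R S f]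
    unfolding h_eq_A_norm[OF assms(3)] by (simp add: power_mult_distrib flip: ennreal_mult)
qed (simp add: A_norm_nonneg)

text \<open>The inequality for \<open>c\<close> and the one for \<open>1 / c\<close> together give
  equality.\<close>

lemma A_norm_cmult:
  assumes "smooth f" "0 < hb" "h hb p m l R S f < \<infinity>"
  shows "A_norm hb p m l R S (\<lambda>x. c * f x) = cmod c * A_norm hb p m l R S f"
proof (rule antisym)
  show "A_norm hb p m l R S (\<lambda>x. c * f x) \<le> cmod c * A_norm hb p m l R S f"
    by (rule A_norm_cmult_le[OF assms])
  show "cmod c * A_norm hb p m l R S f \<le> A_norm hb p m l R S (\<lambda>x. c * f x)"
  proof (cases "c = 0")
    case False
    have "h hb p m l R S (\<lambda>x. c * f x) \<le> ennreal (cmod c ^ (2 ^ (m + 1))) * h hb p m l R S f"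
      by (rule h_cmult_le[OF assms(1,2)])
    also have "\<dots> < \<infinity>" using assms(3) by (simp add: ennreal_mult_less_top)
    finally have "A_norm hb p m l R S (\<lambda>x. (1 / c) * (c * f x)) \<le> cmod (1 / c) * A_norm hb p m l R S (\<lambda>x. c * f x)"
      using assms by (intro A_norm_cmult_le smooth_cmult)
    with False show ?thesis by (simp add: norm_divide field_simps)
  qed (simp add: A_norm_nonneg)
qed

text \<open>Convexity and homogeneity of degree \<open>2 ^ (m + 1)\<close> of \<open>h\<close> make its root a seminorm, since the
  unit ball of the root is convex.\<close>

lemma A_norm_triangle:
  assumes "smooth f" "smooth g" "0 < hb" "h hb p m l R S f < \<infinity>" "h hb p m l R S g < \<infinity>"
  shows "A_norm hb p m l R S (\<lambda>x. f x + g x) \<le> A_norm hb p m l R S f + A_norm hb p m l R S g"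
proof (rule field_le_epsilon)
  fix e :: real assume e: "0 < e"
  \<comment> \<open>The summand \<open>e / 2\<close> makes the numbers positive, so that division is
    possible even where a seminorm vanishes.\<close>
  define a where "a = A_norm hb p m l R S f + e / 2"
  define b where "b = A_norm hb p m l R S g + e / 2"
  have ab: "0 < a" "0 < b" using e A_norm_nonneg[of hb p m l R S] by (auto simp: a_def b_def add_nonneg_pos)
  define t where "t = a / (a + b)"
  define s where "s = b / (a + b)"
  have ts: "0 < t" "0 < s" "t + s = 1" using ab by (auto simp: t_def s_def add_divide_distrib[symmetric])
  have unit: "h hb p m l R S (\<lambda>x. of_real (1 / r) * u x) \<le> 1"
    if u: "smooth u" "h hb p m l R S u < \<infinity>" and r: "A_norm hb p m l R S u \<le> r" "0 < r" for r u
  proof -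
    have "h hb p m l R S (\<lambda>x. of_real (1 / r) * u x) \<le> ennreal (cmod (of_real (1 / r)) ^ 2 ^ (m + 1)) * h hb p m l R S u"
      by (rule h_cmult_le[OF u(1) assms(3)])
    also have "\<dots> = ennreal ((A_norm hb p m l R S u / r) ^ 2 ^ (m + 1))"
      unfolding h_eq_A_norm[OF u(2)] using r A_norm_nonneg[of hb p m l R S u]
      by (simp add: norm_divide power_divide flip: ennreal_mult)
    also have "\<dots> \<le> ennreal 1"
      using r A_norm_nonneg[of hb p m l R S u] by (intro ennreal_leI power_le_one) auto
    finally show ?thesis by simp
  qed
  \<comment> \<open>The sum is \<open>a + b\<close> times a convex combination of two elements of
    the unit ball.\<close>
  let ?f = "\<lambda>x. of_real (1 / a) * f x" and ?g = "\<lambda>x. of_real (1 / b) * g x"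
  let ?k = "\<lambda>x. of_real t * ?f x + of_real s * ?g x"
  have sm: "smooth ?f" "smooth ?g" "smooth ?k"
    by (rule smooth_cmult[OF assms(1)], rule smooth_cmult[OF assms(2)],
        rule smooth_add[OF smooth_cmult[OF smooth_cmult[OF assms(1)]] smooth_cmult[OF smooth_cmult[OF assms(2)]]])
  have "h hb p m l R S ?k \<le> ennreal t * h hb p m l R S ?f + ennreal s * h hb p m l R S ?g"
    by (rule h_convex[OF sm(1,2) assms(3) ts])
  also have "\<dots> \<le> ennreal t * 1 + ennreal s * 1"
    using unit[of f a] unit[of g b] assms ab e by (intro add_mono mult_left_mono) (auto simp: a_def b_def)
  also have "\<dots> = 1" using ts by (simp flip: ennreal_plus)
  finally have k: "h hb p m l R S ?k \<le> 1" .
  have "(\<lambda>x. f x + g x) = (\<lambda>x. of_real (a + b) * ?k x)"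
  proof
    fix x
    have "(a + b) * t * (1 / a) = 1" "(a + b) * s * (1 / b) = 1"
      using ab by (simp_all add: t_def s_def)
    then have "complex_of_real ((a + b) * t * (1 / a)) = 1" "complex_of_real ((a + b) * s * (1 / b)) = 1"
      by simp_all
    then show "f x + g x = of_real (a + b) * ?k x"
      unfolding of_real_mult distrib_left mult.assoc[symmetric] by simp
  qed
  then have "h hb p m l R S (\<lambda>x. f x + g x) \<le> ennreal (cmod (of_real (a + b)) ^ 2 ^ (m + 1)) * h hb p m l R S ?k"
    by (simp only: h_cmult_le[OF sm(3) assms(3)])
  also have "\<dots> \<le> ennreal ((a + b) ^ 2 ^ (m + 1)) * 1"
  proof -
    have "cmod (of_real (a + b)) = a + b"
      using ab unfolding norm_of_real by linarith
    from arg_cong[OF this, of "\<lambda>r. ennreal (r ^ 2 ^ (m + 1))"] show ?thesis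
      by (rule ord_eq_le_trans[OF arg_cong[where f = "\<lambda>r. r * h hb p m l R S ?k"]])
        (rule mult_left_mono[OF k zero_le])
  qed
  finally have "h hb p m l R S (\<lambda>x. f x + g x) \<le> ennreal ((a + b) ^ 2 ^ (m + 1))"
    by (simp only: mult_1_right)
  then have "A_norm hb p m l R S (\<lambda>x. f x + g x) \<le> a + b"
    by (rule A_norm_leI) (use ab in simp)
  then show "A_norm hb p m l R S (\<lambda>x. f x + g x) \<le> A_norm hb p m l R S f + A_norm hb p m l R S g + e"
    by (simp add: a_def b_def)
qed

lemma A_norm_upper_bound:
  fixes R S :: "nat ^ 'n"
  assumes "0 < hb"
  obtains \<epsilon> C where "0 < \<epsilon>" "0 \<le> C" "\<And>(f :: complex ^ 'n \<Rightarrow> complex) p q.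
    fact_bounded \<epsilon> q (jet p f) \<Longrightarrow> h hb p m l R S f < \<infinity> \<and> A_norm hb p m l R S f \<le> C * q"
proof -
  \<comment> \<open>\<open>R\<close> and \<open>S\<close> are fixed in this lemma, so their
    factorials join the constant whatever the exponent is.\<close>
  obtain \<epsilon> C where C: "0 < \<epsilon>" "0 \<le> C" "\<And>(f :: complex ^ 'n \<Rightarrow> complex) p q (l :: nat) R S.
      fact_bounded \<epsilon> q (jet p f) \<Longrightarrow>
      h hb p m l R S f \<le> ennreal (C * q ^ (2 ^ (m + 1)) * (mi_fact R * mi_fact S) powr 1)"
    using h_upper_bound[OF assms zero_less_one, of m, where 'n = 'n] by blast
  define D where "D = C * (mi_fact R * mi_fact S) powr 1"
  have D: "0 \<le> D" using C by (simp add: D_def)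
  show ?thesis
  proof (rule that[of \<epsilon> "root (2 ^ (m + 1)) D"])
    show "0 < \<epsilon>" by (rule C)
    show "0 \<le> root (2 ^ (m + 1)) D" using D by simp
    fix f :: "complex ^ 'n \<Rightarrow> complex" and p q
    assume f: "fact_bounded \<epsilon> q (jet p f)"
    then have q: "0 \<le> q" by (rule fact_bounded_nonneg)
    have le: "h hb p m l R S f \<le> ennreal (D * q ^ (2 ^ (m + 1)))"
      using C(3)[OF f, of l R S] by (simp add: D_def mult_ac)
    also have "D * q ^ (2 ^ (m + 1)) = (root (2 ^ (m + 1)) D * q) ^ (2 ^ (m + 1))"
      using D by (simp only: power_mult_distrib real_root_pow_pos2 zero_less_power zero_less_numeral)
    finally show "h hb p m l R S f < \<infinity> \<and> A_norm hb p m l R S f \<le> root (2 ^ (m + 1)) D * q"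
      using q D by (intro conjI A_norm_leI) (auto intro: order.strict_trans1)
  qed
qed

section \<open>Classes of functions with equal jets\<close>

definition jet_class :: "complex ^ 'n \<Rightarrow> (nat ^ ('n::finite + 'n) \<Rightarrow> complex) \<Rightarrow> (complex ^ 'n \<Rightarrow> complex) set" where
  "jet_class p a = {f. smooth f \<and> jet p f = a}"

text \<open>The norms with \<open>l = 1\<close> and \<open>R = S = 0\<close> already force the
  growth condition on the jet, and the upper bounds recover the finiteness of all the
  others.\<close>

lemma A_tilde_iff:
  assumes "0 < hb"
  shows "f \<in> A_tilde hb p \<longleftrightarrow> smooth f \<and> jet p f \<in> subfactorial"
proof safe
  assume f: "f \<in> A_tilde hb p"
  then show "smooth f" by (simp add: A_tilde_def)
  show "jet p f \<in> subfactorial"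
  proof (rule subfactorialI)
    fix \<epsilon> :: real assume "0 < \<epsilon>"
    then obtain m C where "\<And>f :: complex ^ 'a \<Rightarrow> complex. \<And>p. h hb p (m + 2) 1 0 0 f < \<infinity> \<Longrightarrow>
      fact_bounded \<epsilon> (C * A_norm hb p (m + 2) 1 0 0 f) (jet p f)"
      using jet_bound_A_norm[OF assms, of \<epsilon>, where 'n = 'a] by metis
    moreover have "1 < (2::nat) ^ (m + 2)" by (rule one_less_power) auto
    then have "h hb p (m + 2) 1 0 0 f < \<infinity>" using f unfolding A_tilde_def by blast
    ultimately show "\<exists>A. fact_bounded \<epsilon> A (jet p f)" by blast
  qed
next
  assume f: "smooth f" "jet p f \<in> subfactorial"
  have "h hb p m l R S f < \<infinity>" for m l R S
  proof -
    obtain \<epsilon> C where "0 < \<epsilon>" and C: "\<And>(f :: complex ^ 'a \<Rightarrow> complex) p q.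
        fact_bounded \<epsilon> q (jet p f) \<Longrightarrow> h hb p m l R S f < \<infinity> \<and> A_norm hb p m l R S f \<le> C * q"
      by (rule A_norm_upper_bound[OF assms, of m l R S]) (rule that; assumption)
    then show ?thesis using subfactorialD[OF f(2) \<open>0 < \<epsilon>\<close>] by metis
  qed
  with f(1) show "f \<in> A_tilde hb p" by (simp add: A_tilde_def)
qed

lemma taylor_fn_in_jet_class: "a \<in> subfactorial \<Longrightarrow> taylor_fn p a \<in> jet_class p a"
  by (simp add: jet_class_def smooth_taylor_fn jet_taylor_fn)

lemma jet_rel_Image:
  assumes "0 < hb" "smooth f" "jet p f \<in> subfactorial"
  shows "jet_rel hb p `` {f} = jet_class p (jet p f)"
proof -
  have null: "(\<lambda>x. f x - g x) \<in> jet_null p \<longleftrightarrow> jet p g = jet p f" if g: "smooth g" for g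
  proof -
    have eq: "(\<lambda>K. jet p f K - jet p g K) = (\<lambda>K. 0) \<longleftrightarrow> jet p g = jet p f"
      by (auto simp: fun_eq_iff)
    show ?thesis
      unfolding jet_null_iff jet_diff[OF assms(2) g] eq using smooth_diff[OF assms(2) g] by blast
  qed
  have "(f, g) \<in> jet_rel hb p \<longleftrightarrow> smooth g \<and> jet p g = jet p f" for g
  proof -
    have "(f, g) \<in> jet_rel hb p \<longleftrightarrow>
        f \<in> A_tilde hb p \<and> g \<in> A_tilde hb p \<and> (\<lambda>x. f x - g x) \<in> jet_null p"
      by (simp only: jet_rel_def mem_Collect_eq case_prod_conv)
    then show ?thesis
      unfolding A_tilde_iff[OF assms(1)] using assms(2,3) null by metis
  qed
  then show ?thesis by (simp only: jet_class_def Image_singleton)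
qed

lemma carrier_A_space:
  assumes "0 < hb"
  shows "carrier (A_space hb p) = jet_class p ` subfactorial"
proof -
  have "carrier (A_space hb p) = (\<lambda>f. jet_rel hb p `` {f}) ` A_tilde hb p"
    by (auto simp: A_space_def quotient_def)
  also have "\<dots> = (\<lambda>f. jet_class p (jet p f)) ` A_tilde hb p"
    by (rule image_cong) (auto simp: A_tilde_iff[OF assms] jet_rel_Image[OF assms])
  also have "\<dots> = jet_class p ` subfactorial"
  proof (intro equalityI subsetI)
    fix X assume "X \<in> jet_class p ` subfactorial"
    then obtain a where a: "a \<in> subfactorial" "X = jet_class p a" by blast
    then have "X = jet_class p (jet p (taylor_fn p a))" "taylor_fn p a \<in> A_tilde hb p"
      by (simp_all add: jet_taylor_fn A_tilde_iff[OF assms] smooth_taylor_fn)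
    then show "X \<in> (\<lambda>f. jet_class p (jet p f)) ` A_tilde hb p" by blast
  qed (auto simp: A_tilde_iff[OF assms])
  finally show ?thesis .
qed

text \<open>All sets in the union are equal, and there is at least one because the class contains
  the Taylor function. This is how operations descend to the quotient.\<close>

lemma UN_jet_class:
  assumes "0 < hb" "a \<in> subfactorial" "c \<in> subfactorial"
    "\<And>f. f \<in> jet_class p a \<Longrightarrow> smooth (u f) \<and> jet p (u f) = c"
  shows "(\<Union>f\<in>jet_class p a. jet_rel hb p `` {u f}) = jet_class p c"
proof -
  have "jet_rel hb p `` {u f} = jet_class p c" if "f \<in> jet_class p a" for f
    using jet_rel_Image[OF assms(1), of "u f" p] assms(3) assms(4)[OF that] by simp
  then show ?thesis using taylor_fn_in_jet_class[OF assms(2), of p] by auto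
qed

lemma UN2_jet_class:
  assumes "0 < hb" "a \<in> subfactorial" "b \<in> subfactorial" "c \<in> subfactorial"
    "\<And>f g. f \<in> jet_class p a \<Longrightarrow> g \<in> jet_class p b \<Longrightarrow> smooth (u f g) \<and> jet p (u f g) = c"
  shows "(\<Union>f\<in>jet_class p a. \<Union>g\<in>jet_class p b. jet_rel hb p `` {u f g}) = jet_class p c"
proof -
  have "(\<Union>g\<in>jet_class p b. jet_rel hb p `` {u f g}) = jet_class p c" if "f \<in> jet_class p a" for f
    by (rule UN_jet_class[OF assms(1,3,4) assms(5)[OF that]])
  then show ?thesis using taylor_fn_in_jet_class[OF assms(2), of p] by auto
qed

section \<open>Operations and seminorms in terms of arrays\<close>

lemma A_space_add:
  assumes "0 < hb" "a \<in> subfactorial" "b \<in> subfactorial"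
  shows "jet_class p a \<oplus>\<^bsub>A_space hb p\<^esub> jet_class p b = jet_class p (\<lambda>K. a K + b K)"
  unfolding A_space_def ring_record_simps module.simps
  by (rule UN2_jet_class[OF assms subfactorial_add[OF assms(2,3)]])
    (simp add: jet_class_def smooth_add jet_add)

lemma A_space_smult:
  assumes "0 < hb" "a \<in> subfactorial"
  shows "c \<odot>\<^bsub>A_space hb p\<^esub> jet_class p a = jet_class p (\<lambda>K. c * a K)"
  unfolding A_space_def module.simps
  by (rule UN_jet_class[OF assms subfactorial_scale[OF assms(2)]])
    (simp add: jet_class_def smooth_cmult jet_cmult)

lemma A_space_zero:
  assumes "0 < hb"
  shows "\<zero>\<^bsub>A_space hb p\<^esub> = jet_class p (\<lambda>K. 0)"
  using jet_rel_Image[OF assms, of "\<lambda>x. 0" p] by (simp add: A_space_def jet_zero subfactorial_0)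

lemma A_conj_class:
  assumes "0 < hb" "a \<in> subfactorial"
  shows "A_conj hb p (jet_class p a) = jet_class p (jet_cnj a)"
  unfolding A_conj_def
  by (rule UN_jet_class[OF assms subfactorial_cnj[OF assms(2)]])
    (simp add: jet_class_def smooth_cnj jet_of_cnj)

lemma wick_term_class:
  assumes "0 < hb" "a \<in> subfactorial" "b \<in> subfactorial"
  shows "wick_term hb p \<alpha> (jet_class p a) (jet_class p b) N = jet_class p (wick_coeff (2 * \<alpha>) a b N)"
  unfolding wick_term_def mult.assoc[of _ "wirtinger N 0 _ _"]
proof (rule UN2_jet_class[OF assms wick_coeff_subfactorial[OF assms(2,3)]])
  fix f g assume fg: "f \<in> jet_class p a" "g \<in> jet_class p b"
  let ?c = "(2 * \<alpha>) ^ mi_abs N / of_real (mi_fact N)"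
  have sm: "smooth (wirtinger N 0 f)" "smooth (wirtinger 0 N g)"
    using fg by (simp_all add: jet_class_def smooth_wirtinger)
  have "jet p (\<lambda>x. ?c * (wirtinger N 0 f x * wirtinger 0 N g x)) = wick_coeff (2 * \<alpha>) a b N"
    unfolding jet_cmult[OF smooth_mult[OF sm]] jet_mult[OF sm] wick_coeff_def
    using fg by (simp add: jet_class_def jet_wirtinger)
  then show "smooth (\<lambda>x. ?c * (wirtinger N 0 f x * wirtinger 0 N g x)) \<and>
      jet p (\<lambda>x. ?c * (wirtinger N 0 f x * wirtinger 0 N g x)) = wick_coeff (2 * \<alpha>) a b N"
    using smooth_cmult[OF smooth_mult[OF sm]] by blast
qed

lemma A_norm_cong:
  assumes "jet p f = jet p g"
  shows "A_norm hb p m l R S f = A_norm hb p m l R S g"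
proof -
  have "h hb p m l R S f = h hb p m l R S g" for m l R S
  proof (induction m arbitrary: l R S)
    case 0
    then show ?case using assms by (simp add: wirtinger_eq_jet)
  next
    case (Suc m)
    then have "h_sub hb p m l I J f = h_sub hb p m l I J g" for I J
      by (simp add: h_sub_def)
    then show ?case by (simp add: h_Suc h_inner_def)
  qed
  then show ?thesis by (simp add: A_norm_def)
qed

lemma A_norm_jet_class:
  assumes "a \<in> subfactorial"
  shows "the_elem (A_norm hb p m l R S ` jet_class p a) = A_norm hb p m l R S (taylor_fn p a)"
proof -
  have "A_norm hb p m l R S f = A_norm hb p m l R S (taylor_fn p a)" if "f \<in> jet_class p a" for f
    by (rule A_norm_cong) (use that assms in \<open>simp add: jet_class_def jet_taylor_fn\<close>)
  then have "A_norm hb p m l R S ` jet_class p a = {A_norm hb p m l R S (taylor_fn p a)}"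
    using taylor_fn_in_jet_class[OF assms, of p] by blast
  then show ?thesis by simp
qed

lemma A_seminormsE:
  assumes "q \<in> A_seminorms hb p"
  obtains m l R S where "l < 2 ^ m" "\<And>a. a \<in> subfactorial \<Longrightarrow> q (jet_class p a) = A_norm hb p m l R S (taylor_fn p a)"
proof -
  obtain m l R S where q: "l < 2 ^ m" "q = (\<lambda>F. the_elem (A_norm hb p m l R S ` F))"
    using assms unfolding A_seminorms_def by blast
  show ?thesis by (rule that[OF q(1)]) (simp only: q(2) A_norm_jet_class)
qed

lemma h_taylor_fn_finite:
  assumes "0 < hb" "a \<in> subfactorial" "l < 2 ^ m"
  shows "h hb p m l R S (taylor_fn p a) < \<infinity>"
proof -
  have "taylor_fn p a \<in> A_tilde hb p"
    by (simp add: A_tilde_iff[OF assms(1)] smooth_taylor_fn jet_taylor_fn assms(2))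
  then show ?thesis using assms(3) by (simp add: A_tilde_def)
qed

lemma A_seminorm_nonneg: "q \<in> A_seminorms hb p \<Longrightarrow> a \<in> subfactorial \<Longrightarrow> 0 \<le> q (jet_class p a)"
  by (erule A_seminormsE) (simp add: A_norm_nonneg)

lemma A_seminorm_scale:
  assumes "0 < hb" "q \<in> A_seminorms hb p" "a \<in> subfactorial"
  shows "q (jet_class p (\<lambda>K. c * a K)) = cmod c * q (jet_class p a)"
proof -
  obtain m l R S where q: "l < 2 ^ m"
    "\<And>a. a \<in> subfactorial \<Longrightarrow> q (jet_class p a) = A_norm hb p m l R S (taylor_fn p a)"
    by (rule A_seminormsE[OF assms(2)]) (rule that; assumption)
  note a = smooth_taylor_fn[OF assms(3), of p]
  have "A_norm hb p m l R S (taylor_fn p (\<lambda>K. c * a K)) = A_norm hb p m l R S (\<lambda>x. c * taylor_fn p a x)"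
    by (rule A_norm_cong)
      (simp add: smooth_cmult a jet_cmult jet_taylor_fn assms(3) subfactorial_scale)
  also have "\<dots> = cmod c * A_norm hb p m l R S (taylor_fn p a)"
    by (rule A_norm_cmult[OF a assms(1) h_taylor_fn_finite[OF assms(1,3) q(1)]])
  finally show ?thesis by (simp add: q(2) assms(3) subfactorial_scale)
qed

lemma A_seminorm_triangle:
  assumes "0 < hb" "q \<in> A_seminorms hb p" "a \<in> subfactorial" "b \<in> subfactorial"
  shows "q (jet_class p (\<lambda>K. a K + b K)) \<le> q (jet_class p a) + q (jet_class p b)"
proof -
  obtain m l R S where q: "l < 2 ^ m"
    "\<And>a. a \<in> subfactorial \<Longrightarrow> q (jet_class p a) = A_norm hb p m l R S (taylor_fn p a)"
    by (rule A_seminormsE[OF assms(2)]) (rule that; assumption)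
  note ab = smooth_taylor_fn[OF assms(3), of p] smooth_taylor_fn[OF assms(4), of p]
  have "A_norm hb p m l R S (taylor_fn p (\<lambda>K. a K + b K)) =
      A_norm hb p m l R S (\<lambda>x. taylor_fn p a x + taylor_fn p b x)"
    by (rule A_norm_cong)
      (simp add: smooth_add ab jet_add jet_taylor_fn assms(3,4) subfactorial_add)
  also have "\<dots> \<le> A_norm hb p m l R S (taylor_fn p a) + A_norm hb p m l R S (taylor_fn p b)"
    by (intro A_norm_triangle ab assms(1) h_taylor_fn_finite assms(3,4) q(1))
  finally show ?thesis by (simp add: q(2) assms(3,4) subfactorial_add)
qed

lemma A_seminorm_upper:
  fixes p :: "complex ^ 'n"
  assumes "0 < hb" "q \<in> A_seminorms hb p"
  obtains \<epsilon> C where "0 < \<epsilon>" "0 \<le> C"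
    "\<And>a A. a \<in> subfactorial \<Longrightarrow> fact_bounded \<epsilon> A a \<Longrightarrow> q (jet_class p a) \<le> C * A"
proof -
  obtain m l R S where q: "l < 2 ^ m"
    "\<And>a. a \<in> subfactorial \<Longrightarrow> q (jet_class p a) = A_norm hb p m l R S (taylor_fn p a)"
    by (rule A_seminormsE[OF assms(2)]) (rule that; assumption)
  obtain \<epsilon> C where C: "0 < \<epsilon>" "0 \<le> C" "\<And>(f :: complex ^ 'n \<Rightarrow> complex) p q.
        fact_bounded \<epsilon> q (jet p f) \<Longrightarrow> h hb p m l R S f < \<infinity> \<and> A_norm hb p m l R S f \<le> C * q"
    by (rule A_norm_upper_bound[OF assms(1), of m l R S]) (rule that; assumption)
  show ?thesis
    by (rule that[OF C(1,2)]) (use C(3) in \<open>simp add: q(2) jet_taylor_fn\<close>)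
qed

text \<open>The converse of \<open>A_seminorm_upper\<close>. A single seminorm suffices for each
  exponent, so continuity estimates need only one seminorm on the right.\<close>

lemma A_seminorm_lower:
  fixes p :: "complex ^ 'n"
  assumes "0 < hb" "0 < \<epsilon>"
  obtains q C where "q \<in> A_seminorms hb p" "0 \<le> C"
    "\<And>a. a \<in> subfactorial \<Longrightarrow> fact_bounded \<epsilon> (C * q (jet_class p a)) a"
proof -
  obtain m C where C: "0 \<le> C" "\<And>(f :: complex ^ 'n \<Rightarrow> complex) p. h hb p (m + 2) 1 0 0 f < \<infinity> \<Longrightarrow>
      fact_bounded \<epsilon> (C * A_norm hb p (m + 2) 1 0 0 f) (jet p f)"
    by (rule jet_bound_A_norm[OF assms, where 'n = 'n]) (rule that; assumption)
  have l: "1 < (2::nat) ^ (m + 2)" by (rule one_less_power) auto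
  show ?thesis
  proof (rule that[of "\<lambda>F. the_elem (A_norm hb p (m + 2) 1 0 0 ` F)" C])
    show "(\<lambda>F. the_elem (A_norm hb p (m + 2) 1 0 0 ` F)) \<in> A_seminorms hb p"
      unfolding A_seminorms_def using l by blast
    fix a :: "nat ^ ('n + 'n) \<Rightarrow> complex" assume a: "a \<in> subfactorial"
    show "fact_bounded \<epsilon> (C * the_elem (A_norm hb p (m + 2) 1 0 0 ` jet_class p a)) a"
      using C(2)[OF h_taylor_fn_finite[OF assms(1) a l]] by (simp only: A_norm_jet_class[OF a] jet_taylor_fn[OF a])
  qed (rule C(1))
qed

lemma countable_A_seminorms: "countable (A_seminorms hb p)"
proof -
  have "A_seminorms hb p \<subseteq> range (\<lambda>(m, l, R, S). \<lambda>F. the_elem (A_norm hb p m l R S ` F))"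
  proof
    fix q assume "q \<in> A_seminorms hb p"
    then obtain m l R S where "q = (\<lambda>F. the_elem (A_norm hb p m l R S ` F))"
      unfolding A_seminorms_def by blast
    then show "q \<in> range (\<lambda>(m, l, R, S). \<lambda>F. the_elem (A_norm hb p m l R S ` F))"
      by (intro range_eqI[where x = "(m, l, R, S)"]) simp
  qed
  then show ?thesis by (rule countable_subset) simp
qed

section \<open>The Frechet space\<close>

text \<open>The plain space and the Wick algebra differ only in their multiplication. The locale
  fixes the common fields, so the linear and topological theory is proved once for both.\<close>

locale jet_module =
  fixes hb :: real and p :: "complex ^ 'n"
    and M :: "(complex, (complex ^ 'n \<Rightarrow> complex) set, 'm) module_scheme"
  assumes hb: "0 < hb"
    and M_eq: "carrier M = carrier (A_space hb p)" "add M = add (A_space hb p)"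
      "zero M = zero (A_space hb p)" "smult M = smult (A_space hb p)"
begin

abbreviation cl :: "(nat ^ ('n + 'n) \<Rightarrow> complex) \<Rightarrow> (complex ^ 'n \<Rightarrow> complex) set" where
  "cl \<equiv> jet_class p"

abbreviation T :: "(complex ^ 'n \<Rightarrow> complex) set topology" where
  "T \<equiv> A_topology hb p"

lemma carrier_M: "carrier M = cl ` subfactorial"
  by (simp add: M_eq carrier_A_space[OF hb])

lemma cl_closed: "a \<in> subfactorial \<Longrightarrow> cl a \<in> carrier M"
  by (simp add: carrier_M)

lemma add_cl: "a \<in> subfactorial \<Longrightarrow> b \<in> subfactorial \<Longrightarrow> cl a \<oplus>\<^bsub>M\<^esub> cl b = cl (\<lambda>K. a K + b K)"
  by (simp add: M_eq A_space_add[OF hb])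

lemma smult_cl: "a \<in> subfactorial \<Longrightarrow> c \<odot>\<^bsub>M\<^esub> cl a = cl (\<lambda>K. c * a K)"
  by (simp add: M_eq A_space_smult[OF hb])

lemma zero_cl: "\<zero>\<^bsub>M\<^esub> = cl (\<lambda>K. 0)"
  by (simp add: M_eq A_space_zero[OF hb])

lemma abelian_group_M: "abelian_group M"
proof (rule abelian_groupI)
  fix x y z assume "x \<in> carrier M" "y \<in> carrier M" "z \<in> carrier M"
  then obtain a b c where abc: "a \<in> subfactorial" "b \<in> subfactorial" "c \<in> subfactorial"
    "x = cl a" "y = cl b" "z = cl c"
    unfolding carrier_M by blast
  show "x \<oplus>\<^bsub>M\<^esub> y \<oplus>\<^bsub>M\<^esub> z = x \<oplus>\<^bsub>M\<^esub> (y \<oplus>\<^bsub>M\<^esub> z)"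
    by (simp add: abc add_cl subfactorial_add add.assoc)
next
  fix x y assume "x \<in> carrier M" "y \<in> carrier M"
  then obtain a b where ab: "a \<in> subfactorial" "b \<in> subfactorial" "x = cl a" "y = cl b"
    unfolding carrier_M by blast
  show "x \<oplus>\<^bsub>M\<^esub> y \<in> carrier M"
    unfolding ab add_cl[OF ab(1,2)] by (intro cl_closed subfactorial_add ab)
  show "x \<oplus>\<^bsub>M\<^esub> y = y \<oplus>\<^bsub>M\<^esub> x"
    by (simp add: ab add_cl add.commute)
next
  fix x assume "x \<in> carrier M"
  then obtain a where a: "a \<in> subfactorial" "x = cl a" unfolding carrier_M by blast
  show "\<zero>\<^bsub>M\<^esub> \<oplus>\<^bsub>M\<^esub> x = x" by (simp add: a zero_cl add_cl subfactorial_0)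
  show "\<exists>y\<in>carrier M. y \<oplus>\<^bsub>M\<^esub> x = \<zero>\<^bsub>M\<^esub>"
    by (rule bexI[of _ "cl (\<lambda>K. -1 * a K)"])
      (simp_all add: a zero_cl add_cl subfactorial_scale[OF a(1), of "-1", simplified] cl_closed)
qed (simp add: zero_cl cl_closed subfactorial_0)

lemma minus_cl:
  assumes "a \<in> subfactorial" "b \<in> subfactorial"
  shows "cl a \<ominus>\<^bsub>M\<^esub> cl b = cl (\<lambda>K. a K - b K)"
proof -
  interpret abelian_group M by (rule abelian_group_M)
  have nb: "(\<lambda>K. - b K) \<in> subfactorial" using subfactorial_scale[OF assms(2), of "-1"] by simp
  have "\<ominus>\<^bsub>M\<^esub> cl b = cl (\<lambda>K. - b K)"
    by (rule minus_equality) (simp_all add: cl_closed assms nb add_cl zero_cl)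
  then show ?thesis by (simp add: a_minus_def add_cl assms nb)
qed

lemma cring_complex_ring: "cring complex_ring"
proof (rule cringI)
  show "abelian_group complex_ring"
    by (rule abelian_groupI) (auto simp: complex_ring_def intro: exI[of _ "- _"] add.left_inverse)
  show "comm_monoid complex_ring"
    by (rule comm_monoidI) (auto simp: complex_ring_def)
qed (auto simp: complex_ring_def algebra_simps)

lemma module_M: "module complex_ring M"
proof (rule moduleI[OF cring_complex_ring abelian_group_M])
  fix c x assume "x \<in> carrier M"
  then obtain a where a: "a \<in> subfactorial" "x = cl a" unfolding carrier_M by blast
  show "c \<odot>\<^bsub>M\<^esub> x \<in> carrier M" by (simp add: a smult_cl cl_closed subfactorial_scale)
  show "\<one>\<^bsub>complex_ring\<^esub> \<odot>\<^bsub>M\<^esub> x = x" by (simp add: a smult_cl complex_ring_def)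
  fix d
  show "(c \<oplus>\<^bsub>complex_ring\<^esub> d) \<odot>\<^bsub>M\<^esub> x = c \<odot>\<^bsub>M\<^esub> x \<oplus>\<^bsub>M\<^esub> d \<odot>\<^bsub>M\<^esub> x"
    by (simp add: a smult_cl add_cl subfactorial_scale complex_ring_def distrib_right)
  show "(c \<otimes>\<^bsub>complex_ring\<^esub> d) \<odot>\<^bsub>M\<^esub> x = c \<odot>\<^bsub>M\<^esub> (d \<odot>\<^bsub>M\<^esub> x)"
    by (simp add: a smult_cl subfactorial_scale complex_ring_def mult.assoc)
  fix y assume "y \<in> carrier M"
  then obtain b where b: "b \<in> subfactorial" "y = cl b" unfolding carrier_M by blast
  show "c \<odot>\<^bsub>M\<^esub> (x \<oplus>\<^bsub>M\<^esub> y) = c \<odot>\<^bsub>M\<^esub> x \<oplus>\<^bsub>M\<^esub> c \<odot>\<^bsub>M\<^esub> y"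
    by (simp add: a b smult_cl add_cl subfactorial_scale subfactorial_add distrib_left)
qed

text \<open>Subtraction is built from the shared fields, so the balls of \<open>M\<close> are those
  of \<open>A_space\<close>.\<close>

lemma T_eq: "T = seminorm_topology M (A_seminorms hb p)"
proof -
  have "a_minus M = a_minus (A_space hb p)"
    by (simp add: a_minus_def a_inv_def m_inv_def M_eq fun_eq_iff)
  then show ?thesis by (simp add: A_topology_def seminorm_topology_def M_eq)
qed

lemma seminorm_on_A: "q \<in> A_seminorms hb p \<Longrightarrow> seminorm_on M q"
  unfolding seminorm_on_def carrier_M
  by (auto simp: A_seminorm_nonneg smult_cl add_cl A_seminorm_scale[OF hb] A_seminorm_triangle[OF hb])

lemma A_seminorms_nonempty: "A_seminorms hb p \<noteq> {}"
  using A_seminorm_lower[OF hb zero_less_one, of p] by blast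

lemma seminorm_minus_commute:
  assumes "q \<in> A_seminorms hb p" "a \<in> subfactorial" "b \<in> subfactorial"
  shows "q (cl (\<lambda>K. a K - b K)) = q (cl (\<lambda>K. b K - a K))"
  using A_seminorm_scale[OF hb assms(1) subfactorial_diff[OF assms(2,3)], of "-1"] by simp

lemma seminorm_0:
  assumes "q \<in> A_seminorms hb p" shows "q (cl (\<lambda>K. 0)) = 0"
  using A_seminorm_scale[OF hb assms subfactorial_0, of 0] by simp

lemma seminorm_minus_triangle:
  assumes "q \<in> A_seminorms hb p" "x \<in> carrier M" "y \<in> carrier M" "z \<in> carrier M"
  shows "q (x \<ominus>\<^bsub>M\<^esub> z) \<le> q (x \<ominus>\<^bsub>M\<^esub> y) + q (y \<ominus>\<^bsub>M\<^esub> z)"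
proof -
  obtain a b c where abc: "a \<in> subfactorial" "b \<in> subfactorial" "c \<in> subfactorial"
    "x = cl a" "y = cl b" "z = cl c"
    using assms unfolding carrier_M by blast
  show ?thesis
    using A_seminorm_triangle[OF hb assms(1), of "\<lambda>K. a K - b K" "\<lambda>K. b K - c K"]
    by (simp add: abc minus_cl subfactorial_diff)
qed

lemma seminorm_minus_nonneg:
  assumes "q \<in> A_seminorms hb p" "x \<in> carrier M" "y \<in> carrier M"
  shows "0 \<le> q (x \<ominus>\<^bsub>M\<^esub> y)"
proof -
  obtain a b where ab: "a \<in> subfactorial" "b \<in> subfactorial" "x = cl a" "y = cl b"
    using assms unfolding carrier_M by blast
  show ?thesis
    unfolding ab minus_cl[OF ab(1,2)] by (rule A_seminorm_nonneg[OF assms(1) subfactorial_diff[OF ab(1,2)]])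
qed

lemma seminorm_minus_self:
  assumes "q \<in> A_seminorms hb p" "x \<in> carrier M"
  shows "q (x \<ominus>\<^bsub>M\<^esub> x) = 0"
proof -
  obtain a where a: "a \<in> subfactorial" "x = cl a"
    using assms unfolding carrier_M by blast
  show ?thesis using seminorm_0[OF assms(1)] by (simp add: a minus_cl)
qed

section \<open>Limits, separation and completeness\<close>

definition sball :: "((complex ^ 'n \<Rightarrow> complex) set \<Rightarrow> real) \<Rightarrow> (complex ^ 'n \<Rightarrow> complex) set \<Rightarrow> real \<Rightarrow>
    (complex ^ 'n \<Rightarrow> complex) set set" where
  "sball q x e = {y \<in> carrier M. q (y \<ominus>\<^bsub>M\<^esub> x) < e}"

lemma T_generated: "T = topology_generated_by {sball q x e | q x e. q \<in> A_seminorms hb p \<and> x \<in> carrier M \<and> 0 < e}"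
  by (simp add: T_eq seminorm_topology_def sball_def)

lemma openin_sball: "q \<in> A_seminorms hb p \<Longrightarrow> x \<in> carrier M \<Longrightarrow> 0 < e \<Longrightarrow> openin T (sball q x e)"
  unfolding T_generated by (rule topology_generated_by_Basis) blast

lemma center_in_sball: "q \<in> A_seminorms hb p \<Longrightarrow> x \<in> carrier M \<Longrightarrow> 0 < e \<Longrightarrow> x \<in> sball q x e"
  by (simp add: sball_def seminorm_minus_self)

lemma topspace_T: "topspace T = carrier M"
proof
  show "topspace T \<subseteq> carrier M"
    unfolding T_generated topology_generated_by_topspace by (auto simp: sball_def)
  obtain q where q: "q \<in> A_seminorms hb p" using A_seminorms_nonempty by blast
  show "carrier M \<subseteq> topspace T"
    using openin_subset[OF openin_sball[OF q _ zero_less_one]] center_in_sball[OF q _ zero_less_one] by blast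
qed

text \<open>The balls form only a subbasis, so eventual membership in open sets is checked by
  induction over the generated topology.\<close>

lemma limitin_T_iff:
  "limitin T s x F \<longleftrightarrow> x \<in> carrier M \<and> (\<forall>\<^sub>F i in F. s i \<in> carrier M) \<and>
    (\<forall>q\<in>A_seminorms hb p. ((\<lambda>i. q (s i \<ominus>\<^bsub>M\<^esub> x)) \<longlongrightarrow> 0) F)"
proof safe
  assume lim: "limitin T s x F"
  then show x: "x \<in> carrier M" by (simp add: limitin_def topspace_T)
  have ball: "\<forall>\<^sub>F i in F. s i \<in> sball q x e" if "q \<in> A_seminorms hb p" "0 < e" for q e
    using lim openin_sball[OF that(1) x that(2)] center_in_sball[OF that(1) x that(2)]
    by (simp add: limitin_def)
  obtain q where "q \<in> A_seminorms hb p" using A_seminorms_nonempty by blast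
  from ball[OF this zero_less_one] show "\<forall>\<^sub>F i in F. s i \<in> carrier M"
    by (rule eventually_mono) (simp add: sball_def)
  fix q assume q: "q \<in> A_seminorms hb p"
  show "((\<lambda>i. q (s i \<ominus>\<^bsub>M\<^esub> x)) \<longlongrightarrow> 0) F"
  proof (rule tendstoI)
    fix e :: real assume "0 < e"
    from ball[OF q this] show "\<forall>\<^sub>F i in F. dist (q (s i \<ominus>\<^bsub>M\<^esub> x)) 0 < e"
      by (rule eventually_mono) (use seminorm_minus_nonneg[OF q _ x] in \<open>auto simp: sball_def\<close>)
  qed
next
  assume x: "x \<in> carrier M" and s: "\<forall>\<^sub>F i in F. s i \<in> carrier M"
    and lim: "\<forall>q\<in>A_seminorms hb p. ((\<lambda>i. q (s i \<ominus>\<^bsub>M\<^esub> x)) \<longlongrightarrow> 0) F"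
  show "limitin T s x F"
    unfolding limitin_def topspace_T
  proof (intro conjI x allI impI)
    fix U assume U: "openin T U \<and> x \<in> U"
    then have "generate_topology_on {sball q x e | q x e. q \<in> A_seminorms hb p \<and> x \<in> carrier M \<and> 0 < e} U"
      unfolding T_generated openin_topology_generated_by_iff by blast
    moreover have "x \<in> U" using U by blast
    ultimately show "\<forall>\<^sub>F i in F. s i \<in> U"
    proof (induction rule: generate_topology_on.induct)
      case (Int a b)
      then show ?case by (auto simp: eventually_conj_iff)
    next
      case (UN k)
      then obtain V where "V \<in> k" "x \<in> V" by blast
      with UN have "\<forall>\<^sub>F i in F. s i \<in> V" by blast
      then show ?case by (rule eventually_mono) (use \<open>V \<in> k\<close> in blast)
    next
      case (Basis V)
      then obtain q y e where V: "V = sball q y e" and q: "q \<in> A_seminorms hb p" and y: "y \<in> carrier M"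
        by blast
      \<comment> \<open>The ball need not be centred at \<open>x\<close>; \<open>d\<close> is the
        radius that is left around \<open>x\<close>.\<close>
      define d where "d = e - q (x \<ominus>\<^bsub>M\<^esub> y)"
      have "0 < d" using Basis.prems by (simp add: V sball_def d_def)
      then have "\<forall>\<^sub>F i in F. dist (q (s i \<ominus>\<^bsub>M\<^esub> x)) 0 < d"
        using lim q tendstoD by blast
      with s show ?case
      proof eventually_elim
        case (elim i)
        then have "q (s i \<ominus>\<^bsub>M\<^esub> y) < e"
          using seminorm_minus_triangle[OF q, of "s i" x y] x y by (simp add: d_def dist_real_def)
        with elim show ?case by (simp add: V sball_def)
      qed
    qed simp
  qed
qed

text \<open>Already one seminorm separates points: it bounds every entry of the array, so it
  vanishes only at 0.\<close>

lemma Hausdorff_T: "Hausdorff_space T"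
  unfolding Hausdorff_space_def topspace_T
proof (intro allI impI, elim conjE)
  fix x y assume xy: "x \<in> carrier M" "y \<in> carrier M" "x \<noteq> y"
  obtain a b where ab: "a \<in> subfactorial" "b \<in> subfactorial" "x = cl a" "y = cl b"
    using xy unfolding carrier_M by blast
  obtain q C where q: "q \<in> A_seminorms hb p" "0 \<le> C"
    "\<And>a. a \<in> subfactorial \<Longrightarrow> fact_bounded 1 (C * q (cl a)) a"
    by (rule A_seminorm_lower[OF hb zero_less_one, of p]) (rule that; assumption)
  let ?d = "q (x \<ominus>\<^bsub>M\<^esub> y)"
  have "?d \<noteq> 0"
  proof
    assume "?d = 0"
    then have "fact_bounded 1 0 (\<lambda>K. a K - b K)"
      using q(3)[OF subfactorial_diff[OF ab(1,2)]] by (simp add: ab minus_cl)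
    then have "a = b" by (auto simp: fact_bounded_def fun_eq_iff)
    with xy(3) ab show False by simp
  qed
  then have d: "0 < ?d / 2" using seminorm_minus_nonneg[OF q(1) xy(1,2)] by simp
  have comm: "q (x \<ominus>\<^bsub>M\<^esub> z) = q (z \<ominus>\<^bsub>M\<^esub> x)" if z: "z \<in> carrier M" for z
  proof -
    obtain c where "c \<in> subfactorial" "z = cl c" using z unfolding carrier_M by blast
    then show ?thesis by (simp add: ab minus_cl seminorm_minus_commute[OF q(1) ab(1)])
  qed
  have "disjnt (sball q x (?d / 2)) (sball q y (?d / 2))"
  proof -
    have False if "z \<in> sball q x (?d / 2)" "z \<in> sball q y (?d / 2)" for z
      using that seminorm_minus_triangle[OF q(1) xy(1) _ xy(2), of z] comm[of z]
      by (auto simp: sball_def)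
    then show ?thesis by (auto simp: disjnt_def)
  qed
  then show "\<exists>U V. openin T U \<and> openin T V \<and> x \<in> U \<and> y \<in> V \<and> disjnt U V"
    using openin_sball[OF q(1) _ d] center_in_sball[OF q(1) _ d] xy by metis
qed

text \<open>Each entry of the arrays is a Cauchy sequence. The estimates hold for all indices at
  once, so they pass to the entrywise limit and give both its growth bound and the
  convergence.\<close>

lemma limit_of_Cauchy:
  assumes s: "\<And>i. s i \<in> carrier M"
    and Cauchy: "\<And>q e. q \<in> A_seminorms hb p \<Longrightarrow> 0 < e \<Longrightarrow> \<exists>n::nat. \<forall>i\<ge>n. \<forall>j\<ge>n. q (s i \<ominus>\<^bsub>M\<^esub> s j) < e"
  shows "\<exists>x\<in>carrier M. limitin T s x sequentially"
proof -
  have "\<forall>i. \<exists>a. a \<in> subfactorial \<and> s i = cl a" using s unfolding carrier_M by blast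
  then obtain a where a: "\<And>i. a i \<in> subfactorial" "\<And>i. s i = cl (a i)" by metis
  have close: "\<exists>n. \<forall>i\<ge>n. \<forall>j\<ge>n. fact_bounded \<epsilon> \<delta> (\<lambda>K. a i K - a j K)" if pos: "0 < \<epsilon>" "0 < \<delta>" for \<epsilon> \<delta>
  proof -
    obtain q C where q: "q \<in> A_seminorms hb p" "0 \<le> C"
      "\<And>a. a \<in> subfactorial \<Longrightarrow> fact_bounded \<epsilon> (C * q (cl a)) a"
      by (rule A_seminorm_lower[OF hb pos(1), of p]) (rule that; assumption)
    \<comment> \<open>The constant \<open>C\<close> may be 0, hence the denominator
      \<open>C + 1\<close>.\<close>
    have pos': "0 < \<delta> / (C + 1)" using pos(2) q(2) by simp
    obtain n where n: "\<And>i j. i \<ge> n \<Longrightarrow> j \<ge> n \<Longrightarrow> q (s i \<ominus>\<^bsub>M\<^esub> s j) < \<delta> / (C + 1)"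
      using Cauchy[OF q(1) pos'] by blast
    have "fact_bounded \<epsilon> \<delta> (\<lambda>K. a i K - a j K)" if "i \<ge> n" "j \<ge> n" for i j
    proof (rule fact_bounded_mono[OF q(3)[OF subfactorial_diff[OF a(1) a(1)]] order.refl])
      have "C * q (s i \<ominus>\<^bsub>M\<^esub> s j) \<le> C * (\<delta> / (C + 1))"
        using n[OF that] q(2) by (intro mult_left_mono) auto
      also have "\<dots> \<le> \<delta>" using q(2) \<open>0 < \<delta>\<close> by (simp add: field_simps)
      finally show "C * q (cl (\<lambda>K. a i K - a j K)) \<le> \<delta>" by (simp add: a minus_cl)
    qed
    then show ?thesis by blast
  qed
  have "Cauchy (\<lambda>i. a i K)" for K
  proof (rule CauchyI)
    fix e :: real assume e: "0 < e"
    \<comment> \<open>Half of \<open>e\<close> makes the final inequality strict.\<close>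
    then have "0 < e / (2 * mi_fact K powr 1)" using mi_fact_pos[of K] by simp
    then obtain n where n: "\<And>i j. i \<ge> n \<Longrightarrow> j \<ge> n \<Longrightarrow> fact_bounded 1 (e / (2 * mi_fact K powr 1)) (\<lambda>K. a i K - a j K)"
      using close[OF zero_less_one] by blast
    have "norm (a i K - a j K) < e" if "i \<ge> n" "j \<ge> n" for i j
      using fact_boundedD[OF n[OF that], of K] e mi_fact_pos[of K] by simp
    then show "\<exists>n. \<forall>i\<ge>n. \<forall>j\<ge>n. norm (a i K - a j K) < e" by blast
  qed
  then have "\<forall>K. \<exists>l. (\<lambda>i. a i K) \<longlonglongrightarrow> l" using Cauchy_convergent_iff convergent_def by blast
  then obtain b where b: "\<And>K. (\<lambda>i. a i K) \<longlonglongrightarrow> b K" by metis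
  have near: "\<exists>n. \<forall>i\<ge>n. fact_bounded \<epsilon> \<delta> (\<lambda>K. a i K - b K)" if pos: "0 < \<epsilon>" "0 < \<delta>" for \<epsilon> \<delta>
  proof -
    obtain n where n: "\<And>i j. i \<ge> n \<Longrightarrow> j \<ge> n \<Longrightarrow> fact_bounded \<epsilon> \<delta> (\<lambda>K. a i K - a j K)"
      using close[OF pos] by blast
    have "fact_bounded \<epsilon> \<delta> (\<lambda>K. a i K - b K)" if "i \<ge> n" for i
      unfolding fact_bounded_def
    proof
      fix K
      have "(\<lambda>j. norm (a i K - a j K)) \<longlonglongrightarrow> norm (a i K - b K)"
        by (intro tendsto_intros b)
      moreover have "\<exists>N. \<forall>j\<ge>N. norm (a i K - a j K) \<le> \<delta> * mi_fact K powr \<epsilon>"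
        using fact_boundedD[OF n[OF that]] by blast
      ultimately show "norm (a i K - b K) \<le> \<delta> * mi_fact K powr \<epsilon>" by (rule LIMSEQ_le_const2)
    qed
    then show ?thesis by blast
  qed
  have bsub: "b \<in> subfactorial"
  proof (rule subfactorialI)
    fix \<epsilon> :: real assume \<epsilon>: "0 < \<epsilon>"
    obtain n where n: "fact_bounded \<epsilon> 1 (\<lambda>K. a n K - b K)" using near[OF \<epsilon> zero_less_one] by blast
    obtain A where "fact_bounded \<epsilon> A (a n)" using subfactorialD[OF a(1) \<epsilon>] by blast
    from fact_bounded_diff[OF this n] show "\<exists>A. fact_bounded \<epsilon> A b" by auto
  qed
  have "limitin T s (cl b) sequentially"
    unfolding limitin_T_iff
  proof (intro conjI ballI)
    show "cl b \<in> carrier M" by (rule cl_closed[OF bsub])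
    show "\<forall>\<^sub>F i in sequentially. s i \<in> carrier M" using s by simp
    fix q assume q: "q \<in> A_seminorms hb p"
    obtain \<epsilon> C where C: "0 < \<epsilon>" "0 \<le> C"
      "\<And>a A. a \<in> subfactorial \<Longrightarrow> fact_bounded \<epsilon> A a \<Longrightarrow> q (cl a) \<le> C * A"
      by (rule A_seminorm_upper[OF hb q]) (rule that; assumption)
    show "(\<lambda>i. q (s i \<ominus>\<^bsub>M\<^esub> cl b)) \<longlonglongrightarrow> 0"
    proof (rule LIMSEQ_I)
      fix e :: real assume e: "0 < e"
      then have "0 < e / (C + 1)" using C(2) by simp
      then obtain n where n: "\<And>i. i \<ge> n \<Longrightarrow> fact_bounded \<epsilon> (e / (C + 1)) (\<lambda>K. a i K - b K)"
        using near[OF C(1)] by blast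
      have "norm (q (s i \<ominus>\<^bsub>M\<^esub> cl b) - 0) < e" if "i \<ge> n" for i
      proof -
        have "q (s i \<ominus>\<^bsub>M\<^esub> cl b) \<le> C * (e / (C + 1))"
          using C(3)[OF subfactorial_diff[OF a(1) bsub] n[OF that]] by (simp add: a minus_cl bsub)
        also have "\<dots> < e" using C(2) e by (simp add: field_simps)
        finally show ?thesis
          using seminorm_minus_nonneg[OF q s cl_closed[OF bsub], of i] by simp
      qed
      then show "\<exists>n. \<forall>i\<ge>n. norm (q (s i \<ominus>\<^bsub>M\<^esub> cl b) - 0) < e" by blast
    qed
  qed
  then show ?thesis using cl_closed[OF bsub] by blast
qed

lemma frechet_space_M: "frechet_space M T"
proof (rule frechet_space.intro[OF module_M], rule frechet_space_axioms.intro)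
  show "Hausdorff_space T" by (rule Hausdorff_T)
  let ?q = "from_nat_into (A_seminorms hb p)"
  have range: "range ?q = A_seminorms hb p"
    by (rule range_from_nat_into[OF A_seminorms_nonempty countable_A_seminorms])
  show "\<exists>q :: nat \<Rightarrow> (complex ^ 'n \<Rightarrow> complex) set \<Rightarrow> real.
      (\<forall>k. seminorm_on M (q k)) \<and> T = seminorm_topology M (range q) \<and>
      (\<forall>s :: nat \<Rightarrow> (complex ^ 'n \<Rightarrow> complex) set.
        (\<forall>i. s i \<in> carrier M) \<and> (\<forall>k. \<forall>\<epsilon>>0. \<exists>n. \<forall>i\<ge>n. \<forall>j\<ge>n. q k (s i \<ominus>\<^bsub>M\<^esub> s j) < \<epsilon>)
        \<longrightarrow> (\<exists>x\<in>carrier M. limitin T s x sequentially))"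
  proof (intro exI[of _ ?q] conjI allI impI)
    show "seminorm_on M (?q k)" for k
      using range by (intro seminorm_on_A) blast
    show "T = seminorm_topology M (range ?q)" unfolding range by (rule T_eq)
    fix s :: "nat \<Rightarrow> (complex ^ 'n \<Rightarrow> complex) set"
    assume "(\<forall>i. s i \<in> carrier M) \<and> (\<forall>k. \<forall>\<epsilon>>0. \<exists>n. \<forall>i\<ge>n. \<forall>j\<ge>n. ?q k (s i \<ominus>\<^bsub>M\<^esub> s j) < \<epsilon>)"
    then have "\<And>i. s i \<in> carrier M"
      "\<And>q e. q \<in> range ?q \<Longrightarrow> 0 < e \<Longrightarrow> \<exists>n::nat. \<forall>i\<ge>n. \<forall>j\<ge>n. q (s i \<ominus>\<^bsub>M\<^esub> s j) < e"
      by blast+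
    then show "\<exists>x\<in>carrier M. limitin T s x sequentially"
      unfolding range by (rule limit_of_Cauchy)
  qed
qed

end

section \<open>The Wick algebra\<close>

context jet_module
begin

text \<open>Absolute convergence refers to all continuous seminorms, also those outside the
  generating family. If no bound \<open>1 / Suc n\<close> worked, there would be arrays tending to 0
  on which \<open>q\<close> stays above 1, against continuity; scaling gives the general
  bound.\<close>

lemma continuous_seminorm_upper:
  assumes q: "seminorm_on M q" and cont: "continuous_map T euclideanreal q"
  obtains \<epsilon> C where "0 < \<epsilon>" "0 \<le> C"
    "\<And>a A. a \<in> subfactorial \<Longrightarrow> fact_bounded \<epsilon> A a \<Longrightarrow> q (cl a) \<le> C * A"
proof -
  have scale: "q (cl (\<lambda>K. c * a K)) = cmod c * q (cl a)" if "a \<in> subfactorial" for c a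
    using q that unfolding seminorm_on_def by (metis cl_closed smult_cl)
  have q0: "q (cl (\<lambda>K. 0)) = 0"
    using scale[OF subfactorial_0, of 0] by simp
  have "\<exists>n::nat. \<forall>a\<in>subfactorial. fact_bounded (1 / Suc n) (1 / Suc n) a \<longrightarrow> q (cl a) \<le> 1"
  proof (rule ccontr)
    assume "\<not> ?thesis"
    then have "\<forall>n::nat. \<exists>a. a \<in> subfactorial \<and> fact_bounded (1 / Suc n) (1 / Suc n) a \<and> \<not> q (cl a) \<le> 1"
      by blast
    then obtain a where a: "\<And>n::nat. a n \<in> subfactorial" "\<And>n. fact_bounded (1 / Suc n) (1 / Suc n) (a n)"
      "\<And>n. \<not> q (cl (a n)) \<le> 1"
      by metis
    have "limitin T (\<lambda>n. cl (a n)) (cl (\<lambda>K. 0)) sequentially"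
      unfolding limitin_T_iff
    proof (intro conjI ballI)
      show "cl (\<lambda>K. 0) \<in> carrier M" by (rule cl_closed[OF subfactorial_0])
      show "\<forall>\<^sub>F n in sequentially. cl (a n) \<in> carrier M" by (simp add: cl_closed a(1))
      fix r assume r: "r \<in> A_seminorms hb p"
      obtain \<epsilon> C where C: "0 < \<epsilon>" "0 \<le> C"
        "\<And>a A. a \<in> subfactorial \<Longrightarrow> fact_bounded \<epsilon> A a \<Longrightarrow> r (cl a) \<le> C * A"
        by (rule A_seminorm_upper[OF hb r]) (rule that; assumption)
      obtain n0 where n0: "1 / real (Suc n0) < \<epsilon>" using nat_approx_posE[OF C(1)] .
      show "(\<lambda>n. r (cl (a n) \<ominus>\<^bsub>M\<^esub> cl (\<lambda>K. 0))) \<longlonglongrightarrow> 0"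
      proof (rule tendsto_sandwich[of "\<lambda>n. 0" _ _ "\<lambda>n. C * (1 / Suc n)"])
        show "\<forall>\<^sub>F n in sequentially. 0 \<le> r (cl (a n) \<ominus>\<^bsub>M\<^esub> cl (\<lambda>K. 0))"
          by (intro always_eventually allI seminorm_minus_nonneg r cl_closed a(1) subfactorial_0)
        have "r (cl (a n) \<ominus>\<^bsub>M\<^esub> cl (\<lambda>K. 0)) \<le> C * (1 / Suc n)" if "n \<ge> n0" for n
        proof -
          have "1 / real (Suc n) \<le> 1 / real (Suc n0)" using that by (simp add: frac_le)
          then have "fact_bounded \<epsilon> (1 / Suc n) (a n)"
            using n0 by (intro fact_bounded_mono[OF a(2)]) auto
          from C(3)[OF a(1) this] show ?thesis by (simp add: minus_cl a(1) subfactorial_0)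
        qed
        then show "\<forall>\<^sub>F n in sequentially. r (cl (a n) \<ominus>\<^bsub>M\<^esub> cl (\<lambda>K. 0)) \<le> C * (1 / Suc n)"
          unfolding eventually_sequentially by blast
        show "(\<lambda>n. C * (1 / real (Suc n))) \<longlonglongrightarrow> 0"
          using tendsto_mult_right_zero[OF lim_1_over_n[THEN LIMSEQ_Suc], of C] by simp
      qed simp
    qed
    from continuous_map_limit[OF cont this] have "(\<lambda>n. q (cl (a n))) \<longlonglongrightarrow> 0"
      by (simp add: limitin_canonical_iff o_def q0)
    then have "\<forall>\<^sub>F n in sequentially. q (cl (a n)) < 1"
      by (rule order_tendstoD) simp
    then obtain n where "q (cl (a n)) < 1" unfolding eventually_sequentially by blast
    with a(3)[of n] show False by simp
  qed
  then obtain n :: nat where n: "\<And>a. a \<in> subfactorial \<Longrightarrow> fact_bounded (1 / Suc n) (1 / Suc n) a \<Longrightarrow> q (cl a) \<le> 1"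
    by blast
  show ?thesis
  proof (rule that[of "1 / Suc n" "Suc n"])
    fix a :: "nat ^ ('n + 'n) \<Rightarrow> complex" and A
    assume a: "a \<in> subfactorial" "fact_bounded (1 / Suc n) A a"
    have "0 \<le> A" using a(2) by (rule fact_bounded_nonneg)
    show "q (cl a) \<le> Suc n * A"
    \<comment> \<open>The scaling divides by \<open>A\<close>; a bound 0 forces the zero
      array.\<close>
    proof (cases "A = 0")
      case True
      then have "a = (\<lambda>K. 0)" using a(2) by (auto simp: fact_bounded_def fun_eq_iff)
      then show ?thesis by (simp add: q0 True)
    next
      case False
      with \<open>0 \<le> A\<close> have A: "0 < A" by simp
      \<comment> \<open>Scales the bound from \<open>A\<close> to \<open>1 / Suc n\<close>, where
        the choice of \<open>n\<close> applies.\<close>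
      let ?c = "complex_of_real (1 / (A * Suc n))"
      have c: "cmod ?c = 1 / (A * Suc n)"
        unfolding norm_of_real using A by simp
      have "fact_bounded (1 / Suc n) (cmod ?c * A) (\<lambda>K. ?c * a K)"
        by (rule fact_bounded_scale[OF a(2)])
      also have "cmod ?c * A = 1 / Suc n" unfolding c using A by simp
      finally have "q (cl (\<lambda>K. ?c * a K)) \<le> 1" by (rule n[OF subfactorial_scale[OF a(1)]])
      then have "1 / (A * Suc n) * q (cl a) \<le> 1" unfolding scale[OF a(1)] c .
      moreover have "q (cl a) \<le> r" if "1 / r * q (cl a) \<le> 1" "0 < r" for r :: real
        using that by (simp add: field_simps)
      moreover have "0 < A * Suc n" using A by simp
      ultimately show ?thesis by (metis mult.commute)
    qed
  qed auto
qed

lemma finsum_cl: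
  assumes "finite F" "\<And>N. t N \<in> subfactorial"
  shows "finsum M (\<lambda>N. cl (t N)) F = cl (\<lambda>K. \<Sum>N\<in>F. t N K)"
proof -
  interpret abelian_group M by (rule abelian_group_M)
  show ?thesis
    using assms(1)
  proof (induction F rule: finite_induct)
    case empty
    then show ?case by (simp add: zero_cl)
  next
    case (insert N F)
    then show ?case
      by (simp add: finsum_insert cl_closed assms(2) add_cl subfactorial_sum)
  qed
qed

text \<open>The majorants give both parts: their tails dominate the distance of the partial sums
  from the limit, and their terms dominate the values of any continuous seminorm.\<close>

lemma abs_convergent_cl:
  fixes t :: "'i \<Rightarrow> nat ^ ('n + 'n) \<Rightarrow> complex"
  assumes bound: "\<And>\<epsilon>. 0 < \<epsilon> \<Longrightarrow> \<exists>u. (\<forall>N. 0 \<le> u N) \<and> u summable_on UNIV \<and> (\<forall>N. fact_bounded \<epsilon> (u N) (t N))"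
  shows "abs_convergent_to M T (\<lambda>N. cl (t N)) (cl (\<lambda>K. \<Sum>\<^sub>\<infinity>N. t N K))"
proof -
  let ?s = "\<lambda>K. \<Sum>\<^sub>\<infinity>N. t N K"
  have t: "t N \<in> subfactorial" for N
    using bound by (intro subfactorialI) blast
  have s: "?s \<in> subfactorial"
    using bound fact_bounded_infsum by (intro subfactorialI) blast
  have lim: "series_limit M T (\<lambda>N. cl (t N)) (cl ?s)"
    unfolding series_limit_def limitin_T_iff
  proof (intro conjI ballI)
    show "cl ?s \<in> carrier M" by (rule cl_closed[OF s])
    have fin: "\<forall>\<^sub>F F in finite_subsets_at_top (UNIV :: 'i set). finite F"
      by (rule eventually_finite_subsets_at_top_weakI) simp
    then show "\<forall>\<^sub>F F in finite_subsets_at_top UNIV. finsum M (\<lambda>N. cl (t N)) F \<in> carrier M"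
      by (rule eventually_mono) (simp add: finsum_cl t cl_closed subfactorial_sum)
    fix q assume q: "q \<in> A_seminorms hb p"
    obtain \<epsilon> C where C: "0 < \<epsilon>" "0 \<le> C"
      "\<And>a A. a \<in> subfactorial \<Longrightarrow> fact_bounded \<epsilon> A a \<Longrightarrow> q (cl a) \<le> C * A"
      by (rule A_seminorm_upper[OF hb q]) (rule that; assumption)
    obtain u where u: "\<And>N. 0 \<le> u N" "u summable_on UNIV" "\<And>N. fact_bounded \<epsilon> (u N) (t N)"
      using bound[OF C(1)] by blast
    have tail: "((\<lambda>F. C * (infsum u UNIV - sum u F)) \<longlongrightarrow> 0) (finite_subsets_at_top UNIV)"
    proof -
      have "((\<lambda>F. sum u F) \<longlongrightarrow> infsum u UNIV) (finite_subsets_at_top UNIV)"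
        using has_sum_infsum[OF u(2)] unfolding has_sum_def .
      from tendsto_mult_left[OF tendsto_diff[OF tendsto_const this], of C "infsum u UNIV"] show ?thesis by simp
    qed
    have le: "0 \<le> q (finsum M (\<lambda>N. cl (t N)) F \<ominus>\<^bsub>M\<^esub> cl ?s) \<and>
        q (finsum M (\<lambda>N. cl (t N)) F \<ominus>\<^bsub>M\<^esub> cl ?s) \<le> C * (infsum u UNIV - sum u F)"
      if F: "finite F" for F
    proof -
      have sum: "(\<lambda>K. \<Sum>N\<in>F. t N K) \<in> subfactorial" by (rule subfactorial_sum[OF F t])
      have "infsum u (- F) = infsum u UNIV - sum u F"
        using infsum_Diff[OF u(2), of F] F by (simp add: Compl_eq_Diff_UNIV)
      then have "fact_bounded \<epsilon> (infsum u UNIV - sum u F) (\<lambda>K. ?s K - (\<Sum>N\<in>F. t N K))"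
        using fact_bounded_infsum_tail[OF u(3,2) F] by simp
      then have "q (cl (\<lambda>K. ?s K - (\<Sum>N\<in>F. t N K))) \<le> C * (infsum u UNIV - sum u F)"
        by (rule C(3)[OF subfactorial_diff[OF s sum]])
      then show ?thesis
        using A_seminorm_nonneg[OF q subfactorial_diff[OF sum s]]
        by (simp add: finsum_cl[OF F t] minus_cl[OF sum s] seminorm_minus_commute[OF q sum s])
    qed
    show "((\<lambda>F. q (finsum M (\<lambda>N. cl (t N)) F \<ominus>\<^bsub>M\<^esub> cl ?s)) \<longlongrightarrow> 0) (finite_subsets_at_top UNIV)"
      by (rule tendsto_sandwich[OF _ _ tendsto_const tail]; rule eventually_mono[OF fin]; use le in blast)
  qed
  have "(\<lambda>N. q (cl (t N))) summable_on UNIV"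
    if q: "seminorm_on M q" "continuous_map T euclideanreal q" for q
  proof -
    obtain \<epsilon> C where C: "0 < \<epsilon>" "0 \<le> C"
      "\<And>a A. a \<in> subfactorial \<Longrightarrow> fact_bounded \<epsilon> A a \<Longrightarrow> q (cl a) \<le> C * A"
      by (rule continuous_seminorm_upper[OF q]) (rule that; assumption)
    obtain u where u: "u summable_on UNIV" "\<And>N. fact_bounded \<epsilon> (u N) (t N)"
      using bound[OF C(1)] by blast
    show ?thesis
    proof (rule summable_on_comparison_test)
      show "(\<lambda>N. C * u N) summable_on UNIV" by (rule summable_on_cmult_right[OF u(1)])
      show "q (cl (t N)) \<le> C * u N" for N by (rule C(3)[OF t u(2)])
      show "0 \<le> q (cl (t N))" for N
        using q(1) cl_closed[OF t] by (simp add: seminorm_on_def)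
    qed
  qed
  with lim show ?thesis by (simp add: abs_convergent_to_def cl_closed t)
qed

lemma series_limit_unique:
  "series_limit M T t x \<Longrightarrow> series_limit M T t y \<Longrightarrow> x = y"
  unfolding series_limit_def
  by (rule limitin_Hausdorff_unique[OF _ _ finite_subsets_at_top_neq_bot Hausdorff_T])

end

section \<open>The Wick product of classes\<close>

lemma jet_module_A_space: "0 < hb \<Longrightarrow> jet_module hb p (A_space hb p)"
  by (simp add: jet_module_def)

lemma jet_module_wick_algebra: "0 < hb \<Longrightarrow> jet_module hb p (wick_algebra hb p \<alpha>)"
  by (simp add: jet_module_def wick_algebra_def)

lemma abs_convergent_wick:
  assumes "0 < hb" "a \<in> subfactorial" "b \<in> subfactorial"
  shows "abs_convergent_to (A_space hb p) (A_topology hb p)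
    (wick_term hb p \<alpha> (jet_class p a) (jet_class p b)) (jet_class p (wick_sum (2 * \<alpha>) a b))"
proof -
  have "wick_term hb p \<alpha> (jet_class p a) (jet_class p b) = (\<lambda>N. jet_class p (wick_coeff (2 * \<alpha>) a b N))"
    by (rule ext) (rule wick_term_class[OF assms])
  moreover have "abs_convergent_to (A_space hb p) (A_topology hb p)
      (\<lambda>N. jet_class p (wick_coeff (2 * \<alpha>) a b N)) (jet_class p (\<lambda>K. \<Sum>\<^sub>\<infinity>N. wick_coeff (2 * \<alpha>) a b N K))"
    using wick_coeff_subfactorial_bound[OF assms(2,3)]
    by (intro jet_module.abs_convergent_cl[OF jet_module_A_space[OF assms(1)]]) metis
  ultimately show ?thesis by (simp add: wick_sum_def)
qed

text \<open>The definite description in \<open>wick\<close> is resolved by uniqueness of limits in a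
  Hausdorff space.\<close>

lemma wick_jet_class:
  assumes "0 < hb" "a \<in> subfactorial" "b \<in> subfactorial"
  shows "wick hb p \<alpha> (jet_class p a) (jet_class p b) = jet_class p (wick_sum (2 * \<alpha>) a b)"
proof -
  have lim: "series_limit (A_space hb p) (A_topology hb p)
      (wick_term hb p \<alpha> (jet_class p a) (jet_class p b)) (jet_class p (wick_sum (2 * \<alpha>) a b))"
    using abs_convergent_wick[OF assms] by (simp add: abs_convergent_to_def)
  show ?thesis
    unfolding wick_def
  proof (rule the_equality)
    fix L assume "series_limit (A_space hb p) (A_topology hb p)
        (wick_term hb p \<alpha> (jet_class p a) (jet_class p b)) L"
    then show "L = jet_class p (wick_sum (2 * \<alpha>) a b)"
      by (rule jet_module.series_limit_unique[OF jet_module_A_space[OF assms(1)] _ lim])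
  qed (rule lim)
qed

context jet_module
begin

lemma seminorm_wick_sum_le:
  assumes "q \<in> A_seminorms hb p"
  obtains r C where "r \<in> A_seminorms hb p" "0 \<le> C"
    "\<And>a b. a \<in> subfactorial \<Longrightarrow> b \<in> subfactorial \<Longrightarrow> q (cl (wick_sum c a b)) \<le> C * (r (cl a) * r (cl b))"
proof -
  obtain \<delta> C1 where C1: "0 < \<delta>" "0 \<le> C1"
    "\<And>a A. a \<in> subfactorial \<Longrightarrow> fact_bounded \<delta> A a \<Longrightarrow> q (cl a) \<le> C1 * A"
    by (rule A_seminorm_upper[OF hb assms]) (rule that; assumption)
  obtain \<epsilon> C2 where C2: "0 < \<epsilon>" "0 \<le> C2"
    "\<And>(a :: nat ^ ('n + 'n) \<Rightarrow> complex) b A B. fact_bounded \<epsilon> A a \<Longrightarrow> fact_bounded \<epsilon> B b \<Longrightarrow>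
      fact_bounded \<delta> (C2 * A * B) (wick_sum c a b)"
    by (rule fact_bounded_wick_sum[OF C1(1), where c = c and 'n = 'n]) (rule that; assumption)
  obtain r C3 where C3: "r \<in> A_seminorms hb p" "0 \<le> C3"
    "\<And>a. a \<in> subfactorial \<Longrightarrow> fact_bounded \<epsilon> (C3 * r (cl a)) a"
    by (rule A_seminorm_lower[OF hb C2(1), of p]) (rule that; assumption)
  show ?thesis
  proof (rule that[of r "C1 * C2 * C3 * C3"])
    fix a b :: "nat ^ ('n + 'n) \<Rightarrow> complex"
    assume ab: "a \<in> subfactorial" "b \<in> subfactorial"
    from C1(3)[OF wick_sum_subfactorial[OF ab] C2(3)[OF C3(3)[OF ab(1)] C3(3)[OF ab(2)]]]
    show "q (cl (wick_sum c a b)) \<le> C1 * C2 * C3 * C3 * (r (cl a) * r (cl b))"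
      by (simp add: mult_ac)
  qed (use C1 C2 C3 in auto)
qed

lemma wick_closed:
  assumes "x \<in> carrier M" "y \<in> carrier M" shows "wick hb p \<alpha> x y \<in> carrier M"
  using assms unfolding carrier_M by (auto simp: wick_jet_class[OF hb] wick_sum_subfactorial)

text \<open>By bilinearity, with d for the difference of the left factors and e for that of the
  right ones, the difference of the products is d e + d y + x e. Every summand contains a factor
  that tends to 0.\<close>

lemma seminorm_wick_minus_le:
  assumes "q \<in> A_seminorms hb p"
  obtains r C where "r \<in> A_seminorms hb p"
    "\<And>u v x y. u \<in> carrier M \<Longrightarrow> v \<in> carrier M \<Longrightarrow> x \<in> carrier M \<Longrightarrow> y \<in> carrier M \<Longrightarrow>
      q (wick hb p \<alpha> u v \<ominus>\<^bsub>M\<^esub> wick hb p \<alpha> x y) \<le>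
      C * (r (u \<ominus>\<^bsub>M\<^esub> x) * r (v \<ominus>\<^bsub>M\<^esub> y) + r (u \<ominus>\<^bsub>M\<^esub> x) * r y + r x * r (v \<ominus>\<^bsub>M\<^esub> y))"
proof -
  let ?w = "wick_sum (2 * \<alpha>)"
  obtain r C where r: "r \<in> A_seminorms hb p" "0 \<le> C"
    "\<And>a b. a \<in> subfactorial \<Longrightarrow> b \<in> subfactorial \<Longrightarrow> q (cl (?w a b)) \<le> C * (r (cl a) * r (cl b))"
    by (rule seminorm_wick_sum_le[OF assms, where c = "2 * \<alpha>"]) (rule that; assumption)
  show ?thesis
  proof (rule that[OF r(1), of C])
    fix u v x y assume "u \<in> carrier M" "v \<in> carrier M" "x \<in> carrier M" "y \<in> carrier M"
    then obtain a' b' a b where ab: "a' \<in> subfactorial" "b' \<in> subfactorial" "a \<in> subfactorial" "b \<in> subfactorial"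
      "u = cl a'" "v = cl b'" "x = cl a" "y = cl b"
      unfolding carrier_M by blast
    define d e where "d = (\<lambda>K. a' K - a K)" and "e = (\<lambda>K. b' K - b K)"
    have de: "d \<in> subfactorial" "e \<in> subfactorial"
      by (simp_all add: d_def e_def subfactorial_diff ab)
    have a': "a' = (\<lambda>K. d K + a K)" and b': "b' = (\<lambda>K. e K + b K)"
      by (simp_all add: d_def e_def)
    have "?w a' b' = (\<lambda>K. ?w d b' K + ?w a b' K)"
      unfolding a' by (rule wick_sum_add_left[OF de(1) ab(3,2)])
    also have "?w d b' = (\<lambda>K. ?w d e K + ?w d b K)"
      unfolding b' by (rule wick_sum_add_right[OF de ab(4)])
    also have "?w a b' = (\<lambda>K. ?w a e K + ?w a b K)"
      unfolding b' by (rule wick_sum_add_right[OF ab(3) de(2) ab(4)])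
    finally have eq: "(\<lambda>K. ?w a' b' K - ?w a b K) = (\<lambda>K. ?w d e K + ?w d b K + ?w a e K)"
      by (simp add: fun_eq_iff)
    have "q (wick hb p \<alpha> u v \<ominus>\<^bsub>M\<^esub> wick hb p \<alpha> x y) = q (cl (\<lambda>K. ?w d e K + ?w d b K + ?w a e K))"
      by (simp add: ab wick_jet_class[OF hb] minus_cl wick_sum_subfactorial eq)
    also have "\<dots> \<le> q (cl (?w d e)) + q (cl (?w d b)) + q (cl (?w a e))"
      using A_seminorm_triangle[OF hb assms, of "\<lambda>K. ?w d e K + ?w d b K" "?w a e"]
        A_seminorm_triangle[OF hb assms, of "?w d e" "?w d b"]
      by (simp add: wick_sum_subfactorial subfactorial_add de ab)
    also have "\<dots> \<le> C * (r (cl d) * r (cl e)) + C * (r (cl d) * r (cl b)) + C * (r (cl a) * r (cl e))"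
      by (intro add_mono r de ab)
    finally show "q (wick hb p \<alpha> u v \<ominus>\<^bsub>M\<^esub> wick hb p \<alpha> x y) \<le>
      C * (r (u \<ominus>\<^bsub>M\<^esub> x) * r (v \<ominus>\<^bsub>M\<^esub> y) + r (u \<ominus>\<^bsub>M\<^esub> x) * r y + r x * r (v \<ominus>\<^bsub>M\<^esub> y))"
      by (simp add: ab minus_cl d_def e_def distrib_left)
  qed
qed

text \<open>Continuity is tested along the filter \<open>atin\<close>, where
  \<open>limitin_T_iff\<close> applies; the continuity of the projections gives the convergence of
  both arguments.\<close>

lemma wick_continuous: "continuous_map (prod_topology T T) T (\<lambda>(x, y). wick hb p \<alpha> x y)"
  unfolding continuous_map_atin
proof
  fix z assume "z \<in> topspace (prod_topology T T)"
  then obtain x y where z: "z = (x, y)" and xy: "x \<in> carrier M" "y \<in> carrier M"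
    by (auto simp: topspace_T)
  let ?F = "atin (prod_topology T T) z"
  have ztop: "z \<in> topspace (prod_topology T T)" using z xy by (simp add: topspace_T)
  have "limitin T fst (fst z) ?F" "limitin T snd (snd z) ?F"
    using continuous_map_fst[of T T] continuous_map_snd[of T T] ztop unfolding continuous_map_atin by blast+
  then have lims: "\<forall>\<^sub>F w in ?F. fst w \<in> carrier M" "\<forall>\<^sub>F w in ?F. snd w \<in> carrier M"
    "\<And>q. q \<in> A_seminorms hb p \<Longrightarrow> ((\<lambda>w. q (fst w \<ominus>\<^bsub>M\<^esub> x)) \<longlongrightarrow> 0) ?F"
    "\<And>q. q \<in> A_seminorms hb p \<Longrightarrow> ((\<lambda>w. q (snd w \<ominus>\<^bsub>M\<^esub> y)) \<longlongrightarrow> 0) ?F"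
    unfolding limitin_T_iff z by simp_all
  have car: "\<forall>\<^sub>F w in ?F. fst w \<in> carrier M \<and> snd w \<in> carrier M"
    using lims(1,2) by (rule eventually_conj)
  show "limitin T (\<lambda>(x, y). wick hb p \<alpha> x y) (case z of (x, y) \<Rightarrow> wick hb p \<alpha> x y) ?F"
    unfolding limitin_T_iff
  proof (intro conjI ballI)
    show "(case z of (x, y) \<Rightarrow> wick hb p \<alpha> x y) \<in> carrier M" by (simp add: z wick_closed xy)
    show "\<forall>\<^sub>F w in ?F. (case w of (x, y) \<Rightarrow> wick hb p \<alpha> x y) \<in> carrier M"
      using car by (rule eventually_mono) (auto simp: wick_closed)
    fix q assume q: "q \<in> A_seminorms hb p"
    obtain r C where r: "r \<in> A_seminorms hb p"
      "\<And>u v x y. u \<in> carrier M \<Longrightarrow> v \<in> carrier M \<Longrightarrow> x \<in> carrier M \<Longrightarrow> y \<in> carrier M \<Longrightarrow>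
        q (wick hb p \<alpha> u v \<ominus>\<^bsub>M\<^esub> wick hb p \<alpha> x y) \<le>
        C * (r (u \<ominus>\<^bsub>M\<^esub> x) * r (v \<ominus>\<^bsub>M\<^esub> y) + r (u \<ominus>\<^bsub>M\<^esub> x) * r y + r x * r (v \<ominus>\<^bsub>M\<^esub> y))"
      by (rule seminorm_wick_minus_le[OF q, where \<alpha> = \<alpha>]) (rule that; assumption)
    let ?b = "\<lambda>w. C * (r (fst w \<ominus>\<^bsub>M\<^esub> x) * r (snd w \<ominus>\<^bsub>M\<^esub> y) + r (fst w \<ominus>\<^bsub>M\<^esub> x) * r y + r x * r (snd w \<ominus>\<^bsub>M\<^esub> y))"
    have b: "(?b \<longlongrightarrow> 0) ?F"
    proof -
      have "(?b \<longlongrightarrow> C * (0 * 0 + 0 * r y + r x * 0)) ?F"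
        by (intro tendsto_mult tendsto_add tendsto_const lims(3,4) r(1))
      then show ?thesis by simp
    qed
    show "((\<lambda>w. q ((case w of (x, y) \<Rightarrow> wick hb p \<alpha> x y) \<ominus>\<^bsub>M\<^esub> (case z of (x, y) \<Rightarrow> wick hb p \<alpha> x y))) \<longlongrightarrow> 0) ?F"
    proof (rule tendsto_sandwich[OF _ _ tendsto_const b])
      show "\<forall>\<^sub>F w in ?F. 0 \<le> q ((case w of (x, y) \<Rightarrow> wick hb p \<alpha> x y) \<ominus>\<^bsub>M\<^esub> (case z of (x, y) \<Rightarrow> wick hb p \<alpha> x y))"
        using car by (rule eventually_mono) (auto simp: z xy wick_closed seminorm_minus_nonneg[OF q])
      show "\<forall>\<^sub>F w in ?F. q ((case w of (x, y) \<Rightarrow> wick hb p \<alpha> x y) \<ominus>\<^bsub>M\<^esub> (case z of (x, y) \<Rightarrow> wick hb p \<alpha> x y)) \<le> ?b w"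
        using car by (rule eventually_mono) (use r(2) xy in \<open>auto simp: z\<close>)
    qed
  qed
qed

text \<open>Conjugation keeps every bound \<open>fact_bounded\<close> unchanged, so passing from one
  seminorm to the growth bound and back proves continuity.\<close>

lemma A_conj_continuous: "continuous_map T T (A_conj hb p)"
  unfolding continuous_map_atin
proof
  fix x assume "x \<in> topspace T"
  then have x: "x \<in> carrier M" by (simp add: topspace_T)
  have closed: "A_conj hb p u \<in> carrier M" if "u \<in> carrier M" for u
    using that unfolding carrier_M by (auto simp: A_conj_class[OF hb] subfactorial_cnj)
  have "limitin T (\<lambda>u. u) x (atin T x)"
    using continuous_map_id[of T] \<open>x \<in> topspace T\<close> unfolding continuous_map_atin id_def by blast
  then have lims: "\<forall>\<^sub>F u in atin T x. u \<in> carrier M"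
    "\<And>q. q \<in> A_seminorms hb p \<Longrightarrow> ((\<lambda>u. q (u \<ominus>\<^bsub>M\<^esub> x)) \<longlongrightarrow> 0) (atin T x)"
    unfolding limitin_T_iff by simp_all
  show "limitin T (A_conj hb p) (A_conj hb p x) (atin T x)"
    unfolding limitin_T_iff
  proof (intro conjI ballI)
    show "A_conj hb p x \<in> carrier M" by (rule closed[OF x])
    show "\<forall>\<^sub>F u in atin T x. A_conj hb p u \<in> carrier M"
      using lims(1) by (rule eventually_mono) (rule closed)
    fix q assume q: "q \<in> A_seminorms hb p"
    obtain \<epsilon> C1 where C1: "0 < \<epsilon>" "0 \<le> C1"
      "\<And>a A. a \<in> subfactorial \<Longrightarrow> fact_bounded \<epsilon> A a \<Longrightarrow> q (cl a) \<le> C1 * A"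
      by (rule A_seminorm_upper[OF hb q]) (rule that; assumption)
    obtain r C2 where C2: "r \<in> A_seminorms hb p" "0 \<le> C2"
      "\<And>a. a \<in> subfactorial \<Longrightarrow> fact_bounded \<epsilon> (C2 * r (cl a)) a"
      by (rule A_seminorm_lower[OF hb C1(1), of p]) (rule that; assumption)
    have le: "q (A_conj hb p u \<ominus>\<^bsub>M\<^esub> A_conj hb p x) \<le> C1 * (C2 * r (u \<ominus>\<^bsub>M\<^esub> x))" if u: "u \<in> carrier M" for u
    proof -
      obtain a b where ab: "a \<in> subfactorial" "b \<in> subfactorial" "u = cl a" "x = cl b"
        using u x unfolding carrier_M by blast
      have "fact_bounded \<epsilon> (C2 * r (cl (\<lambda>K. a K - b K))) (jet_cnj (\<lambda>K. a K - b K))"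
        by (intro fact_bounded_cnj C2(3) subfactorial_diff ab)
      from C1(3)[OF subfactorial_cnj[OF subfactorial_diff[OF ab(1,2)]] this] show ?thesis
        unfolding ab A_conj_class[OF hb ab(1)] A_conj_class[OF hb ab(2)] minus_cl[OF ab(1,2)]
          minus_cl[OF subfactorial_cnj[OF ab(1)] subfactorial_cnj[OF ab(2)]]
        by (simp add: jet_cnj_def)
    qed
    have b: "((\<lambda>u. C1 * (C2 * r (u \<ominus>\<^bsub>M\<^esub> x))) \<longlongrightarrow> 0) (atin T x)"
      by (intro tendsto_mult_right_zero lims(2) C2(1))
    show "((\<lambda>u. q (A_conj hb p u \<ominus>\<^bsub>M\<^esub> A_conj hb p x)) \<longlongrightarrow> 0) (atin T x)"
    proof (rule tendsto_sandwich[OF _ _ tendsto_const b])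
      show "\<forall>\<^sub>F u in atin T x. 0 \<le> q (A_conj hb p u \<ominus>\<^bsub>M\<^esub> A_conj hb p x)"
        using lims(1) by (rule eventually_mono) (intro seminorm_minus_nonneg q closed x)
      show "\<forall>\<^sub>F u in atin T x. q (A_conj hb p u \<ominus>\<^bsub>M\<^esub> A_conj hb p x) \<le> C1 * (C2 * r (u \<ominus>\<^bsub>M\<^esub> x))"
        using lims(1) by (rule eventually_mono) (rule le)
    qed
  qed
qed

end

section \<open>The algebra and its involution\<close>

lemma frechet_algebra_wick:
  assumes "0 < hb"
  shows "frechet_algebra (wick_algebra hb p \<alpha>) (A_topology hb p)"
proof -
  let ?M = "wick_algebra hb p \<alpha>"
  interpret jet_module hb p ?M by (rule jet_module_wick_algebra[OF assms])
  have mult: "x \<otimes>\<^bsub>?M\<^esub> y = wick hb p \<alpha> x y" for x y by (simp add: wick_algebra_def)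
  have "frechet_algebra_axioms ?M (A_topology hb p)"
  proof (rule frechet_algebra_axioms.intro; unfold mult)
    fix x y assume xy: "x \<in> carrier ?M" "y \<in> carrier ?M"
    show "wick hb p \<alpha> x y \<in> carrier ?M" by (rule wick_closed[OF xy])
    obtain a b where ab: "a \<in> subfactorial" "b \<in> subfactorial" "x = cl a" "y = cl b"
      using xy unfolding carrier_M by blast
    note sub = subfactorial_add subfactorial_scale wick_sum_subfactorial
    show "wick hb p \<alpha> (c \<odot>\<^bsub>?M\<^esub> x) y = c \<odot>\<^bsub>?M\<^esub> wick hb p \<alpha> x y" for c
      by (simp add: ab smult_cl sub wick_jet_class[OF assms] wick_sum_scale_left)
    show "wick hb p \<alpha> x (c \<odot>\<^bsub>?M\<^esub> y) = c \<odot>\<^bsub>?M\<^esub> wick hb p \<alpha> x y" for c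
      by (simp add: ab smult_cl sub wick_jet_class[OF assms] wick_sum_scale_right)
    fix z assume z: "z \<in> carrier ?M"
    obtain c where c: "c \<in> subfactorial" "z = cl c"
      using z unfolding carrier_M by blast
    show "wick hb p \<alpha> (x \<oplus>\<^bsub>?M\<^esub> y) z = wick hb p \<alpha> x z \<oplus>\<^bsub>?M\<^esub> wick hb p \<alpha> y z"
      by (simp add: ab c add_cl sub wick_jet_class[OF assms] wick_sum_add_left)
    show "wick hb p \<alpha> x (y \<oplus>\<^bsub>?M\<^esub> z) = wick hb p \<alpha> x y \<oplus>\<^bsub>?M\<^esub> wick hb p \<alpha> x z"
      by (simp add: ab c add_cl sub wick_jet_class[OF assms] wick_sum_add_right)
  qed (rule wick_continuous)
  then show ?thesis by (rule frechet_algebra.intro[OF frechet_space_M])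
qed

lemma frechet_star_algebra_wick:
  assumes "0 < hb"
  shows "frechet_star_algebra (wick_algebra hb p (of_real hb)) (A_topology hb p) (A_conj hb p)"
proof -
  let ?M = "wick_algebra hb p (of_real hb)"
  interpret jet_module hb p ?M by (rule jet_module_wick_algebra[OF assms])
  have mult: "x \<otimes>\<^bsub>?M\<^esub> y = wick hb p (of_real hb) x y" for x y by (simp add: wick_algebra_def)
  note conj = A_conj_class[OF assms]
  have "frechet_star_algebra_axioms ?M (A_topology hb p) (A_conj hb p)"
  proof (rule frechet_star_algebra_axioms.intro; (unfold mult)?)
    fix x assume "x \<in> carrier ?M"
    then obtain a where a: "a \<in> subfactorial" "x = cl a" unfolding carrier_M by blast
    show "A_conj hb p x \<in> carrier ?M" by (simp add: a conj cl_closed subfactorial_cnj)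
    show "A_conj hb p (c \<odot>\<^bsub>?M\<^esub> x) = cnj c \<odot>\<^bsub>?M\<^esub> A_conj hb p x" for c
      by (simp add: a conj smult_cl subfactorial_cnj subfactorial_scale) (simp add: jet_cnj_def)
    show "A_conj hb p (A_conj hb p x) = x"
      by (simp add: a conj subfactorial_cnj) (simp add: jet_cnj_def)
    fix y assume "y \<in> carrier ?M"
    then obtain b where b: "b \<in> subfactorial" "y = cl b" unfolding carrier_M by blast
    show "A_conj hb p (x \<oplus>\<^bsub>?M\<^esub> y) = A_conj hb p x \<oplus>\<^bsub>?M\<^esub> A_conj hb p y"
      by (simp add: a b conj add_cl subfactorial_cnj subfactorial_add) (simp add: jet_cnj_def)
    \<comment> \<open>The parameter \<open>of_real hb\<close> is real, as
      \<open>wick_sum_cnj\<close> demands.\<close>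
    show "A_conj hb p (wick hb p (of_real hb) x y) = wick hb p (of_real hb) (A_conj hb p y) (A_conj hb p x)"
      by (simp add: a b conj wick_jet_class[OF assms] wick_sum_subfactorial subfactorial_cnj wick_sum_cnj)
  qed (rule A_conj_continuous)
  then show ?thesis by (rule frechet_star_algebra.intro[OF frechet_algebra_wick[OF assms]])
qed

theorem theorem4p5:
  fixes p :: "complex ^ 'n" and hb :: real
  assumes "0 < hb"
  shows "(\<forall>\<alpha>.
            (\<forall>F\<in>carrier (A_space hb p). \<forall>G\<in>carrier (A_space hb p).
               abs_convergent_to (A_space hb p) (A_topology hb p)
                 (wick_term hb p \<alpha> F G) (wick hb p \<alpha> F G)) \<and>
            frechet_algebra (wick_algebra hb p \<alpha>) (A_topology hb p) \<and>
            (\<forall>F\<in>carrier (A_space hb p). \<forall>G\<in>carrier (A_space hb p). \<forall>H\<in>carrier (A_space hb p).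
               wick hb p \<alpha> (wick hb p \<alpha> F G) H = wick hb p \<alpha> F (wick hb p \<alpha> G H))) \<and>
         frechet_star_algebra (wick_algebra hb p (of_real hb)) (A_topology hb p) (A_conj hb p)"
proof (intro conjI allI ballI)
  note car = carrier_A_space[OF assms, of p]
  fix \<alpha> F G assume "F \<in> carrier (A_space hb p)" "G \<in> carrier (A_space hb p)"
  then obtain a b where ab: "a \<in> subfactorial" "b \<in> subfactorial" "F = jet_class p a" "G = jet_class p b"
    unfolding car by blast
  show "abs_convergent_to (A_space hb p) (A_topology hb p) (wick_term hb p \<alpha> F G) (wick hb p \<alpha> F G)"
    unfolding ab wick_jet_class[OF assms ab(1,2)] by (rule abs_convergent_wick[OF assms ab(1,2)])
  fix H assume "H \<in> carrier (A_space hb p)"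
  then obtain c where c: "c \<in> subfactorial" "H = jet_class p c"
    unfolding car by blast
  show "wick hb p \<alpha> (wick hb p \<alpha> F G) H = wick hb p \<alpha> F (wick hb p \<alpha> G H)"
    by (simp add: ab c wick_jet_class[OF assms] wick_sum_subfactorial wick_sum_assoc)
qed (use assms frechet_algebra_wick frechet_star_algebra_wick in blast)+

end
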